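(* Let $k$ be an algebraically closed field and let $f_1,\dots,f_m \in k[x_1,\dots,x_n]$ be polynomials of total degrees at most $d$ whose transcendence degree is $r$. Let $S$ be a finite subset of $k$, and for $1\le i\le r+1$ define $g_i := \sum_{j=i}^{m} c_{ij} f_j$, where each coefficient $c_{ij}$ is picked independently and uniformly at random from $S$. Then with probability at least $1 - d^{(r+1)m}/|S|$ we have $V(\langle f_1,\dots,f_m\rangle) = V(\langle g_1,\dots,g_{r+1}\rangle)$.
   Context: The transcendence degree of a set of polynomials is the size of any maximal algebraically independent (over $k$) subset of it. For an ideal $I \subseteq k[x_1,\dots,x_n]$, $V(I)\subseteq k^n$ denotes its set of common zeros.
   Formalization: The degree bound d is assumed to be at least 2, since the claim fails for d = 0 (f_1 = 1, 0 in S) and d = 1 (f = x_1, x_2, S = {0,1}: probability 1/4 < 1/2); polynomials of degree at most 1 are covered with d = 2. S is taken nonempty. *)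

theory Defs
  imports
    "HOL-Probability.Probability"
    "HOL-Library.Poly_Mapping"
    "HOL-Computational_Algebra.Polynomial"
begin

text \<open>
  Polynomials over \<open>'a\<close> in variables indexed by \<open>'v\<close>: a monomial is an exponent vector of
  finite support, a polynomial a finitely supported family of coefficients. The ring structure
  is the one from \<^theory>\<open>HOL-Library.Poly_Mapping\<close>. The ring \<open>k[x\<^sub>1,\<dots>,x\<^sub>n]\<close> is
  \<open>('n, 'k) mpoly\<close> with \<open>'n\<close> a finite type having \<open>n\<close> elements, and \<open>k\<^sup>n\<close> is \<open>'k ^ 'n\<close>.
\<close>

type_synonym ('v, 'a) mpoly = "('v \<Rightarrow>\<^sub>0 nat) \<Rightarrow>\<^sub>0 'a"

definition mpoly_const :: "'a::zero \<Rightarrow> ('v, 'a) mpoly" where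
  "mpoly_const a = Poly_Mapping.single 0 a"

text \<open>
  Substitution of the values \<open>x v\<close> for the variables, the coefficients being mapped by \<open>h\<close>:
  the identity when evaluating at points over the coefficient field, and \<^const>\<open>mpoly_const\<close>
  when polynomials are substituted for the variables.
\<close>

definition mpoly_subst ::
    "('a::zero \<Rightarrow> 'b::comm_semiring_1) \<Rightarrow> ('v \<Rightarrow> 'b) \<Rightarrow> ('v, 'a) mpoly \<Rightarrow> 'b" where
  "mpoly_subst h x p =
     (\<Sum>m\<in>Poly_Mapping.keys p. h (Poly_Mapping.lookup p m) *
        (\<Prod>v\<in>Poly_Mapping.keys m. x v ^ Poly_Mapping.lookup m v))"

definition mpoly_eval :: "'a::comm_semiring_1 ^ 'n \<Rightarrow> ('n, 'a) mpoly \<Rightarrow> 'a" where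
  "mpoly_eval x p = mpoly_subst (\<lambda>a. a) (\<lambda>v. x $ v) p"

text \<open>The zero polynomial gets total degree \<open>0\<close>.\<close>

definition total_degree :: "('v, 'a::zero) mpoly \<Rightarrow> nat" where
  "total_degree p =
     Max (insert 0 ((\<lambda>m. \<Sum>v\<in>Poly_Mapping.keys m. Poly_Mapping.lookup m v) ` Poly_Mapping.keys p))"

text \<open>
  A possible algebraic relation between the members of a set \<open>B\<close> of polynomials is a polynomial
  \<open>P\<close> in one fresh variable for each member of \<open>B\<close>. It is convenient to let the elements of \<open>B\<close>
  themselves index these variables, so that plugging \<open>B\<close> into \<open>P\<close> substitutes \<open>b\<close> for the
  variable with index \<open>b\<close>.
\<close>

definition alg_independent :: "('v, 'a::comm_ring_1) mpoly set \<Rightarrow> bool" where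
  "alg_independent B \<longleftrightarrow>
     (\<forall>P :: (('v, 'a) mpoly, 'a) mpoly.
        (\<forall>m\<in>Poly_Mapping.keys P. Poly_Mapping.keys m \<subseteq> B) \<longrightarrow>
        mpoly_subst mpoly_const (\<lambda>b. b) P = 0 \<longrightarrow> P = 0)"

definition maximal_alg_independent ::
    "('v, 'a::comm_ring_1) mpoly set \<Rightarrow> ('v, 'a) mpoly set \<Rightarrow> bool" where
  "maximal_alg_independent F B \<longleftrightarrow>
     B \<subseteq> F \<and> alg_independent B \<and> (\<forall>B'. B \<subset> B' \<and> B' \<subseteq> F \<longrightarrow> \<not> alg_independent B')"

text \<open>
  All maximal algebraically independent subsets have the same size, so the choice made here is
  immaterial.
\<close>

definition trdeg :: "('v, 'a::comm_ring_1) mpoly set \<Rightarrow> nat" where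
  "trdeg F = card (SOME B. maximal_alg_independent F B)"

lemma module_ring_mult: "module ((*) :: 'a::comm_ring_1 \<Rightarrow> 'a \<Rightarrow> 'a)"
  by unfold_locales (simp_all add: algebra_simps)

text \<open>The ideal generated by \<open>F\<close>, as the submodule of the ring generated by \<open>F\<close>.\<close>

definition ideal_gen :: "'a::comm_ring_1 set \<Rightarrow> 'a set" where
  "ideal_gen F = module.span (*) F"

definition zero_locus :: "('n, 'a::comm_ring_1) mpoly set \<Rightarrow> ('a ^ 'n) set" where
  "zero_locus I = {x. \<forall>p\<in>I. mpoly_eval x p = 0}"

definition lin_comb ::
    "(nat \<Rightarrow> ('v, 'a::comm_ring_1) mpoly) \<Rightarrow> nat \<Rightarrow> (nat \<times> nat \<Rightarrow> 'a) \<Rightarrow> nat \<Rightarrow> ('v, 'a) mpoly" where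
  "lin_comb f m c i = (\<Sum>j\<in>{i..m}. mpoly_const (c (i, j)) * f j)"

text \<open>
  Independent uniform choices from \<open>S\<close> of the coefficients \<open>c (i, j)\<close> for \<open>1 \<le> i \<le> s\<close> and
  \<open>i \<le> j \<le> m\<close>; the entries outside this range are not used and are fixed to \<open>0\<close>.
\<close>

definition random_coeffs :: "'a::zero set \<Rightarrow> nat \<Rightarrow> nat \<Rightarrow> (nat \<times> nat \<Rightarrow> 'a) pmf" where
  "random_coeffs S s m = Pi_pmf (SIGMA i:{1..s}. {i..m}) 0 (\<lambda>_. pmf_of_set S)"

end

theory Submission
  imports Defs
begin

text \<open>
  It suffices to find a nonzero polynomial \<open>R\<close> of degree at most \<open>d ^ ((r + 1) * m)\<close> in the
  coefficients \<open>c\<close> such that the \<open>f\<^sub>j\<close> vanish wherever the \<open>g\<^sub>i\<close> do as soon as \<open>R c\<close> is nonzero; the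
  Schwartz--Zippel lemma does the rest.

  The span of the monomials of degree at most \<open>N\<close> in the \<open>f\<^sub>j\<close> has dimension at most
  \<open>(d * N + r) choose r\<close>: with respect to a monomial order, the leading exponents of the elements of
  \<open>k[f\<^sub>1, \<dots>, f\<^sub>m]\<close> lie in a space of dimension \<open>r\<close>, because \<open>r + 1\<close> independent ones would make the
  algebra grow too fast, and \<open>r\<close> suitable coordinates determine a vector of that space.
  For large \<open>N\<close> this is much smaller than the number of monomials of degree \<open>N\<close> in \<open>r + 2\<close> variables, so
  \<open>r + 2\<close> linear combinations of the \<open>f\<^sub>j\<close> with indeterminate coefficients satisfy a homogeneous relation
  of degree \<open>N\<close> whose coefficients are polynomials of controlled degree in these indeterminates. After adding
  multiples of the last combination \<open>L\<close> to the others, the relation involves \<open>L ^ N\<close> with a nonzero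
  coefficient \<open>R\<close>, so that \<open>L\<close> vanishes where the other \<open>r + 1\<close> combinations do, unless \<open>R\<close> is zero. As \<open>L\<close> is
  generic, all \<open>f\<^sub>j\<close> vanish there. Row operations bring the coefficient matrix of the \<open>r + 1\<close>
  combinations into the triangular shape of \<open>c\<close>.
\<close>

text \<open>Two dimension bounds are needed because the first one is crude. Clearing denominators
  gives a bound with constants \<open>C\<close> and \<open>k\<close> that are not controlled; it
  fixes only the order of growth, and hence the rank \<open>r\<close> of the leading exponents.
  Counting these exponents then gives a bound in \<open>d\<close>, \<open>N\<close> and
  \<open>r\<close> alone, so that \<open>N\<close> can be chosen explicitly and the degree of
  \<open>R\<close> estimated.

  The relation comes from counting unknowns. A product of powers of the forms, with exponent
  \<open>a i\<close> for form \<open>i\<close> and total degree \<open>N\<close>, is multiplied by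
  monomials of degree \<open>\<delta> - a i\<close> in the entries of row \<open>i\<close>. All
  these products have degree \<delta> in every row and therefore share one space. The value
  \<open>N = 2 * (r + 1) * d ^ r\<close> makes the exponent vectors \<open>a\<close> more than twice
  as numerous as the dimension bound, and \<open>\<delta> + 1 = 2 * (m - 1) * N\<close> limits the
  loss caused by the padding to a factor 2. As the row of \<open>L\<close> is finally specialised to
  constants, \<open>R\<close> has degree at most \<open>(r + 1) * \<delta>\<close>, which stays
  below \<open>d ^ ((r + 1) * m)\<close>.\<close>

lemma infinite_alg_closed: "infinite (UNIV :: 'k::alg_closed_field set)"
proof
  assume fin: "finite (UNIV :: 'k set)"
  \<comment> \<open>As in Euclid's proof for primes: the product of all linear factors vanishes
    everywhere, so adding 1 gives a nonconstant polynomial without roots.\<close>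
  define q :: "'k poly" where "q = (\<Prod>a\<in>UNIV. [:- a, 1:])"
  have "degree q = card (UNIV :: 'k set)"
    unfolding q_def by (subst degree_prod_eq_sum_degree) auto
  then have "degree (q + 1) > 0"
    using fin by (subst degree_add_eq_left) (auto simp: card_gt_0_iff)
  then obtain x where "poly (q + 1) x = 0"
    using alg_closed_imp_poly_has_root by blast
  moreover have "poly q x = 0"
    using fin by (auto simp: q_def poly_prod)
  ultimately show False by simp
qed

section \<open>Polynomial functions\<close>

text \<open>Functions take the place of formal polynomials: being nonzero means having a point with
  nonzero value, and substitution is composition. The index is only an upper bound of the degree, so
  that sums need no maximum.\<close>

inductive polyfun :: "nat \<Rightarrow> (('v \<Rightarrow> 'k::field) \<Rightarrow> 'k) \<Rightarrow> bool" where
  const: "polyfun D (\<lambda>_. c)"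
| var: "polyfun (Suc D) (\<lambda>y. y v)"
| add: "polyfun D F \<Longrightarrow> polyfun D G \<Longrightarrow> polyfun D (\<lambda>y. F y + G y)"
| mult: "polyfun D F \<Longrightarrow> polyfun E G \<Longrightarrow> polyfun (D + E) (\<lambda>y. F y * G y)"

lemma polyfun_mono: "polyfun D F \<Longrightarrow> D \<le> E \<Longrightarrow> polyfun E F"
proof (induction arbitrary: E rule: polyfun.induct)
  case (const D c) show ?case by (rule polyfun.const)
next
  case (var D v)
  then obtain E' where "E = Suc E'" using Suc_le_D by blast
  then show ?case by (simp add: polyfun.var)
next
  case (add D F G)
  then show ?case by (simp add: polyfun.add)
next
  case (mult D F D' G)
  then have "polyfun D F" "polyfun (E - D) G" "E = D + (E - D)" by simp_all
  then show ?case using polyfun.mult by metis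
qed

lemma polyfun_sum: "(\<And>i. i \<in> I \<Longrightarrow> polyfun D (F i)) \<Longrightarrow> polyfun D (\<lambda>y. \<Sum>i\<in>I. F i y)"
  by (induction I rule: infinite_finite_induct) (simp_all add: polyfun.const polyfun.add)

lemma polyfun_prod:
  "(\<And>i. i \<in> I \<Longrightarrow> polyfun (D i) (F i)) \<Longrightarrow> polyfun (\<Sum>i\<in>I. D i) (\<lambda>y. \<Prod>i\<in>I. F i y)"
  by (induction I rule: infinite_finite_induct) (simp_all add: polyfun.const polyfun.mult)

lemma polyfun_power: "polyfun D F \<Longrightarrow> polyfun (n * D) (\<lambda>y. F y ^ n)"
  by (induction n) (simp_all add: polyfun.const polyfun.mult)

lemma polyfun_compose:
  assumes "polyfun D F" "\<And>v. polyfun (Suc 0) (\<lambda>z. h z v)"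
  shows "polyfun D (\<lambda>z. F (h z))"
  using assms(1)
proof induction
  case (var D v)
  then show ?case using polyfun_mono[OF assms(2)] by simp
qed (simp_all add: polyfun.const polyfun.add polyfun.mult)

lemma polyfun_line:
  assumes "polyfun D F"
  shows "\<exists>p :: 'k::field poly. \<forall>s. F (\<lambda>v. a v + s * b v) = poly p s"
  using assms
proof induction
  case (const D c)
  then show ?case by (intro exI[of _ "[:c:]"]) simp
next
  case (var D v)
  then show ?case by (intro exI[of _ "[:a v, b v:]"]) (simp add: algebra_simps)
next
  case (add D F  G)
  from add.IH(1) obtain p where "\<forall>s. F (\<lambda>v. a v + s * b v) = poly p s" by (elim exE)
  moreover from add.IH(2) obtain q where "\<forall>s. G (\<lambda>v. a v + s * b v) = poly q s" by (elim exE)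
  ultimately show ?case by (intro exI[of _ "p + q"]) simp
next
  case (mult D F E G)
  from mult.IH(1) obtain p where "\<forall>s. F (\<lambda>v. a v + s * b v) = poly p s" by (elim exE)
  moreover from mult.IH(2) obtain q where "\<forall>s. G (\<lambda>v. a v + s * b v) = poly q s" by (elim exE)
  ultimately show ?case by (intro exI[of _ "p * q"]) simp
qed

text \<open>On the line through the two witnesses both functions are univariate polynomials, nonzero
  at the parameters 0 and 1 respectively; their product has finitely many roots.\<close>

lemma polyfun_common_nonzero:
  fixes F G :: "('v \<Rightarrow> 'k::field) \<Rightarrow> 'k"
  assumes inf: "infinite (UNIV :: 'k set)"
    and "polyfun D F" "polyfun E G" and "F a \<noteq> 0" "G b \<noteq> 0"
  shows "\<exists>s. F (\<lambda>v. a v + s * (b v - a v)) \<noteq> 0 \<and> G (\<lambda>v. a v + s * (b v - a v)) \<noteq> 0"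
proof -
  obtain p q where p: "\<And>s. F (\<lambda>v. a v + s * (b v - a v)) = poly p s"
    and q: "\<And>s. G (\<lambda>v. a v + s * (b v - a v)) = poly q s"
    using polyfun_line[OF assms(2)] polyfun_line[OF assms(3)] by metis
  have "poly p 0 \<noteq> 0" "poly q 1 \<noteq> 0"
    using p[of 0] q[of 1] assms(4,5) by simp_all
  then have "p * q \<noteq> 0" by auto
  then have "finite {s. poly (p * q) s = 0}" by (rule poly_roots_finite)
  then obtain s where "s \<notin> {s. poly (p * q) s = 0}"
    using inf ex_new_if_finite by blast
  then show ?thesis using p q by auto
qed

text \<open>The loss of \<open>i\<close> degrees in the coefficient of the \<open>i\<close>-th power
  is what pays for the sliced variable in the Schwartz--Zippel induction. Invariance of
  \<open>p\<close> under changes at \<open>v\<close> lets that variable be drawn separately.\<close>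

lemma polyfun_as_poly:
  fixes F :: "('v \<Rightarrow> 'k::field) \<Rightarrow> 'k"
  assumes "polyfun D F"
  shows "\<exists>p. (\<forall>y. F y = poly (p y) (y v)) \<and> (\<forall>y t. p (y(v := t)) = p y)
           \<and> (\<forall>y. degree (p y) \<le> D) \<and> (\<forall>i\<le>D. polyfun (D - i) (\<lambda>y. coeff (p y) i))"
  using assms
proof induction
  case (const D c)
  show ?case
    by (intro exI[of _ "\<lambda>_. [:c:]"] conjI allI impI polyfun.const) simp_all
next
  case (var D w)
  show ?case
  proof (cases "w = v")
    case True
    then show ?thesis by (intro exI[of _ "\<lambda>_. [:0, 1:]"]) (simp add: polyfun.const)
  next
    case False
    have "\<forall>i\<le>Suc D. polyfun (Suc D - i) (\<lambda>y. coeff [:y w:] i)"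
    proof (intro allI impI)
      fix i assume "i \<le> Suc D"
      show "polyfun (Suc D - i) (\<lambda>y. coeff [:y w:] i)"
        by (cases i) (simp_all add: polyfun.const polyfun.var)
    qed
    then show ?thesis using False by (intro exI[of _ "\<lambda>y. [:y w:]"]) (simp del: coeff_pCons)
  qed
next
  case (add D F G)
  from add.IH(1) obtain p where
    p: "\<forall>y. F y = poly (p y) (y v)" "\<forall>y t. p (y(v := t)) = p y"
     "\<forall>y. degree (p y) \<le> D" "\<forall>i\<le>D. polyfun (D - i) (\<lambda>y. coeff (p y) i)" by (elim exE conjE)
  from add.IH(2) obtain q where
    q: "\<forall>y. G y = poly (q y) (y v)" "\<forall>y t. q (y(v := t)) = q y"
     "\<forall>y. degree (q y) \<le> D" "\<forall>i\<le>D. polyfun (D - i) (\<lambda>y. coeff (q y) i)" by (elim exE conjE)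
  have "\<forall>i\<le>D. polyfun (D - i) (\<lambda>y. coeff (p y + q y) i)"
    using p(4) q(4) by (simp add: polyfun.add)
  then show ?case using p q
    by (intro exI[of _ "\<lambda>y. p y + q y"]) (simp add: degree_add_le del: fun_upd_apply)
next
  case (mult D F E G)
  from mult.IH(1) obtain p where
    p: "\<forall>y. F y = poly (p y) (y v)" "\<forall>y t. p (y(v := t)) = p y"
     "\<forall>y. degree (p y) \<le> D" "\<forall>i\<le>D. polyfun (D - i) (\<lambda>y. coeff (p y) i)" by (elim exE conjE)
  from mult.IH(2) obtain q where
    q: "\<forall>y. G y = poly (q y) (y v)" "\<forall>y t. q (y(v := t)) = q y"
     "\<forall>y. degree (q y) \<le> E" "\<forall>i\<le>E. polyfun (E - i) (\<lambda>y. coeff (q y) i)" by (elim exE conjE)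
  have "polyfun (D + E - l) (\<lambda>y. coeff (p y) i * coeff (q y) (l - i))"
    if "l \<le> D + E" "i \<le> l" for l i
  proof (cases "i \<le> D \<and> l - i \<le> E")
    case True
    then have "D + E - l = (D - i) + (E - (l - i))" using that by arith
    then show ?thesis
      using polyfun.mult[of "D - i" "\<lambda>y. coeff (p y) i" "E - (l - i)" "\<lambda>y. coeff (q y) (l - i)"]
        p(4) q(4) True by simp
  next
    case False
    then have "coeff (p y) i * coeff (q y) (l - i) = 0" for y
      using spec[OF p(3), of y] spec[OF q(3), of y]
        coeff_eq_0[of "p y" i] coeff_eq_0[of "q y" "l - i"] by fastforce
    then show ?thesis by (simp only: polyfun.const)
  qed
  then have "\<forall>l\<le>D + E. polyfun (D + E - l) (\<lambda>y. coeff (p y * q y) l)"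
    unfolding coeff_mult by (intro allI impI polyfun_sum) auto
  moreover have "degree (p y * q y) \<le> D + E" for y
    using p(3) q(3) degree_mult_le[of "p y" "q y"] by (meson add_mono order_trans)
  ultimately show ?case using p q
    by (intro exI[of _ "\<lambda>y. p y * q y"]) (simp del: fun_upd_apply)
qed

lemma prob_pmf_of_set_poly_root:
  fixes p :: "'k::field poly"
  assumes "finite S" "S \<noteq> {}" "p \<noteq> 0"
  shows "measure_pmf.prob (pmf_of_set S) {t. poly p t = 0} \<le> degree p / card S"
proof -
  have "card (S \<inter> {t. poly p t = 0}) \<le> degree p"
    using card_mono[OF poly_roots_finite[OF assms(3)] Int_lower2] card_poly_roots_bound[OF assms(3)]
    by (rule order_trans)
  then show ?thesis using assms
    by (simp add: measure_pmf_of_set divide_right_mono)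
qed

text \<open>Schwartz--Zippel, by slicing off one variable: the induction continues with the leading
  coefficient in that variable.\<close>

lemma prob_polyfun_zero:
  fixes F :: "('v \<Rightarrow> 'k::field) \<Rightarrow> 'k"
  assumes "finite V" "finite S" "S \<noteq> {}"
    and "polyfun D F" "F a \<noteq> 0" "\<And>v. v \<notin> V \<Longrightarrow> a v = 0"
  shows "measure_pmf.prob (Pi_pmf V 0 (\<lambda>_. pmf_of_set S)) {y. F y = 0} \<le> D / card S"
  using assms(1,4-)
proof (induction V arbitrary: F D a rule: finite_induct)
  case empty
  then have "a = (\<lambda>_. 0)" by auto
  then show ?case using empty by simp
next
  case (insert v V)
  from polyfun_as_poly[OF insert.prems(1), of v] obtain p where
    p: "\<forall>y. F y = poly (p y) (y v)" "\<forall>y t. p (y(v := t)) = p y"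
      "\<forall>y. degree (p y) \<le> D" "\<forall>i\<le>D. polyfun (D - i) (\<lambda>y. coeff (p y) i)"
    by (elim exE conjE)
  define supp where "supp = {y :: 'v \<Rightarrow> 'k. \<forall>w. w \<notin> V \<longrightarrow> y w = 0}"
  \<comment> \<open>Only points vanishing off \<open>V\<close> count, because the induction
    hypothesis asks for a witness of that kind for the top coefficient.\<close>
  define I where "I = {i. \<exists>y\<in>supp. coeff (p y) i \<noteq> 0}"
  have I_le: "I \<subseteq> {..D}"
  proof
    fix i assume "i \<in> I"
    then obtain y where "coeff (p y) i \<noteq> 0" by (auto simp: I_def)
    then show "i \<in> {..D}" using le_degree spec[OF p(3), of y] order_trans by fastforce
  qed
  then have finI: "finite I" using finite_subset by blast
  have "a(v := 0) \<in> supp" using insert.prems(3) by (auto simp: supp_def)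
  moreover have "p (a(v := 0)) \<noteq> 0"
    using spec[OF p(1), of a] p(2) insert.prems(2) by (auto simp del: fun_upd_apply)
  ultimately have "degree (p (a(v := 0))) \<in> I"
    unfolding I_def by (intro CollectI bexI[of _ "a(v := 0)"]) auto
  then have "I \<noteq> {}" by blast
  define e where "e = Max I"
  have "e \<in> I" using finI \<open>I \<noteq> {}\<close> e_def by auto
  then obtain b where b: "b \<in> supp" "coeff (p b) e \<noteq> 0" unfolding I_def by blast
  have eD: "e \<le> D" using \<open>e \<in> I\<close> I_le by blast
  have deg: "degree (p y) \<le> e" if "y \<in> supp" for y
  proof (cases "p y = 0")
    case False
    then have "degree (p y) \<in> I"
      using that unfolding I_def by (intro CollectI bexI[of _ y]) auto
    then show ?thesis unfolding e_def using finI by (rule Max_ge[rotated])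
  qed simp
  let ?M = "Pi_pmf V 0 (\<lambda>_. pmf_of_set S)"
  let ?Z = "{y. coeff (p y) e = 0}"
  have IH: "measure_pmf.prob ?M ?Z \<le> (D - e) / card S"
    using insert.IH[OF p(4)[rule_format, OF eD] b(2)] b(1) by (simp add: supp_def)
  \<comment> \<open>The coordinates are independent and may be drawn in any order; \<open>v\<close>
    comes last, when the slice \<open>p y\<close> is already fixed.\<close>
  have Pi: "Pi_pmf (insert v V) 0 (\<lambda>_. pmf_of_set S)
      = bind_pmf ?M (\<lambda>y. map_pmf (\<lambda>t. y(v := t)) (pmf_of_set S))"
    unfolding Pi_pmf_insert'[OF insert.hyps(1,2)] map_pmf_def by (rule bind_commute_pmf)
  have F_upd: "F (y(v := t)) = poly (p y) t" for y t
    using spec[OF p(1), of "y(v := t)"] p(2) by (simp only: fun_upd_same)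
  have "emeasure (Pi_pmf (insert v V) 0 (\<lambda>_. pmf_of_set S)) {y. F y = 0}
      = (\<integral>\<^sup>+y. emeasure (pmf_of_set S) {t. poly (p y) t = 0} \<partial>?M)"
    unfolding Pi emeasure_bind_pmf emeasure_map_pmf vimage_def mem_Collect_eq F_upd ..
  \<comment> \<open>Where the coefficient of degree \<open>e\<close> vanishes the trivial bound 1 is
    used; elsewhere at most \<open>e\<close> values of \<open>t\<close> are roots.\<close>
  also have "\<dots> \<le> (\<integral>\<^sup>+y. indicator ?Z y + ennreal (real e / card S) \<partial>?M)"
  proof (intro nn_integral_mono_AE AE_pmfI)
    fix y assume "y \<in> set_pmf ?M"
    then have ys: "y \<in> supp"
      using set_Pi_pmf_subset[OF insert.hyps(1)] by (fastforce simp: supp_def PiE_dflt_def)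
    show "emeasure (pmf_of_set S) {t. poly (p y) t = 0} \<le> indicator ?Z y + ennreal (real e / card S)"
    proof (cases "coeff (p y) e = 0")
      case True
      have "emeasure (pmf_of_set S) {t. poly (p y) t = 0} \<le> 1 + 0"
        using measure_pmf.emeasure_le_1 by simp
      also have "\<dots> \<le> indicator ?Z y + ennreal (real e / card S)"
        using True by (intro add_mono) simp_all
      finally show ?thesis .
    next
      case False
      then have "p y \<noteq> 0" by auto
      have "measure_pmf.prob (pmf_of_set S) {t. poly (p y) t = 0} \<le> degree (p y) / card S"
        using prob_pmf_of_set_poly_root[OF assms(2,3) \<open>p y \<noteq> 0\<close>] .
      also have "\<dots> \<le> e / card S" using deg[OF ys] by (simp add: divide_right_mono)
      finally show ?thesis using False
        by (simp add: measure_pmf.emeasure_eq_measure ennreal_leI)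
    qed
  qed
  also have "\<dots> = emeasure ?M ?Z + ennreal (real e / card S)"
    by (subst nn_integral_add) simp_all
  also have "\<dots> = ennreal (measure_pmf.prob ?M ?Z + e / card S)"
    by (simp add: measure_pmf.emeasure_eq_measure)
  finally have "measure_pmf.prob (Pi_pmf (insert v V) 0 (\<lambda>_. pmf_of_set S)) {y. F y = 0}
      \<le> measure_pmf.prob ?M ?Z + e / card S"
    by (simp add: measure_pmf.emeasure_eq_measure del: ennreal_plus)
  also have "\<dots> \<le> D / card S"
    using IH eD by (simp add: of_nat_diff diff_divide_distrib)
  finally show ?case .
qed

section \<open>Monomials\<close>

definition exps :: "'v set \<Rightarrow> nat \<Rightarrow> ('v \<Rightarrow> nat) set" where
  "exps V t = {\<alpha>. (\<forall>v. v \<notin> V \<longrightarrow> \<alpha> v = 0) \<and> (\<Sum>v\<in>V. \<alpha> v) = t}"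

definition exps_le :: "'v set \<Rightarrow> nat \<Rightarrow> ('v \<Rightarrow> nat) set" where
  "exps_le V t = {\<alpha>. (\<forall>v. v \<notin> V \<longrightarrow> \<alpha> v = 0) \<and> (\<Sum>v\<in>V. \<alpha> v) \<le> t}"

lemma exps_le_card:
  fixes V :: "'v set"
  assumes "finite V"
  shows "finite (exps_le V t) \<and> card (exps_le V t) = (t + card V) choose card V"
  using assms
proof (induction V arbitrary: t rule: finite_induct)
  case empty
  have "exps_le ({} :: 'v set) t = {\<lambda>_. 0}" by (auto simp: exps_le_def)
  then show ?case by simp
next
  case (insert v V)
  define P where "P s = (\<lambda>\<alpha>. \<alpha>(v := s)) ` exps_le V (t - s)" for s
  have sum_upd: "(\<Sum>w\<in>V. (\<alpha>(v := s)) w) = (\<Sum>w\<in>V. \<alpha> w)" for \<alpha> :: "'v \<Rightarrow> nat" and s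
    using insert.hyps by (intro sum.cong) auto
  have eq: "exps_le (insert v V) t = (\<Union>s\<in>{..t}. P s)"
  proof (intro equalityI subsetI)
    fix \<alpha> assume "\<alpha> \<in> exps_le (insert v V) t"
    then have "\<alpha>(v := 0) \<in> exps_le V (t - \<alpha> v)" "\<alpha> v \<le> t"
      using insert.hyps sum_upd[of \<alpha> 0] by (auto simp: exps_le_def)
    moreover have "\<alpha> = (\<alpha>(v := 0))(v := \<alpha> v)" by simp
    ultimately show "\<alpha> \<in> (\<Union>s\<in>{..t}. P s)" unfolding P_def by blast
  next
    fix \<alpha> assume "\<alpha> \<in> (\<Union>s\<in>{..t}. P s)"
    then obtain s \<beta> where "s \<le> t" "\<beta> \<in> exps_le V (t - s)" "\<alpha> = \<beta>(v := s)"
      unfolding P_def by auto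
    then show "\<alpha> \<in> exps_le (insert v V) t"
      using insert.hyps sum_upd[of \<beta> s] by (auto simp: exps_le_def)
  qed
  have fin: "finite (P s)" for s unfolding P_def using insert.IH by blast
  have inj: "inj_on (\<lambda>\<alpha>. \<alpha>(v := s)) (exps_le V u)" for s u
  proof (rule inj_onI)
    fix \<alpha> \<beta> assume *: "\<alpha> \<in> exps_le V u" "\<beta> \<in> exps_le V u" "\<alpha>(v := s) = \<beta>(v := s)"
    then have "\<alpha> v = 0" "\<beta> v = 0" using insert.hyps by (auto simp: exps_le_def)
    then show "\<alpha> = \<beta>" using *(3) by (metis fun_upd_triv fun_upd_upd)
  qed
  have "card (exps_le (insert v V) t) = (\<Sum>s\<le>t. card (P s))"
    unfolding eq using fin
    by (intro card_UN_disjoint) (auto simp: P_def dest: fun_cong[where x = v])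
  also have "\<dots> = (\<Sum>s\<le>t. (t - s + card V) choose card V)"
    unfolding P_def using insert.IH by (simp add: card_image[OF inj])
  also have "\<dots> = (\<Sum>s\<le>t. (s + card V) choose card V)"
    by (rule sum.reindex_bij_witness[where i = "\<lambda>s. t - s" and j = "\<lambda>s. t - s"]) auto
  also have "\<dots> = (t + card (insert v V)) choose card (insert v V)"
    using insert.hyps choose_rising_sum(1)[of "card V" t] by (simp add: add.commute)
  finally show ?case using eq fin by simp
qed

lemmas finite_exps_le = conjunct1[OF exps_le_card]
lemmas card_exps_le = conjunct2[OF exps_le_card]

lemma finite_exps: "finite V \<Longrightarrow> finite (exps V t)"
  using finite_exps_le[of V t] by (rule finite_subset[rotated]) (auto simp: exps_def exps_le_def)

text \<open>In fixed degree the exponent of one variable is determined by the others, which form an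
  arbitrary exponent of degree at most \<open>t\<close>.\<close>

lemma card_exps:
  assumes "finite V" "V \<noteq> {}"
  shows "card (exps V t) = (t + (card V - 1)) choose (card V - 1)"
proof -
  obtain v where v: "v \<in> V" using assms(2) by blast
  define U where "U = V - {v}"
  have V: "V = insert v U" "v \<notin> U" "finite U" using v assms(1) by (auto simp: U_def)
  have sum_upd: "(\<Sum>w\<in>U. (\<alpha>(v := s)) w) = (\<Sum>w\<in>U. \<alpha> w)" for \<alpha> :: "'a \<Rightarrow> nat" and s
    using V by (intro sum.cong) auto
  have "bij_betw (\<lambda>\<alpha>. \<alpha>(v := 0)) (exps V t) (exps_le U t)"
  proof (rule bij_betw_byWitness[where f' = "\<lambda>\<alpha>. \<alpha>(v := t - (\<Sum>w\<in>U. \<alpha> w))"])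
    show "\<forall>\<alpha>\<in>exps V t. (\<alpha>(v := 0))(v := t - (\<Sum>w\<in>U. (\<alpha>(v := 0)) w)) = \<alpha>"
      unfolding sum_upd using V by (auto simp: exps_def fun_eq_iff)
    show "\<forall>\<alpha>\<in>exps_le U t. (\<alpha>(v := t - (\<Sum>w\<in>U. \<alpha> w)))(v := 0) = \<alpha>"
      using V by (auto simp: exps_le_def fun_eq_iff)
    show "(\<lambda>\<alpha>. \<alpha>(v := 0)) ` exps V t \<subseteq> exps_le U t"
      using V sum_upd[of _ 0] by (auto simp: exps_def exps_le_def)
    show "(\<lambda>\<alpha>. \<alpha>(v := t - (\<Sum>w\<in>U. \<alpha> w))) ` exps_le U t \<subseteq> exps V t"
      using V sum_upd by (auto simp: exps_def exps_le_def)
  qed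
  then have "card (exps V t) = card (exps_le U t)" by (rule bij_betw_same_card)
  then show ?thesis using V by (simp add: card_exps_le)
qed

definition mon :: "'v set \<Rightarrow> ('v \<Rightarrow> nat) \<Rightarrow> ('v \<Rightarrow> 'b::comm_semiring_1) \<Rightarrow> 'b" where
  "mon V \<alpha> y = (\<Prod>v\<in>V. y v ^ \<alpha> v)"

lemma mon_add: "mon V (\<lambda>v. \<alpha> v + \<beta> v) y = mon V \<alpha> y * mon V \<beta> y"
  by (simp add: mon_def power_add prod.distrib)

lemma mon_zero: "mon V (\<lambda>_. 0) y = 1"
  by (simp add: mon_def)

lemma mon_Suc:
  assumes "finite V" "v \<in> V"
  shows "mon V (\<alpha>(v := Suc (\<alpha> v))) y = y v * mon V \<alpha> y"
proof -
  have "(\<Prod>w\<in>V - {v}. y w ^ (\<alpha>(v := Suc (\<alpha> v))) w) = (\<Prod>w\<in>V - {v}. y w ^ \<alpha> w)"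
    by (intro prod.cong) auto
  then show ?thesis using assms by (simp add: mon_def prod.remove[of V v] mult.assoc)
qed

lemma exps_le_Suc:
  assumes "finite V" "v \<in> V" "\<alpha> \<in> exps_le V n"
  shows "\<alpha>(v := Suc (\<alpha> v)) \<in> exps_le V (Suc n)"
proof -
  have "(\<Sum>w\<in>V - {v}. (\<alpha>(v := Suc (\<alpha> v))) w) = (\<Sum>w\<in>V - {v}. \<alpha> w)"
    by (intro sum.cong) auto
  then show ?thesis using assms by (simp add: exps_le_def sum.remove[of V v])
qed

lemma exps_le_pred:
  assumes "finite V" "\<alpha> \<in> exps_le V n" "\<alpha> \<noteq> (\<lambda>_. 0)"
  obtains v k \<beta> where "v \<in> V" "n = Suc k" "\<beta> \<in> exps_le V k" "\<alpha> = \<beta>(v := Suc (\<beta> v))"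
proof -
  obtain v where v: "\<alpha> v \<noteq> 0" using assms(3) by auto
  with assms(2) have vV: "v \<in> V" by (auto simp: exps_le_def)
  define \<beta> where "\<beta> = \<alpha>(v := \<alpha> v - 1)"
  have eq: "\<alpha> = \<beta>(v := Suc (\<beta> v))" using v by (auto simp: \<beta>_def)
  have "(\<Sum>w\<in>V - {v}. \<beta> w) = (\<Sum>w\<in>V - {v}. \<alpha> w)"
    by (intro sum.cong) (auto simp: \<beta>_def)
  then have "Suc (\<Sum>w\<in>V. \<beta> w) = (\<Sum>w\<in>V. \<alpha> w)"
    using assms(1) vV v by (simp add: sum.remove[of V v] \<beta>_def)
  then have "Suc (\<Sum>w\<in>V. \<beta> w) \<le> n" using assms(2) by (simp add: exps_le_def)
  then obtain k where k: "n = Suc k" "(\<Sum>w\<in>V. \<beta> w) \<le> k" by (cases n) auto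
  have "\<beta> \<in> exps_le V k" using k(2) assms(2) by (auto simp: exps_le_def \<beta>_def)
  then show thesis using that vV k(1) eq by blast
qed

text \<open>The sum is sorted by powers of \<open>v\<close>. The indices that share the exponent of
  \<open>i\<^sub>0\<close> in \<open>v\<close> are still told apart by the remaining variables, so
  some \<open>y\<close> makes the coefficient of that power nonzero, and an infinite field contains
  a \<open>t\<close> that is not a root.\<close>

lemma monomials_nonzero:
  fixes c :: "'i \<Rightarrow> 'k::field"
  assumes inf: "infinite (UNIV :: 'k set)" and "finite V" "finite I"
    and "i\<^sub>0 \<in> I" "c i\<^sub>0 \<noteq> 0"
    and "\<And>i j. i \<in> I \<Longrightarrow> j \<in> I \<Longrightarrow> (\<And>v. v \<in> V \<Longrightarrow> e i v = e j v) \<Longrightarrow> i = j"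
  shows "\<exists>y. (\<Sum>i\<in>I. c i * mon V (e i) y) \<noteq> 0"
  using assms(2-)
proof (induction V arbitrary: I rule: finite_induct)
  case empty
  then have "I = {i\<^sub>0}" by blast
  then show ?case using empty by (simp add: mon_def)
next
  case (insert v V)
  define I' where "I' = {i \<in> I. e i v = e i\<^sub>0 v}"
  have "\<exists>y. (\<Sum>i\<in>I'. c i * mon V (e i) y) \<noteq> 0"
  proof (rule insert.IH)
    fix i j assume ij: "i \<in> I'" "j \<in> I'" and eq: "\<And>v. v \<in> V \<Longrightarrow> e i v = e j v"
    show "i = j"
      by (rule insert.prems(4)) (use ij eq in \<open>auto simp: I'_def\<close>)
  qed (use insert.prems in \<open>auto simp: I'_def\<close>)
  then obtain y where y: "(\<Sum>i\<in>I'. c i * mon V (e i) y) \<noteq> 0" ..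
  define p where "p = (\<Sum>i\<in>I. monom (c i * mon V (e i) y) (e i v))"
  have "coeff p (e i\<^sub>0 v) = (\<Sum>i\<in>I. if e i v = e i\<^sub>0 v then c i * mon V (e i) y else 0)"
    unfolding p_def coeff_sum by (intro sum.cong) auto
  also have "\<dots> = (\<Sum>i\<in>I'. c i * mon V (e i) y)"
    unfolding I'_def using insert.prems(1) by (simp add: sum.inter_filter)
  finally have "p \<noteq> 0" using y by auto
  then obtain t where t: "poly p t \<noteq> 0"
    using inf poly_roots_finite[of p] ex_new_if_finite by blast
  have "mon (insert v V) (e i) (y(v := t)) = t ^ e i v * mon V (e i) y" for i
  proof -
    have "mon V (e i) (y(v := t)) = mon V (e i) y"
      unfolding mon_def using insert.hyps by (intro prod.cong) auto
    then show ?thesis using insert.hyps by (simp add: mon_def)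
  qed
  then have "(\<Sum>i\<in>I. c i * mon (insert v V) (e i) (y(v := t))) = poly p t"
    unfolding p_def poly_sum by (simp add: poly_monom mult_ac)
  then show ?case using t by metis
qed

section \<open>Homogeneous linear systems with more unknowns than equations\<close>

lemma exists_kernel_vector:
  fixes M :: "'i \<Rightarrow> 't \<Rightarrow> 'k::field"
  assumes "finite T" "finite I" "card T < card I"
  shows "\<exists>p. (\<exists>i\<in>I. p i \<noteq> 0) \<and> (\<forall>t\<in>T. (\<Sum>i\<in>I. p i * M i t) = 0)"
  using assms
proof (induction T arbitrary: I M rule: finite_induct)
  case empty
  then obtain i where "i \<in> I" by fastforce
  then show ?case by (intro exI[of _ "\<lambda>_. 1"]) auto
next
  case (insert t T)
  show ?case
  proof (cases "\<forall>i\<in>I. M i t = 0")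
    case True
    have "card T < card I" using insert by simp
    from insert.IH[OF insert.prems(1) this, of M] obtain p
      where "\<exists>i\<in>I. p i \<noteq> 0" "\<forall>t\<in>T. (\<Sum>i\<in>I. p i * M i t) = 0" by blast
    then show ?thesis using True by (intro exI[of _ p]) simp
  next
    case False
    then obtain j where j: "j \<in> I" "M j t \<noteq> 0" by blast
    define I' where "I' = I - {j}"
    have I: "I = insert j I'" "j \<notin> I'" "finite I'" using j insert.prems by (auto simp: I'_def)
    have "card T < card I'" using insert.prems insert.hyps I by simp
    from insert.IH[OF I(3) this, of "\<lambda>i u. M i u - M i t / M j t * M j u"] obtain p
      where p: "\<exists>i\<in>I'. p i \<noteq> 0"
        "\<forall>u\<in>T. (\<Sum>i\<in>I'. p i * (M i u - M i t / M j t * M j u)) = 0" by blast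
    \<comment> \<open>The unknown \<open>j\<close> is solved from equation \<open>t\<close>;
      substituting it into the other equations gives the system passed to the induction
      hypothesis.\<close>
    define s where "s = (\<Sum>i\<in>I'. p i * M i t) / M j t"
    define q where "q = p(j := - s)"
    have q: "(\<Sum>i\<in>I. q i * M i u) = (\<Sum>i\<in>I'. p i * (M i u - M i t / M j t * M j u))" for u
    proof -
      have "(\<Sum>i\<in>I'. q i * M i u) = (\<Sum>i\<in>I'. p i * M i u)"
        using I by (intro sum.cong) (auto simp: q_def)
      then have "(\<Sum>i\<in>I. q i * M i u) = (\<Sum>i\<in>I'. p i * M i u) - s * M j u"
        using I by (simp add: q_def)
      also have "s * M j u = (\<Sum>i\<in>I'. p i * (M i t / M j t * M j u))"
        by (simp add: s_def sum_divide_distrib sum_distrib_right mult.assoc)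
      finally show ?thesis by (simp add: sum_subtractf right_diff_distrib)
    qed
    have "\<forall>u\<in>insert t T. (\<Sum>i\<in>I. q i * M i u) = 0"
      unfolding q using p(2) j(2) by simp
    moreover have "\<exists>i\<in>I. q i \<noteq> 0" using p(1) I by (auto simp: q_def)
    ultimately show ?thesis by blast
  qed
qed

lemma (in vector_space) exists_relation:
  assumes "finite I" "finite T" "card T < card I" "\<And>i. i \<in> I \<Longrightarrow> g i \<in> span T"
  shows "\<exists>p. (\<exists>i\<in>I. p i \<noteq> 0) \<and> (\<Sum>i\<in>I. scale (p i) (g i)) = 0"
proof -
  have "\<forall>i\<in>I. \<exists>u. g i = (\<Sum>t\<in>T. scale (u t) t)"
    using assms(4) unfolding span_finite[OF assms(2)] by blast
  then obtain M where M: "\<And>i. i \<in> I \<Longrightarrow> g i = (\<Sum>t\<in>T. scale (M i t) t)" by metis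
  from exists_kernel_vector[OF assms(2,1,3), of M] obtain p
    where p: "\<exists>i\<in>I. p i \<noteq> 0" "\<forall>t\<in>T. (\<Sum>i\<in>I. p i * M i t) = 0" by blast
  have "(\<Sum>i\<in>I. scale (p i) (g i)) = (\<Sum>i\<in>I. \<Sum>t\<in>T. scale (p i * M i t) t)"
    by (intro sum.cong refl) (simp add: M scale_sum_right)
  also have "\<dots> = (\<Sum>t\<in>T. scale (\<Sum>i\<in>I. p i * M i t) t)"
    by (subst sum.swap) (simp add: scale_sum_left)
  also have "\<dots> = 0" using p(2) by simp
  finally show ?thesis using p(1) by blast
qed

section \<open>The polynomial ring as a vector space, filtered by degree in given elements\<close>

lemma const_0: "mpoly_const 0 = 0"
  and const_1: "mpoly_const 1 = 1"
  and const_add: "mpoly_const (a + b) = mpoly_const a + mpoly_const b"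
  and const_mult: "mpoly_const (c * d) = (mpoly_const c * mpoly_const d :: ('v, 'a::comm_ring_1) mpoly)"
  by (simp_all add: mpoly_const_def single_add mult_single)

lemma lookup_const_mult:
  "Poly_Mapping.lookup (mpoly_const c * p :: ('v, 'a::comm_ring_1) mpoly) \<alpha> = c * Poly_Mapping.lookup p \<alpha>"
  unfolding mpoly_const_def by (simp add: mult_map_scale_conv_mult[symmetric] Poly_Mapping.map.rep_eq when_def)

interpretation mpv: vector_space "\<lambda>c (p :: ('v, 'k::field) mpoly). mpoly_const c * p"
  by unfold_locales (simp_all add: const_add const_mult const_1 algebra_simps)

lemma mpv_span_mult_span:
  assumes "p \<in> mpv.span X" "q \<in> mpv.span Y" "\<And>x y. x \<in> X \<Longrightarrow> y \<in> Y \<Longrightarrow> x * y \<in> mpv.span Z"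
  shows "p * q \<in> mpv.span Z"
  using assms(1)
proof (induction rule: mpv.span_induct_alt)
  case base
  then show ?case by (simp add: mpv.span_zero)
next
  case (step c x p')
  have "x * q \<in> mpv.span Z"
    using assms(2)
  proof (induction rule: mpv.span_induct_alt)
    case base
    then show ?case by (simp add: mpv.span_zero)
  next
    case (step d y q')
    have "x * (mpoly_const d * y + q') = mpoly_const d * (x * y) + x * q'"
      by (simp add: algebra_simps)
    then show ?case
      using step assms(3)[OF \<open>x \<in> X\<close>] by (simp add: mpv.span_add mpv.span_scale)
  qed
  moreover have "(mpoly_const c * x + p') * q = mpoly_const c * (x * q) + p' * q"
    by (simp add: algebra_simps)
  ultimately show ?case using step by (simp add: mpv.span_add mpv.span_scale)
qed

text \<open>The union over \<open>n\<close> is the subalgebra generated by the \<open>g v\<close>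
  with \<open>v\<close> in \<open>V\<close>. The level \<open>n\<close> counts factors
  \<open>g v\<close>; it is not the degree of the resulting polynomial.\<close>

definition filt :: "'i set \<Rightarrow> ('i \<Rightarrow> ('v, 'k::field) mpoly) \<Rightarrow> nat \<Rightarrow> ('v, 'k) mpoly set" where
  "filt V g n = mpv.span ((\<lambda>\<alpha>. mon V \<alpha> g) ` exps_le V n)"

lemma filt_mono: "n \<le> n' \<Longrightarrow> filt V g n \<subseteq> filt V g n'"
  unfolding filt_def by (intro mpv.span_mono image_mono) (auto simp: exps_le_def)

lemma mon_in_filt: "\<alpha> \<in> exps_le V n \<Longrightarrow> mon V \<alpha> g \<in> filt V g n"
  unfolding filt_def by (intro mpv.span_base) blast

lemma filt_mult:
  assumes "p \<in> filt V g n" "q \<in> filt V g n'"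
  shows "p * q \<in> filt V g (n + n')"
  using assms unfolding filt_def
proof (rule mpv_span_mult_span)
  fix x y assume "x \<in> (\<lambda>\<alpha>. mon V \<alpha> g) ` exps_le V n" "y \<in> (\<lambda>\<alpha>. mon V \<alpha> g) ` exps_le V n'"
  then obtain \<alpha> \<beta> where "\<alpha> \<in> exps_le V n" "\<beta> \<in> exps_le V n'" "x = mon V \<alpha> g" "y = mon V \<beta> g"
    by blast
  then have "(\<lambda>v. \<alpha> v + \<beta> v) \<in> exps_le V (n + n')" "x * y = mon V (\<lambda>v. \<alpha> v + \<beta> v) g"
    by (simp_all add: exps_le_def sum.distrib add_mono mon_add)
  then show "x * y \<in> mpv.span ((\<lambda>\<alpha>. mon V \<alpha> g) ` exps_le V (n + n'))"
    by (intro mpv.span_base) blast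
qed

lemma one_in_filt: "1 \<in> filt V g n"
proof -
  have "mon V (\<lambda>_. 0) g \<in> filt V g n" by (rule mon_in_filt) (simp add: exps_le_def)
  then show ?thesis by (simp add: mon_zero)
qed

lemma filt_power: "p \<in> filt V g n \<Longrightarrow> p ^ k \<in> filt V g (k * n)"
  by (induction k) (simp_all add: one_in_filt filt_mult)

lemma filt_prod:
  "finite I \<Longrightarrow> (\<And>i. i \<in> I \<Longrightarrow> p i \<in> filt V g (n i)) \<Longrightarrow> (\<Prod>i\<in>I. p i) \<in> filt V g (\<Sum>i\<in>I. n i)"
  by (induction I rule: finite_induct) (simp_all add: one_in_filt filt_mult)

lemma filt_const_mult: "p \<in> filt V g n \<Longrightarrow> mpoly_const c * p \<in> filt V g n"
  and filt_uminus: "p \<in> filt V g n \<Longrightarrow> - p \<in> filt V g n"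
  and filt_0: "0 \<in> filt V g n"
  unfolding filt_def by (auto intro: mpv.span_scale mpv.span_neg mpv.span_zero)

lemma filt_sum: "(\<And>i. i \<in> I \<Longrightarrow> p i \<in> filt V g n) \<Longrightarrow> (\<Sum>i\<in>I. p i) \<in> filt V g n"
  unfolding filt_def by (rule mpv.span_sum)

section \<open>Algebraic dependence and growth\<close>

text \<open>Relations arise below as sums over index sets with exponent functions. These are cut off
  outside \<open>B\<close> to become keys of a formal polynomial whose variables lie in
  \<open>B\<close>.\<close>

lemma alg_independentD:
  fixes B :: "('v, 'k::field) mpoly set"
  assumes "alg_independent B" "finite B" "finite I"
    and "\<And>i j. i \<in> I \<Longrightarrow> j \<in> I \<Longrightarrow> (\<And>b. b \<in> B \<Longrightarrow> e i b = e j b) \<Longrightarrow> i = j"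
    and "(\<Sum>i\<in>I. mpoly_const (c i) * mon B (e i) (\<lambda>b. b)) = 0" and "i \<in> I"
  shows "c i = 0"
proof -
  define E where "E i = Abs_poly_mapping (\<lambda>b. if b \<in> B then e i b else 0)" for i
  have E: "Poly_Mapping.lookup (E i) b = (if b \<in> B then e i b else 0)" for i b
    unfolding E_def using assms(2) by (subst lookup_Abs_poly_mapping) (auto elim: finite_subset[rotated])
  have inj: "inj_on E I"
  proof (rule inj_onI)
    fix i j assume ij: "i \<in> I" "j \<in> I" "E i = E j"
    show "i = j"
    proof (rule assms(4)[OF ij(1,2)])
      fix b assume "b \<in> B" then show "e i b = e j b" using E[of i b] E[of j b] ij(3) by simp
    qed
  qed
  define P where "P = (\<Sum>i\<in>I. Poly_Mapping.single (E i) (c i))"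
  have look: "Poly_Mapping.lookup P (E i) = c i" if "i \<in> I" for i
  proof -
    have "Poly_Mapping.lookup P (E i) = (\<Sum>j\<in>I. if j = i then c i else 0)"
      unfolding P_def lookup_sum using inj that
      by (intro sum.cong refl) (auto simp: lookup_single when_def inj_on_eq_iff)
    then show ?thesis using assms(3) that by simp
  qed
  have keysP: "Poly_Mapping.keys P \<subseteq> E ` I"
  proof
    fix m assume "m \<in> Poly_Mapping.keys P"
    then have "(\<Sum>i\<in>I. Poly_Mapping.lookup (Poly_Mapping.single (E i) (c i)) m) \<noteq> 0"
      by (simp add: P_def in_keys_iff lookup_sum)
    then obtain i where "i \<in> I" "Poly_Mapping.lookup (Poly_Mapping.single (E i) (c i)) m \<noteq> 0"
      by (meson sum.not_neutral_contains_not_neutral)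
    then show "m \<in> E ` I" by (auto simp: lookup_single when_def split: if_splits)
  qed
  have keysE: "Poly_Mapping.keys (E i) \<subseteq> B" for i
    by (auto simp: in_keys_iff E split: if_splits)
  have prod: "(\<Prod>b\<in>Poly_Mapping.keys (E i). b ^ Poly_Mapping.lookup (E i) b) = mon B (e i) (\<lambda>b. b)" for i
  proof -
    have "(\<Prod>b\<in>Poly_Mapping.keys (E i). b ^ Poly_Mapping.lookup (E i) b)
        = (\<Prod>b\<in>B. b ^ Poly_Mapping.lookup (E i) b)"
      using keysE assms(2) by (intro prod.mono_neutral_left) (auto simp: in_keys_iff)
    also have "\<dots> = mon B (e i) (\<lambda>b. b)" unfolding mon_def by (intro prod.cong) (auto simp: E)
    finally show ?thesis .
  qed
  have "mpoly_subst mpoly_const (\<lambda>b. b) P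
      = (\<Sum>m\<in>E ` I. mpoly_const (Poly_Mapping.lookup P m) *
          (\<Prod>b\<in>Poly_Mapping.keys m. b ^ Poly_Mapping.lookup m b))"
    unfolding mpoly_subst_def using keysP assms(3)
    by (intro sum.mono_neutral_left) (auto simp: in_keys_iff const_0)
  also have "\<dots> = (\<Sum>i\<in>I. mpoly_const (c i) * mon B (e i) (\<lambda>b. b))"
    using inj by (simp add: sum.reindex look prod)
  finally have "mpoly_subst mpoly_const (\<lambda>b. b) P = 0" using assms(5) by simp
  moreover have "\<forall>m\<in>Poly_Mapping.keys P. Poly_Mapping.keys m \<subseteq> B" using keysP keysE by blast
  ultimately have "P = 0" using assms(1) unfolding alg_independent_def by blast
  then show ?thesis using look[OF assms(6)] by simp
qed

text \<open>The relation is sorted by powers of \<open>q\<close>; its top coefficient is nonzero because \<open>B\<close> is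
  independent.\<close>

lemma algebraic_relation:
  fixes B :: "('v, 'k::field) mpoly set"
  assumes "alg_independent B" "finite B" "q \<notin> B" "\<not> alg_independent (insert q B)"
  shows "\<exists>e a n. (\<forall>i\<le>e. a i \<in> filt B (\<lambda>b. b) n) \<and> a e \<noteq> 0 \<and> (\<Sum>i\<le>e. a i * q ^ i) = 0"
proof -
  obtain P :: "(('v, 'k) mpoly, 'k) mpoly"
    where P: "\<forall>m\<in>Poly_Mapping.keys P. Poly_Mapping.keys m \<subseteq> insert q B"
      "mpoly_subst mpoly_const (\<lambda>b. b) P = 0" "P \<noteq> 0"
    using assms(4) unfolding alg_independent_def by blast
  define K where "K = Poly_Mapping.keys P"
  define L where "L = Poly_Mapping.lookup P"
  have finK: "finite K" by (simp add: K_def)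
  have "K \<noteq> {}" using P(3) unfolding K_def by (metis all_not_in_conv in_keys_iff lookup_zero poly_mapping_eqI)
  define e where "e = Max ((\<lambda>m. Poly_Mapping.lookup m q) ` K)"
  have e_le: "Poly_Mapping.lookup m q \<le> e" if "m \<in> K" for m
    unfolding e_def using finK that by simp
  obtain m\<^sub>0 where m0: "m\<^sub>0 \<in> K" "Poly_Mapping.lookup m\<^sub>0 q = e"
    using Max_in[of "(\<lambda>m. Poly_Mapping.lookup m q) ` K"] finK \<open>K \<noteq> {}\<close> unfolding e_def by fastforce
  define a where "a i = (\<Sum>m\<in>{m\<in>K. Poly_Mapping.lookup m q = i}.
      mpoly_const (L m) * mon B (Poly_Mapping.lookup m) (\<lambda>b. b))" for i
  define n where "n = Max ((\<lambda>m. \<Sum>b\<in>B. Poly_Mapping.lookup m b) ` K)"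
  have in_filt: "mon B (Poly_Mapping.lookup m) (\<lambda>b. b) \<in> filt B (\<lambda>b. b) n" if "m \<in> K" for m
  proof -
    have "(\<lambda>b. if b \<in> B then Poly_Mapping.lookup m b else 0) \<in> exps_le B n"
      unfolding exps_le_def n_def using finK that by (auto intro!: Max_ge)
    from mon_in_filt[OF this, of "\<lambda>b. b"] show ?thesis
      by (simp add: mon_def cong: prod.cong)
  qed
  then have "a i \<in> filt B (\<lambda>b. b) n" for i
    unfolding a_def by (auto intro!: filt_sum filt_const_mult)
  moreover have "a e \<noteq> 0"
  proof
    assume a0: "a e = 0"
    have "L m\<^sub>0 = 0"
    proof (rule alg_independentD[OF assms(1,2), where I = "{m\<in>K. Poly_Mapping.lookup m q = e}"
          and e = "Poly_Mapping.lookup"])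
      fix m m' assume m: "m \<in> {m\<in>K. Poly_Mapping.lookup m q = e}" "m' \<in> {m\<in>K. Poly_Mapping.lookup m q = e}"
        and eq: "\<And>b. b \<in> B \<Longrightarrow> Poly_Mapping.lookup m b = Poly_Mapping.lookup m' b"
      show "m = m'"
      proof (rule poly_mapping_eqI)
        fix b
        have "Poly_Mapping.lookup m b = 0" "Poly_Mapping.lookup m' b = 0" if "b \<notin> insert q B"
          using P(1) m that unfolding K_def mem_Collect_eq by (meson in_keys_iff subsetD)+
        then show "Poly_Mapping.lookup m b = Poly_Mapping.lookup m' b"
          using m eq by (cases "b \<in> insert q B") auto
      qed
    qed (use a0 m0 finK in \<open>auto simp: a_def\<close>)
    then show False using m0(1) by (simp add: K_def L_def in_keys_iff)
  qed
  moreover have "(\<Sum>i\<le>e. a i * q ^ i) = 0"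
  proof -
    have prod: "(\<Prod>b\<in>Poly_Mapping.keys m. b ^ Poly_Mapping.lookup m b)
        = mon B (Poly_Mapping.lookup m) (\<lambda>b. b) * q ^ Poly_Mapping.lookup m q" if "m \<in> K" for m
    proof -
      have "(\<Prod>b\<in>Poly_Mapping.keys m. b ^ Poly_Mapping.lookup m b)
          = (\<Prod>b\<in>insert q B. b ^ Poly_Mapping.lookup m b)"
        using P(1) that assms(2) unfolding K_def
        by (intro prod.mono_neutral_left) (auto simp: in_keys_iff)
      then show ?thesis using assms(2,3) by (simp add: mon_def mult.commute)
    qed
    have "(\<Sum>i\<le>e. a i * q ^ i)
        = (\<Sum>i\<le>e. \<Sum>m\<in>{m\<in>K. Poly_Mapping.lookup m q = i}.
             mpoly_const (L m) * mon B (Poly_Mapping.lookup m) (\<lambda>b. b) * q ^ Poly_Mapping.lookup m q)"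
      unfolding a_def sum_distrib_right by (intro sum.cong) auto
    also have "\<dots> = (\<Sum>m\<in>K. mpoly_const (L m) * mon B (Poly_Mapping.lookup m) (\<lambda>b. b) *
                      q ^ Poly_Mapping.lookup m q)"
      using finK e_le by (intro sum.group) auto
    also have "\<dots> = mpoly_subst mpoly_const (\<lambda>b. b) P"
      unfolding mpoly_subst_def K_def[symmetric] L_def[symmetric]
      by (intro sum.cong refl) (simp add: prod mult.assoc)
    finally show ?thesis using P(2) by simp
  qed
  ultimately show ?thesis by blast
qed

text \<open>The product of the top coefficients serves as a common denominator \<open>Q\<close>, and
  multiplication by powers of \<open>f j\<close> brings all relations to a common exponent
  \<open>e\<close>. That the ring is a domain appears as a hypothesis because it is derived only
  later, from leading exponents.\<close>

lemma common_relation: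
  fixes f :: "'i \<Rightarrow> ('v, 'k::field) mpoly"
  assumes domain: "\<And>p q :: ('v, 'k) mpoly. p * q = 0 \<Longrightarrow> p = 0 \<or> q = 0"
    and "finite J"
    and "\<And>j. j \<in> J \<Longrightarrow> \<exists>e a n. (\<forall>i\<le>e. a i \<in> filt B g n) \<and> a e \<noteq> 0 \<and> (\<Sum>i\<le>e. a i * f j ^ i) = 0"
  shows "\<exists>Q e n. Q \<noteq> 0 \<and> Q \<in> filt B g n \<and> 0 < e \<and>
    (\<forall>j\<in>J. \<exists>a. (\<forall>i<e. a i \<in> filt B g n) \<and> Q * f j ^ e = (\<Sum>i<e. a i * f j ^ i))"
  using assms(2,3)
proof (induction J rule: finite_induct)
  case empty
  show ?case by (intro exI[of _ 1] exI[of _ 0]) (auto simp: one_in_filt)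
next
  case (insert j J)
  have "\<exists>Q e n. Q \<noteq> 0 \<and> Q \<in> filt B g n \<and> 0 < e \<and>
      (\<forall>j\<in>J. \<exists>a. (\<forall>i<e. a i \<in> filt B g n) \<and> Q * f j ^ e = (\<Sum>i<e. a i * f j ^ i))"
    by (rule insert.IH) (rule insert.prems, rule insertI2)
  then obtain Q e n where Q: "Q \<noteq> 0" "Q \<in> filt B g n" "0 < e"
    "\<forall>j\<in>J. \<exists>a. (\<forall>i<e. a i \<in> filt B g n) \<and> Q * f j ^ e = (\<Sum>i<e. a i * f j ^ i)"
    by (elim exE conjE)
  from insert.prems[OF insertI1] obtain e' b n'
    where b: "\<forall>i\<le>e'. b i \<in> filt B g n'" "b e' \<noteq> 0" "(\<Sum>i\<le>e'. b i * f j ^ i) = 0"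
    by (elim exE conjE)
  \<comment> \<open>One relation is scaled by the top coefficient \<open>s\<close> of the other and
    shifted by \<open>w\<close>; the coefficients below \<open>w\<close> become 0.\<close>
  have shift: "\<exists>a'. (\<forall>i<e+e'. a' i \<in> filt B g (n + n')) \<and> s * c * x ^ (e + e') = (\<Sum>i<e+e'. a' i * x ^ i)"
    if a: "\<forall>i<u. a i \<in> filt B g N" "c * x ^ u = (\<Sum>i<u. a i * x ^ i)" and s: "s \<in> filt B g N'"
      and eqs: "u + w = e + e'" "N + N' = n + n'" for a c x u w s N N'
  proof (intro exI conjI allI impI)
    let ?a = "\<lambda>i. if i < w then 0 else s * a (i - w)"
    show "?a i \<in> filt B g (n + n')" if "i < e + e'" for i
      using a(1) that eqs filt_mult[OF s, of "a (i - w)" N] by (auto simp: filt_0 add.commute)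
    have "s * c * x ^ (e + e') = s * (c * x ^ u) * x ^ w"
      unfolding eqs(1)[symmetric] by (simp add: power_add mult_ac)
    also have "\<dots> = (\<Sum>i<u. s * a i * x ^ (i + w))"
      unfolding a(2) by (simp add: sum_distrib_left sum_distrib_right power_add mult_ac)
    also have "\<dots> = (\<Sum>i\<in>{w..<u+w}. ?a i * x ^ i)"
      by (rule sum.reindex_bij_witness[where i = "\<lambda>i. i - w" and j = "\<lambda>i. i + w"]) auto
    also have "\<dots> = (\<Sum>i<e+e'. ?a i * x ^ i)"
      unfolding eqs(1) by (intro sum.mono_neutral_left) auto
    finally show "s * c * x ^ (e + e') = (\<Sum>i<e+e'. ?a i * x ^ i)" .
  qed
  have "\<exists>a. (\<forall>i<e+e'. a i \<in> filt B g (n + n')) \<and> b e' * Q * f i ^ (e + e') = (\<Sum>l<e+e'. a l * f i ^ l)"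
    if "i \<in> insert j J" for i
  proof (cases "i \<in> J")
    case True
    with Q(4) obtain a where "\<forall>l<e. a l \<in> filt B g n" "Q * f i ^ e = (\<Sum>l<e. a l * f i ^ l)" by blast
    from shift[OF this, of "b e'" n' e'] b(1) show ?thesis by simp
  next
    case False
    have "b e' * f j ^ e' = (\<Sum>l<e'. - b l * f j ^ l)"
      using b(3) by (simp add: lessThan_Suc_atMost[symmetric] sum_negf eq_neg_iff_add_eq_0 add.commute)
    from shift[OF _ this Q(2), of n' e] False that b(1) show ?thesis
      by (auto simp: filt_uminus mult.commute[of "b e'"] add.commute)
  qed
  moreover have "b e' * Q \<noteq> 0" using domain Q(1) b(2) by blast
  moreover have "b e' * Q \<in> filt B g (n + n')"
    using filt_mult[of "b e'" B g n' Q n] Q(2) b(1) by (simp add: add.commute)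
  ultimately show ?case using Q(3)
    by (intro exI[of _ "b e' * Q"] exI[of _ "e + e'"] exI[of _ "n + n'"]) simp
qed

text \<open>Multiplication by \<open>Q ^ n\<close> clears the denominators that arise when the exponents of the \<open>f j\<close>
  are reduced below \<open>e\<close>.\<close>

lemma growth:
  fixes f :: "'i \<Rightarrow> ('v, 'k::field) mpoly"
  assumes "finite J" "finite B" and Q: "Q \<in> filt B g k" "0 < e"
    and rel: "\<And>j. j \<in> J \<Longrightarrow> \<exists>a. (\<forall>i<e. a i \<in> filt B g k) \<and> Q * f j ^ e = (\<Sum>i<e. a i * f j ^ i)"
  shows "\<exists>C. \<forall>n. \<exists>T. finite T \<and> card T \<le> C * ((k * n + card B) choose card B) \<and>
    (\<forall>p\<in>filt J f n. Q ^ n * p \<in> mpv.span T)"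
proof -
  define \<Gamma> where "\<Gamma> = {\<gamma>. (\<forall>v. v \<notin> J \<longrightarrow> \<gamma> v = 0) \<and> (\<forall>v\<in>J. \<gamma> v < e)}"
  have "\<Gamma> \<subseteq> exps_le J (card J * e)"
    unfolding \<Gamma>_def exps_le_def using sum_bounded_above[of J _ e] by (auto intro: less_imp_le)
  then have fin\<Gamma>: "finite \<Gamma>" using finite_exps_le[OF assms(1)] finite_subset by blast
  define T where "T t = (\<lambda>(\<beta>, \<gamma>). mon B \<beta> g * mon J \<gamma> f) ` (exps_le B t \<times> \<Gamma>)" for t
  have finT: "finite (T t)" for t
    unfolding T_def using finite_exps_le[OF assms(2)] fin\<Gamma> by blast
  have cardT: "card (T t) \<le> card \<Gamma> * ((t + card B) choose card B)" for t
  proof -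
    have "card (T t) \<le> card (exps_le B t \<times> \<Gamma>)"
      unfolding T_def using finite_exps_le[OF assms(2)] fin\<Gamma> by (intro card_image_le) blast
    then show ?thesis using card_exps_le[OF assms(2)] by (simp add: card_cartesian_product mult.commute)
  qed
  have span_T: "b * mon J \<gamma> f \<in> mpv.span (T t)" if "b \<in> filt B g t" "\<gamma> \<in> \<Gamma>" for b \<gamma> t
  proof (rule mpv_span_mult_span)
    show "b \<in> mpv.span ((\<lambda>\<alpha>. mon B \<alpha> g) ` exps_le B t)" using that(1) by (simp add: filt_def)
    show "mon J \<gamma> f \<in> mpv.span {mon J \<gamma> f}" by (intro mpv.span_base) simp
    fix x y assume "x \<in> (\<lambda>\<alpha>. mon B \<alpha> g) ` exps_le B t" "y \<in> {mon J \<gamma> f}"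
    then have "x * y \<in> T t" using that(2) unfolding T_def by force
    then show "x * y \<in> mpv.span (T t)" by (rule mpv.span_base)
  qed
  \<comment> \<open>A multiplier that costs \<open>k\<close> filtration levels on reduced monomials
    costs \<open>k\<close> levels on the whole span. The multipliers are \<open>Q\<close> and the
    \<open>Q * f j\<close>.\<close>
  have step: "z * p \<in> mpv.span (T (k + t))"
    if p: "p \<in> mpv.span (T t)" and z: "\<And>\<gamma>. \<gamma> \<in> \<Gamma> \<Longrightarrow> \<exists>a. (\<forall>\<gamma>'\<in>\<Gamma>. a \<gamma>' \<in> filt B g k) \<and>
      z * mon J \<gamma> f = (\<Sum>\<gamma>'\<in>\<Gamma>. a \<gamma>' * mon J \<gamma>' f)" for z p t
  proof (rule mpv_span_mult_span[OF _ p])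
    show "z \<in> mpv.span {z}" by (intro mpv.span_base) simp
    fix x y assume "x \<in> {z}" "y \<in> T t"
    then obtain \<beta> \<gamma> where xy: "x = z" "\<beta> \<in> exps_le B t" "\<gamma> \<in> \<Gamma>" "y = mon B \<beta> g * mon J \<gamma> f"
      unfolding T_def by auto
    from z[OF xy(3)] obtain a where a: "\<forall>\<gamma>'\<in>\<Gamma>. a \<gamma>' \<in> filt B g k"
      "z * mon J \<gamma> f = (\<Sum>\<gamma>'\<in>\<Gamma>. a \<gamma>' * mon J \<gamma>' f)" by blast
    have "x * y = mon B \<beta> g * (z * mon J \<gamma> f)" by (simp add: xy mult_ac)
    also have "\<dots> = (\<Sum>\<gamma>'\<in>\<Gamma>. (a \<gamma>' * mon B \<beta> g) * mon J \<gamma>' f)"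
      unfolding a(2) by (simp add: sum_distrib_left mult_ac)
    also have "\<dots> \<in> mpv.span (T (k + t))"
      using a(1) mon_in_filt[OF xy(2)] by (intro mpv.span_sum span_T filt_mult) auto
    finally show "x * y \<in> mpv.span (T (k + t))" .
  qed
  have stepQ: "Q * p \<in> mpv.span (T (k + t))" if "p \<in> mpv.span (T t)" for p t
  proof (rule step[OF that])
    fix \<gamma> assume "\<gamma> \<in> \<Gamma>"
    then show "\<exists>a. (\<forall>\<gamma>'\<in>\<Gamma>. a \<gamma>' \<in> filt B g k) \<and> Q * mon J \<gamma> f = (\<Sum>\<gamma>'\<in>\<Gamma>. a \<gamma>' * mon J \<gamma>' f)"
      using Q(1) fin\<Gamma>
      by (intro exI[of _ "\<lambda>\<gamma>'. if \<gamma>' = \<gamma> then Q else 0"]) (simp add: filt_0 if_distrib[of "\<lambda>x. x * _"] cong: if_cong)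
  qed
  have stepf: "(Q * f j) * p \<in> mpv.span (T (k + t))" if "p \<in> mpv.span (T t)" "j \<in> J" for p t j
  proof (rule step[OF that(1)])
    fix \<gamma> assume \<gamma>: "\<gamma> \<in> \<Gamma>"
    have mon_split: "mon J (\<gamma>(j := i)) f = mon (J - {j}) \<gamma> f * f j ^ i" for i
    proof -
      have "mon (J - {j}) (\<gamma>(j := i)) f = mon (J - {j}) \<gamma> f"
        unfolding mon_def by (intro prod.cong) auto
      then show ?thesis using assms(1) that(2) by (simp add: mon_def prod.remove[of J j] mult.commute)
    qed
    have upd: "\<gamma>(j := i) \<in> \<Gamma>" if "i < e" for i using \<gamma> that \<open>j \<in> J\<close> by (auto simp: \<Gamma>_def)
    have "\<exists>a. (\<forall>i<e. a i \<in> filt B g k) \<and> Q * f j * mon J \<gamma> f = (\<Sum>i<e. a i * mon J (\<gamma>(j := i)) f)"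
    \<comment> \<open>The relation is called upon when the raised exponent reaches \<open>e\<close>;
      below that the monomial stays reduced.\<close>
    proof (cases "Suc (\<gamma> j) = e")
      case True
      from rel[OF that(2)] obtain a where a: "\<forall>i<e. a i \<in> filt B g k"
        "Q * f j ^ e = (\<Sum>i<e. a i * f j ^ i)" by blast
      have "mon J \<gamma> f = mon (J - {j}) \<gamma> f * f j ^ \<gamma> j"
        using mon_split[of "\<gamma> j"] by simp
      then have "Q * f j * mon J \<gamma> f = mon (J - {j}) \<gamma> f * (Q * (f j * f j ^ \<gamma> j))"
        by (simp only: mult_ac)
      also have "\<dots> = mon (J - {j}) \<gamma> f * (Q * f j ^ e)" using True by auto
      also have "\<dots> = (\<Sum>i<e. a i * mon J (\<gamma>(j := i)) f)"
        unfolding a(2) mon_split by (simp add: sum_distrib_left mult_ac)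
      finally show ?thesis using a(1) by blast
    next
      case False
      then have lt: "Suc (\<gamma> j) < e" using \<gamma> that(2) by (auto simp: \<Gamma>_def)
      have "Q * f j * mon J \<gamma> f = Q * mon J (\<gamma>(j := Suc (\<gamma> j))) f"
        using mon_Suc[OF assms(1) that(2), of \<gamma> f] by (simp add: mult_ac)
      also have "\<dots> = (\<Sum>i<e. (if i = Suc (\<gamma> j) then Q else 0) * mon J (\<gamma>(j := i)) f)"
        using lt by (simp add: if_distrib[of "\<lambda>x. x * _"] cong: if_cong)
      finally show ?thesis using Q(1)
        by (intro exI[of _ "\<lambda>i. if i = Suc (\<gamma> j) then Q else 0"]) (simp add: filt_0)
    qed
    then obtain a where a: "\<forall>i<e. a i \<in> filt B g k"
      "Q * f j * mon J \<gamma> f = (\<Sum>i<e. a i * mon J (\<gamma>(j := i)) f)" by blast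
    let ?U = "(\<lambda>i. \<gamma>(j := i)) ` {..<e}"
    have inj: "inj_on (\<lambda>i. \<gamma>(j := i)) {..<e}" by (auto intro!: inj_onI dest: fun_cong[where x = j])
    have "(\<Sum>i<e. a i * mon J (\<gamma>(j := i)) f) = (\<Sum>\<gamma>'\<in>?U. a (\<gamma>' j) * mon J \<gamma>' f)"
      by (subst sum.reindex[OF inj]) simp
    also have "\<dots> = (\<Sum>\<gamma>'\<in>\<Gamma>. (if \<gamma>' \<in> ?U then a (\<gamma>' j) else 0) * mon J \<gamma>' f)"
      using fin\<Gamma> upd by (intro sum.mono_neutral_cong_left) auto
    finally show "\<exists>a. (\<forall>\<gamma>'\<in>\<Gamma>. a \<gamma>' \<in> filt B g k) \<and> Q * f j * mon J \<gamma> f = (\<Sum>\<gamma>'\<in>\<Gamma>. a \<gamma>' * mon J \<gamma>' f)"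
      using a by (intro exI[of _ "\<lambda>\<gamma>'. if \<gamma>' \<in> ?U then a (\<gamma>' j) else 0"]) (auto simp: filt_0)
  qed
  have one: "1 \<in> mpv.span (T 0)"
  proof -
    have "(\<lambda>_. 0) \<in> \<Gamma>" using Q(2) by (simp add: \<Gamma>_def)
    from span_T[OF one_in_filt this, of 0] show ?thesis by (simp add: mon_zero)
  qed
  \<comment> \<open>This covers monomials whose factors are exhausted before the powers of
    \<open>Q\<close> are.\<close>
  have powQ: "Q ^ n \<in> mpv.span (T (k * n))" for n
    by (induction n) (use one stepQ in \<open>simp_all\<close>)
  have monQ: "Q ^ n * mon J \<gamma> f \<in> mpv.span (T (k * n))" if "\<gamma> \<in> exps_le J n" for \<gamma> n
    using that
  proof (induction n arbitrary: \<gamma>)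
    case 0
    then have "\<gamma> = (\<lambda>_. 0)" using assms(1) by (auto simp: exps_le_def)
    then show ?case using one by (simp add: mon_zero)
  next
    case (Suc n)
    show ?case
    proof (cases "\<gamma> = (\<lambda>_. 0)")
      case True
      then show ?thesis using powQ[of "Suc n"] by (simp add: mon_zero)
    next
      case False
      from exps_le_pred[OF assms(1) Suc.prems False] obtain j l \<beta>
        where *: "j \<in> J" "Suc n = Suc l" "\<beta> \<in> exps_le J l" "\<gamma> = \<beta>(j := Suc (\<beta> j))" by blast
      have "Q * f j * (Q ^ n * mon J \<beta> f) \<in> mpv.span (T (k + k * n))"
        using Suc.IH[of \<beta>] * by (intro stepf) auto
      then show ?thesis using mon_Suc[OF assms(1) *(1), of \<beta> f] *(4)
        by (simp add: mult_ac del: fun_upd_apply)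
    qed
  qed
  have "Q ^ n * p \<in> mpv.span (T (k * n))" if "p \<in> filt J f n" for p n
  proof (rule mpv_span_mult_span)
    show "p \<in> mpv.span ((\<lambda>\<alpha>. mon J \<alpha> f) ` exps_le J n)" using that by (simp add: filt_def)
    show "Q ^ n \<in> mpv.span {Q ^ n}" by (intro mpv.span_base) simp
  qed (use monQ in auto)
  then show ?thesis using finT cardT by (intro exI[of _ "card \<Gamma>"]) blast
qed

section \<open>Leading exponents\<close>

lemma Suc_times_binomial_shift: "Suc r * ((n + Suc r) choose Suc r) = (n + Suc r) * ((n + r) choose r)"
  using Suc_times_binomial[of r "n + r"] by (simp only: add_Suc_right)

text \<open>Up to the common denominator \<open>r!\<close>, both sides are products over
  \<open>i\<close> from 1 to \<open>r\<close>, and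
  \<open>d * n + i \<le> d * (n + i)\<close>.\<close>

lemma binomial_scale_le:
  assumes "0 < d"
  shows "(d * n + r) choose r \<le> d ^ r * ((n + r) choose r)"
proof (induction r)
  case (Suc r)
  have "Suc r * ((d * n + Suc r) choose Suc r) = (d * n + Suc r) * ((d * n + r) choose r)"
    by (rule Suc_times_binomial_shift)
  also have "\<dots> \<le> (d * (n + Suc r)) * (d ^ r * ((n + r) choose r))"
    using assms mult_le_mono1[of 1 d "Suc r"] by (intro mult_mono Suc.IH) (simp_all add: add_mult_distrib2)
  also have "\<dots> = d ^ Suc r * ((n + Suc r) * ((n + r) choose r))"
    by (simp only: power_Suc mult_ac)
  also have "\<dots> = Suc r * (d ^ Suc r * ((n + Suc r) choose Suc r))"
    by (simp only: Suc_times_binomial_shift[symmetric] mult_ac)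
  finally show ?case using mult_le_cancel1 by blast
qed simp

lemma binomial_outgrows: "\<exists>n. C * ((k * n + b) choose b) < (n + Suc b) choose Suc b"
proof -
  \<comment> \<open>Chosen so that \<open>C * Suc k ^ b\<close> equals \<open>n / Suc b\<close>,
    which is less than the quotient \<open>(n + Suc b) / Suc b\<close> of the binomial coefficients
    for \<open>Suc b\<close> and \<open>b\<close>. \<open>Suc k\<close> replaces \<open>k\<close>
    because the scaling factor has to be positive.\<close>
  define n where "n = Suc b * C * Suc k ^ b"
  have eq: "Suc b * (C * (Suc k ^ b * x)) = n * x" for x unfolding n_def by (simp only: mult_ac)
  have "(k * n + b) choose b \<le> (Suc k * n + b) choose b" by (intro binomial_right_mono) simp
  also have "\<dots> \<le> Suc k ^ b * ((n + b) choose b)" by (rule binomial_scale_le) simp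
  finally have "Suc b * (C * ((k * n + b) choose b)) \<le> Suc b * (C * (Suc k ^ b * ((n + b) choose b)))"
    by (intro mult_le_mono) simp_all
  also have "\<dots> = n * ((n + b) choose b)"
    using eq by blast
  also have "\<dots> < (n + Suc b) * ((n + b) choose b)" by (intro mult_less_mono1) simp_all
  also have "\<dots> = Suc b * ((n + Suc b) choose Suc b)"
    by (rule Suc_times_binomial_shift[symmetric])
  finally show ?thesis using mult_less_cancel1 by blast
qed

text \<open>A monomial order, encoded by an injective multiplicative weight: assign distinct primes to the
  variables.\<close>

locale monomial_weight =
  fixes W :: "('n::finite \<Rightarrow>\<^sub>0 nat) \<Rightarrow> nat"
  assumes W_inj: "W \<alpha> = W \<beta> \<Longrightarrow> \<alpha> = \<beta>"
    and W_add: "W (\<alpha> + \<beta>) = W \<alpha> * W \<beta>"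
    and W_pos: "0 < W \<alpha>"

text \<open>Unique factorisation makes the weight injective. Its values are natural numbers, so
  reduction by leading terms will terminate.\<close>

lemma monomial_weight_exists: "\<exists>W :: ('n::finite \<Rightarrow>\<^sub>0 nat) \<Rightarrow> nat. monomial_weight W"
proof -
  obtain P :: "nat set" where P: "finite P" "card P = CARD('n)" "P \<subseteq> {p. prime p}"
    using infinite_arbitrarily_large[OF primes_infinite] by blast
  then obtain pr :: "'n \<Rightarrow> nat" where pr: "bij_betw pr UNIV P"
    using finite_same_card_bij[of "UNIV :: 'n set" P] by auto
  have inj: "inj pr" and range: "range pr = P" and prime: "prime (pr v)" for v
    using pr P(3) by (auto simp: bij_betw_def)
  have prime_P: "prime x" if "x \<in> P" for x using that P(3) by blast
  define W where "W \<alpha> = (\<Prod>v\<in>UNIV. pr v ^ Poly_Mapping.lookup \<alpha> v)" for \<alpha> :: "'n \<Rightarrow>\<^sub>0 nat"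
  have mult: "multiplicity (pr v) (W \<alpha>) = Poly_Mapping.lookup \<alpha> v" for v \<alpha>
  proof -
    have "W \<alpha> = (\<Prod>p\<in>P. p ^ Poly_Mapping.lookup \<alpha> (inv pr p))"
      unfolding W_def range[symmetric] using inj by (subst prod.reindex) (simp_all add: inv_f_f)
    then show ?thesis
      using multiplicity_prod_prime_powers[OF P(1) prime_P prime, of v "\<lambda>p. Poly_Mapping.lookup \<alpha> (inv pr p)"]
        range inj by (auto simp: inv_f_f)
  qed
  have "monomial_weight W"
  proof
    fix \<alpha> \<beta> assume "W \<alpha> = W \<beta>"
    then show "\<alpha> = \<beta>" using mult by (intro poly_mapping_eqI) metis
  next
    show "W (\<alpha> + \<beta>) = W \<alpha> * W \<beta>" for \<alpha> \<beta>
      by (simp add: W_def lookup_add power_add prod.distrib)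
    show "0 < W \<alpha>" for \<alpha> using prime by (simp add: W_def prime_gt_0_nat)
  qed
  then show ?thesis by blast
qed

definition exp_vec :: "('n::finite \<Rightarrow>\<^sub>0 nat) \<Rightarrow> real ^ 'n" where
  "exp_vec \<alpha> = (\<chi> v. real (Poly_Mapping.lookup \<alpha> v))"

lemma exp_vec_add: "exp_vec (\<alpha> + \<beta>) = exp_vec \<alpha> + exp_vec \<beta>"
  by (simp add: exp_vec_def vec_eq_iff lookup_add)

lemma exp_vec_inj: "exp_vec \<alpha> = exp_vec \<beta> \<Longrightarrow> \<alpha> = \<beta>"
  by (intro poly_mapping_eqI) (simp add: exp_vec_def vec_eq_iff)

context monomial_weight
begin

definition lead :: "('n, 'k::field) mpoly \<Rightarrow> ('n \<Rightarrow>\<^sub>0 nat) \<Rightarrow> bool" where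
  "lead p \<alpha> \<longleftrightarrow> \<alpha> \<in> Poly_Mapping.keys p \<and> (\<forall>\<beta>\<in>Poly_Mapping.keys p. W \<beta> \<le> W \<alpha>)"

lemma lead_exists:
  assumes "p \<noteq> 0"
  shows "\<exists>\<alpha>. lead p \<alpha>"
proof -
  have "Poly_Mapping.keys p \<noteq> {}"
    using assms by (metis all_not_in_conv in_keys_iff lookup_zero poly_mapping_eqI)
  then have "Max (W ` Poly_Mapping.keys p) \<in> W ` Poly_Mapping.keys p" by (intro Max_in) auto
  then obtain \<alpha> where "\<alpha> \<in> Poly_Mapping.keys p" "W \<alpha> = Max (W ` Poly_Mapping.keys p)" by auto
  then show ?thesis unfolding lead_def by (intro exI[of _ \<alpha>]) auto
qed

lemma lead_nonzero: "lead p \<alpha> \<Longrightarrow> p \<noteq> 0"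
  by (auto simp: lead_def)

lemma lead_less: "lead p \<alpha> \<Longrightarrow> \<beta> \<in> Poly_Mapping.keys p \<Longrightarrow> \<beta> \<noteq> \<alpha> \<Longrightarrow> W \<beta> < W \<alpha>"
  using W_inj unfolding lead_def by (metis le_neq_implies_less)

text \<open>All products of terms other than that of the two leading ones have strictly smaller
  weight, as \<open>W\<close> is multiplicative and positive; hence nothing cancels the leading
  product.\<close>

lemma lead_mult:
  fixes p q :: "('n, 'k::field) mpoly"
  assumes "lead p \<alpha>" "lead q \<beta>"
  shows "lead (p * q) (\<alpha> + \<beta>)"
proof -
  define a where "a = Poly_Mapping.lookup p \<alpha>"
  define b where "b = Poly_Mapping.lookup q \<beta>"
  define p' where "p' = p - Poly_Mapping.single \<alpha> a"
  define q' where "q' = q - Poly_Mapping.single \<beta> b"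
  have ab: "a \<noteq> 0" "b \<noteq> 0" using assms by (simp_all add: lead_def a_def b_def in_keys_iff)
  have p': "W \<gamma> < W \<alpha>" if "\<gamma> \<in> Poly_Mapping.keys p'" for \<gamma>
    using that lead_less[OF assms(1), of \<gamma>]
    by (auto simp: p'_def a_def in_keys_iff lookup_minus lookup_single when_def split: if_splits)
  have q': "W \<gamma> < W \<beta>" if "\<gamma> \<in> Poly_Mapping.keys q'" for \<gamma>
    using that lead_less[OF assms(2), of \<gamma>]
    by (auto simp: q'_def b_def in_keys_iff lookup_minus lookup_single when_def split: if_splits)
  have "\<alpha> + \<beta> \<notin> Poly_Mapping.keys (Poly_Mapping.single \<alpha> a * q')"
  proof
    assume "\<alpha> + \<beta> \<in> Poly_Mapping.keys (Poly_Mapping.single \<alpha> a * q')"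
    then obtain \<gamma> \<delta> where "\<gamma> \<in> Poly_Mapping.keys (Poly_Mapping.single \<alpha> a)" "\<delta> \<in> Poly_Mapping.keys q'"
      "\<alpha> + \<beta> = \<gamma> + \<delta>" using keys_mult by blast
    then have "\<delta> = \<beta>" "\<delta> \<in> Poly_Mapping.keys q'" by (auto split: if_splits)
    then show False using q' by blast
  qed
  moreover have "\<alpha> + \<beta> \<notin> Poly_Mapping.keys (p' * q)"
  proof
    assume "\<alpha> + \<beta> \<in> Poly_Mapping.keys (p' * q)"
    then obtain \<gamma> \<delta> where *: "\<gamma> \<in> Poly_Mapping.keys p'" "\<delta> \<in> Poly_Mapping.keys q" "\<alpha> + \<beta> = \<gamma> + \<delta>"
      using keys_mult by blast
    have "W \<gamma> * W \<delta> < W \<alpha> * W \<beta>"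
      using p'[OF *(1)] assms(2) *(2) W_pos[of \<delta>] W_pos[of \<beta>]
      by (intro mult_less_le_imp_less) (auto simp: lead_def)
    then show False using *(3) W_add[of \<alpha> \<beta>] W_add[of \<gamma> \<delta>] by simp
  qed
  moreover have "p * q = Poly_Mapping.single (\<alpha> + \<beta>) (a * b) + Poly_Mapping.single \<alpha> a * q' + p' * q"
    by (simp add: p'_def q'_def algebra_simps mult_single)
  ultimately have "Poly_Mapping.lookup (p * q) (\<alpha> + \<beta>) = a * b"
    by (simp add: lookup_add in_keys_iff)
  then have "\<alpha> + \<beta> \<in> Poly_Mapping.keys (p * q)" using ab by (simp add: in_keys_iff)
  moreover have "W \<gamma> \<le> W (\<alpha> + \<beta>)" if "\<gamma> \<in> Poly_Mapping.keys (p * q)" for \<gamma>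
    using that keys_mult[of p q] assms by (fastforce simp: lead_def W_add intro: mult_le_mono)
  ultimately show ?thesis unfolding lead_def by blast
qed

lemma mpoly_domain:
  fixes p q :: "('n, 'k::field) mpoly"
  assumes "p * q = 0"
  shows "p = 0 \<or> q = 0"
  using assms lead_exists lead_mult lead_nonzero by metis

lemma lead_one: "lead (1 :: ('n, 'k::field) mpoly) 0"
  by (simp add: lead_def)

lemma lead_power:
  assumes "lead p \<alpha>"
  shows "\<exists>\<beta>. lead (p ^ n) \<beta> \<and> exp_vec \<beta> = real n *\<^sub>R exp_vec \<alpha>"
proof (induction n)
  case 0
  show ?case by (intro exI[of _ 0]) (simp add: lead_one exp_vec_def vec_eq_iff)
next
  case (Suc n)
  then obtain \<beta> where "lead (p ^ n) \<beta>" "exp_vec \<beta> = real n *\<^sub>R exp_vec \<alpha>" by blast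
  then show ?case using lead_mult[OF assms]
    by (intro exI[of _ "\<alpha> + \<beta>"]) (simp add: exp_vec_add scaleR_add_left)
qed

lemma lead_prod:
  assumes "finite I" "\<And>i. i \<in> I \<Longrightarrow> \<exists>\<beta>. lead (p i) \<beta> \<and> exp_vec \<beta> = u i"
  shows "\<exists>\<beta>. lead (\<Prod>i\<in>I. p i) \<beta> \<and> exp_vec \<beta> = (\<Sum>i\<in>I. u i)"
  using assms
proof (induction I rule: finite_induct)
  case empty
  show ?case by (intro exI[of _ 0]) (simp add: lead_one exp_vec_def vec_eq_iff)
next
  case (insert i I)
  then obtain \<beta> \<gamma> where "lead (\<Prod>i\<in>I. p i) \<beta>" "exp_vec \<beta> = (\<Sum>i\<in>I. u i)"
    "lead (p i) \<gamma>" "exp_vec \<gamma> = u i" by blast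
  then show ?case using insert.hyps lead_mult
    by (intro exI[of _ "\<gamma> + \<beta>"]) (simp add: exp_vec_add)
qed

text \<open>Among the terms with nonzero coefficient, the leading monomial of largest weight cannot
  be cancelled.\<close>

lemma lead_independent:
  fixes h :: "'i \<Rightarrow> ('n, 'k::field) mpoly"
  assumes "finite I" "\<And>i. i \<in> I \<Longrightarrow> lead (h i) (\<alpha> i)" "inj_on \<alpha> I"
    and "(\<Sum>i\<in>I. mpoly_const (c i) * h i) = 0"
  shows "\<forall>i\<in>I. c i = 0"
proof (rule ccontr)
  assume "\<not> (\<forall>i\<in>I. c i = 0)"
  define I' where "I' = {i\<in>I. c i \<noteq> 0}"
  have I': "finite I'" "I' \<noteq> {}" using assms(1) \<open>\<not> _\<close> by (auto simp: I'_def)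
  then have "Max ((\<lambda>i. W (\<alpha> i)) ` I') \<in> (\<lambda>i. W (\<alpha> i)) ` I'" by (intro Max_in) auto
  then obtain i where i: "i \<in> I'" "W (\<alpha> i) = Max ((\<lambda>i. W (\<alpha> i)) ` I')" by auto
  have le: "W (\<alpha> j) \<le> W (\<alpha> i)" if "j \<in> I'" for j using i(2) I' that by simp
  have "Poly_Mapping.lookup (mpoly_const (c j) * h j) (\<alpha> i) = 0" if j: "j \<in> I - {i}" for j
  proof (cases "c j = 0")
    case False
    then have "j \<in> I'" using j by (auto simp: I'_def)
    have "\<alpha> j \<noteq> \<alpha> i" using j i(1) assms(3) by (auto simp: I'_def inj_on_eq_iff)
    then have "\<alpha> i \<notin> Poly_Mapping.keys (h j)"
      using le[OF \<open>j \<in> I'\<close>] assms(2)[of j] lead_less[of "h j" "\<alpha> j" "\<alpha> i"] j by fastforce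
    then show ?thesis by (simp add: lookup_const_mult in_keys_iff)
  qed (simp add: const_0)
  then have "Poly_Mapping.lookup (\<Sum>j\<in>I. mpoly_const (c j) * h j) (\<alpha> i)
      = Poly_Mapping.lookup (mpoly_const (c i) * h i) (\<alpha> i)"
    unfolding lookup_sum using i(1) assms(1)
    by (subst sum.remove[of I i]) (simp_all add: I'_def)
  also have "\<dots> \<noteq> 0"
    using i(1) assms(2)[of i] by (simp add: I'_def lookup_const_mult lead_def in_keys_iff)
  finally show False using assms(4) by simp
qed

text \<open>One element is kept for each occurring leading exponent. Subtracting a multiple of it
  removes the leading term and lowers the weight, so that every element is eventually reduced to
  0.\<close>

lemma span_by_leads:
  fixes X :: "('n, 'k::field) mpoly set"
  assumes "finite E" "\<And>p \<alpha>. p \<in> mpv.span X \<Longrightarrow> lead p \<alpha> \<Longrightarrow> \<alpha> \<in> E"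
  shows "\<exists>H. finite H \<and> card H \<le> card E \<and> H \<subseteq> mpv.span X \<and> mpv.span X \<subseteq> mpv.span H"
proof -
  define E' where "E' = {\<alpha>. \<exists>p\<in>mpv.span X. lead p \<alpha>}"
  have E': "E' \<subseteq> E" using assms(2) by (auto simp: E'_def)
  then have finE': "finite E'" using assms(1) finite_subset by blast
  have "\<forall>\<alpha>\<in>E'. \<exists>p. p \<in> mpv.span X \<and> lead p \<alpha>" by (auto simp: E'_def)
  then obtain h where h: "\<And>\<alpha>. \<alpha> \<in> E' \<Longrightarrow> h \<alpha> \<in> mpv.span X \<and> lead (h \<alpha>) \<alpha>" by metis
  have in_span: "p \<in> mpv.span (h ` E')" if "p \<in> mpv.span X" "\<forall>\<alpha>\<in>Poly_Mapping.keys p. W \<alpha> < n" for p n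
    using that
  proof (induction n arbitrary: p rule: less_induct)
    case (less n)
    show ?case
    proof (cases "p = 0")
      case False
      then obtain \<alpha> where \<alpha>: "lead p \<alpha>" using lead_exists by blast
      then have "\<alpha> \<in> E'" using less.prems by (auto simp: E'_def)
      note h\<alpha> = h[OF this]
      define c where "c = Poly_Mapping.lookup p \<alpha> / Poly_Mapping.lookup (h \<alpha>) \<alpha>"
      define q where "q = p - mpoly_const c * h \<alpha>"
      have nz: "Poly_Mapping.lookup (h \<alpha>) \<alpha> \<noteq> 0" using h\<alpha> by (simp add: lead_def in_keys_iff)
      have "W \<beta> < W \<alpha>" if "\<beta> \<in> Poly_Mapping.keys q" for \<beta>
      proof -
        have *: "Poly_Mapping.lookup p \<beta> \<noteq> c * Poly_Mapping.lookup (h \<alpha>) \<beta>"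
          using that by (simp add: q_def in_keys_iff lookup_minus lookup_const_mult)
        then have "\<beta> \<noteq> \<alpha>" using nz by (auto simp: c_def)
        moreover have "\<beta> \<in> Poly_Mapping.keys p \<or> \<beta> \<in> Poly_Mapping.keys (h \<alpha>)"
          using * by (auto simp: in_keys_iff)
        ultimately show ?thesis using lead_less \<alpha> h\<alpha> by blast
      qed
      moreover have "W \<alpha> < n" using less.prems(2) \<alpha> by (auto simp: lead_def)
      moreover have "q \<in> mpv.span X"
        unfolding q_def using less.prems(1) h\<alpha> by (intro mpv.span_diff mpv.span_scale) auto
      ultimately have "q \<in> mpv.span (h ` E')" using less.IH by blast
      moreover have "mpoly_const c * h \<alpha> \<in> mpv.span (h ` E')"
        using \<open>\<alpha> \<in> E'\<close> by (intro mpv.span_scale mpv.span_base) blast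
      ultimately have "q + mpoly_const c * h \<alpha> \<in> mpv.span (h ` E')" by (rule mpv.span_add)
      then show ?thesis by (simp add: q_def)
    qed (simp add: mpv.span_zero)
  qed
  have "mpv.span X \<subseteq> mpv.span (h ` E')"
  proof
    fix p assume p: "p \<in> mpv.span X"
    have "\<forall>\<alpha>\<in>Poly_Mapping.keys p. W \<alpha> < Suc (\<Sum>\<alpha>\<in>Poly_Mapping.keys p. W \<alpha>)"
      by (auto simp: less_Suc_eq_le intro!: member_le_sum)
    then show "p \<in> mpv.span (h ` E')" using in_span[OF p] by blast
  qed
  moreover have "card (h ` E') \<le> card E"
    using card_image_le[OF finE', of h] card_mono[OF assms(1) E'] by linarith
  ultimately show ?thesis using finE' h by (intro exI[of _ "h ` E'"]) auto
qed

end

text \<open>Setting a coordinate to 0 that does not vanish identically on the subspace lowers its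
  dimension, so after at most \<open>dim U\<close> such steps only 0 remains.\<close>

lemma coordinates_separate:
  fixes U :: "(real ^ 'n::finite) set"
  assumes "subspace U"
  shows "\<exists>J. card J \<le> dim U \<and> (\<forall>u\<in>U. (\<forall>j\<in>J. u $ j = 0) \<longrightarrow> u = 0)"
  using assms
proof (induction "dim U" arbitrary: U rule: less_induct)
  case less
  show ?case
  proof (cases "U \<subseteq> {0}")
    case True
    then show ?thesis by (intro exI[of _ "{}"]) auto
  next
    case False
    then obtain u where u: "u \<in> U" "u \<noteq> 0" by blast
    then obtain i where i: "u $ i \<noteq> 0" by (auto simp: vec_eq_iff)
    define U' where "U' = {v \<in> U. v $ i = 0}"
    have sub: "subspace U'"
      using less.prems unfolding U'_def subspace_def by auto
    have "U' \<subset> U" using u(1) i by (auto simp: U'_def)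
    then have "span U' \<subset> span U" using sub less.prems by (metis span_eq_iff)
    then have dim: "dim U' < dim U" by (rule dim_psubset)
    from less.hyps[OF dim sub] obtain J where J: "card J \<le> dim U'"
      "\<forall>u\<in>U'. (\<forall>j\<in>J. u $ j = 0) \<longrightarrow> u = 0" by blast
    have "card (insert i J) \<le> dim U" using J(1) dim card_insert_le_m1[of "dim U" J i] by simp
    moreover have "\<forall>u\<in>U. (\<forall>j\<in>insert i J. u $ j = 0) \<longrightarrow> u = 0"
      using J(2) by (auto simp: U'_def)
    ultimately show ?thesis by blast
  qed
qed

context monomial_weight
begin

text \<open>Elements with linearly independent leading exponents are algebraically independent, so there cannot
  be more than \<open>b\<close> of them in an algebra whose dimensions grow like \<open>n ^ b\<close>.\<close>

lemma lead_rank: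
  fixes f :: "'i \<Rightarrow> ('n, 'k::field) mpoly"
  assumes "Q \<noteq> 0"
    and growth: "\<And>n. \<exists>T. finite T \<and> card T \<le> C * ((k * n + b) choose b) \<and>
      (\<forall>p\<in>filt J f n. Q ^ n * p \<in> mpv.span T)"
  shows "dim {exp_vec \<alpha> | \<alpha>. \<exists>n. \<exists>p\<in>filt J f n. lead p \<alpha>} \<le> b" (is "dim ?D \<le> b")
proof (rule ccontr)
  assume "\<not> dim ?D \<le> b"
  obtain Y where Y: "Y \<subseteq> ?D" "independent Y" "card Y = dim ?D" by (rule basis_exists[of ?D])
  with \<open>\<not> dim ?D \<le> b\<close> have "Suc b \<le> card Y" by simp
  then obtain X where X: "X \<subseteq> Y" "card X = Suc b" "finite X"
    using obtain_subset_with_card_n[of "Suc b" Y] by blast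
  have indep: "independent X" using Y(2) X(1) independent_mono by blast
  have "\<forall>x\<in>X. \<exists>n p. p \<in> filt J f n \<and> (\<exists>\<alpha>. lead p \<alpha> \<and> exp_vec \<alpha> = x)"
    using X(1) Y(1) by blast
  then obtain N h where h: "\<And>x. x \<in> X \<Longrightarrow> h x \<in> filt J f (N x)"
    "\<And>x. x \<in> X \<Longrightarrow> \<exists>\<alpha>. lead (h x) \<alpha> \<and> exp_vec \<alpha> = x" by metis
  \<comment> \<open>A common level for the finitely many representatives, which may occur at
    different levels.\<close>
  define K where "K = (\<Sum>x\<in>X. N x)"
  have hK: "h x \<in> filt J f K" if "x \<in> X" for x
    using h(1)[OF that] filt_mono[of "N x" K] X(3) that member_le_sum[of x X N] by (auto simp: K_def)
  define H where "H \<gamma> = (\<Prod>x\<in>X. h x ^ \<gamma> x)" for \<gamma> :: "real ^ 'n \<Rightarrow> nat"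
  have "\<exists>\<beta>. lead (H \<gamma>) \<beta> \<and> exp_vec \<beta> = (\<Sum>x\<in>X. real (\<gamma> x) *\<^sub>R x)" for \<gamma>
    unfolding H_def
  proof (rule lead_prod[OF X(3)])
    fix x assume "x \<in> X"
    then obtain \<alpha> where \<alpha>: "lead (h x) \<alpha>" "exp_vec \<alpha> = x" using h(2) by blast
    show "\<exists>\<beta>. lead (h x ^ \<gamma> x) \<beta> \<and> exp_vec \<beta> = real (\<gamma> x) *\<^sub>R x"
      using lead_power[OF \<alpha>(1), of "\<gamma> x"] \<alpha>(2) by simp
  qed
  then obtain A where A: "\<And>\<gamma>. lead (H \<gamma>) (A \<gamma>)" "\<And>\<gamma>. exp_vec (A \<gamma>) = (\<Sum>x\<in>X. real (\<gamma> x) *\<^sub>R x)"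
    by metis
  \<comment> \<open>Linear independence of \<open>X\<close> enters here: distinct exponents \<gamma>
    give the products \<open>H \<gamma>\<close> distinct leading exponents.\<close>
  have injA: "inj_on A (exps_le X n)" for n
  proof (rule inj_onI)
    fix \<gamma> \<delta> assume *: "\<gamma> \<in> exps_le X n" "\<delta> \<in> exps_le X n" "A \<gamma> = A \<delta>"
    have "(\<Sum>x\<in>X. (real (\<gamma> x) - real (\<delta> x)) *\<^sub>R x) = 0"
      using A(2)[of \<gamma>] A(2)[of \<delta>] *(3) by (simp add: scaleR_left_diff_distrib sum_subtractf)
    then have eq: "\<forall>x\<in>X. real (\<gamma> x) - real (\<delta> x) = 0"
      using independentD[OF indep X(3) order_refl, of "\<lambda>x. real (\<gamma> x) - real (\<delta> x)"] by blast
    show "\<gamma> = \<delta>"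
    proof
      fix x show "\<gamma> x = \<delta> x" using eq * by (cases "x \<in> X") (auto simp: exps_le_def)
    qed
  qed
  have Hfilt: "H \<gamma> \<in> filt J f (n * K)" if "\<gamma> \<in> exps_le X n" for \<gamma> n
  proof -
    have "H \<gamma> \<in> filt J f (\<Sum>x\<in>X. \<gamma> x * K)"
      unfolding H_def using X(3) hK by (intro filt_prod filt_power) auto
    moreover have "(\<Sum>x\<in>X. \<gamma> x * K) \<le> n * K"
      using that by (simp add: sum_distrib_right[symmetric] exps_le_def)
    ultimately show ?thesis using filt_mono by blast
  qed
  \<comment> \<open>At level \<open>n * K\<close> there are \<open>(n + Suc b) choose Suc b\<close>
    independent products, while the growth bound is only of order \<open>n ^ b\<close>. The linear
    relation forced by this persists after cancelling the power of \<open>Q\<close>, a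
    contradiction.\<close>
  obtain n where n: "C * ((k * K * n + b) choose b) < (n + Suc b) choose Suc b"
    using binomial_outgrows by blast
  from growth[of "n * K"] obtain T where T: "finite T" "card T \<le> C * ((k * (n * K) + b) choose b)"
    "\<forall>p\<in>filt J f (n * K). Q ^ (n * K) * p \<in> mpv.span T" by (elim exE conjE)
  have "card T < card (exps_le X n)"
    using T(2) n card_exps_le[OF X(3), of n] X(2) by (simp add: mult_ac)
  moreover have "Q ^ (n * K) * H \<gamma> \<in> mpv.span T" if "\<gamma> \<in> exps_le X n" for \<gamma>
    using T(3) Hfilt[OF that] by (rule bspec)
  ultimately obtain c where c: "\<exists>\<gamma>\<in>exps_le X n. c \<gamma> \<noteq> 0"
    "(\<Sum>\<gamma>\<in>exps_le X n. mpoly_const (c \<gamma>) * (Q ^ (n * K) * H \<gamma>)) = 0"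
    using mpv.exists_relation[OF finite_exps_le[OF X(3)] T(1), of n "\<lambda>\<gamma>. Q ^ (n * K) * H \<gamma>"]
    by (elim exE conjE meta_impE) auto
  have "Q ^ (n * K) * (\<Sum>\<gamma>\<in>exps_le X n. mpoly_const (c \<gamma>) * H \<gamma>) = 0"
    using c(2) by (simp add: sum_distrib_left mult_ac)
  moreover have "Q ^ j \<noteq> 0" for j
    using \<open>Q \<noteq> 0\<close> by (induction j) (use mpoly_domain in auto)
  ultimately have "(\<Sum>\<gamma>\<in>exps_le X n. mpoly_const (c \<gamma>) * H \<gamma>) = 0" using mpoly_domain by blast
  from lead_independent[OF finite_exps_le[OF X(3)] A(1) injA this] c(1) show False by blast
qed

text \<open>Leading exponents differ by vectors of \<open>span D\<close>, so at most
  \<open>r\<close> coordinates tell them apart. The sum of these coordinates is at most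
  \<open>d * n\<close>, which reduces the count to monomials of bounded degree in at most
  \<open>r\<close> variables.\<close>

lemma filt_spanning_set:
  fixes f :: "'i \<Rightarrow> ('n, 'k::field) mpoly"
  assumes "finite J" and deg: "\<And>j. j \<in> J \<Longrightarrow> total_degree (f j) \<le> d"
    and rank: "dim {exp_vec \<alpha> | \<alpha>. \<exists>n. \<exists>p\<in>filt J f n. lead p \<alpha>} \<le> r"
  shows "\<exists>H. finite H \<and> card H \<le> (d * n + r) choose r \<and> filt J f n \<subseteq> mpv.span H"
proof -
  define md where "md \<alpha> = (\<Sum>v\<in>UNIV. Poly_Mapping.lookup \<alpha> v)" for \<alpha> :: "'n \<Rightarrow>\<^sub>0 nat"
  define dg where "dg p t \<longleftrightarrow> (\<forall>\<alpha>\<in>Poly_Mapping.keys p. md \<alpha> \<le> t)" for p :: "('n, 'k) mpoly" and t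
  have dg_f: "dg (f j) d" if "j \<in> J" for j
    unfolding dg_def
  proof
    fix \<alpha> assume \<alpha>: "\<alpha> \<in> Poly_Mapping.keys (f j)"
    have "md \<alpha> = (\<Sum>v\<in>Poly_Mapping.keys \<alpha>. Poly_Mapping.lookup \<alpha> v)"
      unfolding md_def by (intro sum.mono_neutral_right) (auto simp: in_keys_iff)
    also have "\<dots> \<le> total_degree (f j)"
      unfolding total_degree_def using \<alpha> by (intro Max_ge) auto
    finally show "md \<alpha> \<le> d" using deg[OF that] by simp
  qed
  have dg_mult: "dg (p * q) (s + t)" if "dg p s" "dg q t" for p q s t
    unfolding dg_def
  proof
    fix \<alpha> assume "\<alpha> \<in> Poly_Mapping.keys (p * q)"
    then obtain \<beta> \<gamma> where *: "\<alpha> = \<beta> + \<gamma>" "\<beta> \<in> Poly_Mapping.keys p" "\<gamma> \<in> Poly_Mapping.keys q"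
      using keys_mult by blast
    have "md \<alpha> = md \<beta> + md \<gamma>" by (simp add: *(1) md_def lookup_add sum.distrib)
    then show "md \<alpha> \<le> s + t" using that *(2,3) by (auto simp: dg_def intro: add_mono)
  qed
  have dg_one: "dg 1 0" by (simp add: dg_def md_def)
  have dg_pow: "dg (p ^ k) (t * k)" if "dg p t" for p t k
    by (induction k) (use that dg_one dg_mult in \<open>simp_all\<close>)
  have dg_mon: "dg (mon J' \<gamma> f) (\<Sum>j\<in>J'. d * \<gamma> j)" if "finite J'" "J' \<subseteq> J" for J' \<gamma>
    using that
    by (induction J' rule: finite_induct) (use dg_f dg_one dg_mult dg_pow in \<open>auto simp: mon_def\<close>)
  have dg_filt: "dg p (d * n)" if "p \<in> filt J f n" for p
    using that unfolding filt_def
  proof (induction rule: mpv.span_induct_alt)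
    case base
    show ?case by (simp add: dg_def)
  next
    case (step c x p)
    then obtain \<gamma> where \<gamma>: "\<gamma> \<in> exps_le J n" "x = mon J \<gamma> f" by blast
    have "(\<Sum>j\<in>J. d * \<gamma> j) \<le> d * n"
      using \<gamma>(1) by (simp add: sum_distrib_left[symmetric] exps_le_def)
    then have x: "dg x (d * n)" using dg_mon[OF assms(1) order_refl, of \<gamma>] \<gamma>(2)
      by (auto simp: dg_def intro: order_trans)
    have "\<alpha> \<in> Poly_Mapping.keys x \<or> \<alpha> \<in> Poly_Mapping.keys p"
      if "\<alpha> \<in> Poly_Mapping.keys (mpoly_const c * x + p)" for \<alpha>
      using that by (auto simp: in_keys_iff lookup_add lookup_const_mult)
    then show ?case using x step.IH unfolding dg_def by blast
  qed
  define D where "D = {exp_vec \<alpha> | \<alpha>. \<exists>n. \<exists>p\<in>filt J f n. lead p \<alpha>}"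
  obtain I where I: "card I \<le> dim (span D)" "\<forall>u\<in>span D. (\<forall>i\<in>I. u $ i = 0) \<longrightarrow> u = 0"
    using coordinates_separate[OF subspace_span] by blast
  define E where "E = {\<alpha>. \<exists>p\<in>filt J f n. lead p \<alpha>}"
  define \<pi> where "\<pi> \<alpha> = (\<lambda>v. if v \<in> I then Poly_Mapping.lookup \<alpha> v else 0)" for \<alpha> :: "'n \<Rightarrow>\<^sub>0 nat"
  have inj: "inj_on \<pi> E"
  proof (rule inj_onI)
    fix \<alpha> \<beta> assume *: "\<alpha> \<in> E" "\<beta> \<in> E" "\<pi> \<alpha> = \<pi> \<beta>"
    then have "exp_vec \<alpha> - exp_vec \<beta> \<in> span D"
      by (intro span_diff span_base) (auto simp: D_def E_def)
    moreover have "(exp_vec \<alpha> - exp_vec \<beta>) $ i = 0" if "i \<in> I" for i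
      using fun_cong[OF *(3), of i] that by (simp add: \<pi>_def exp_vec_def)
    ultimately have "exp_vec \<alpha> - exp_vec \<beta> = 0" using I(2) by blast
    then show "\<alpha> = \<beta>" using exp_vec_inj by simp
  qed
  have img: "\<pi> ` E \<subseteq> exps_le I (d * n)"
  proof
    fix \<gamma> assume "\<gamma> \<in> \<pi> ` E"
    then obtain \<alpha> p where \<alpha>: "\<gamma> = \<pi> \<alpha>" "p \<in> filt J f n" "lead p \<alpha>" by (auto simp: E_def)
    have "(\<Sum>v\<in>I. \<pi> \<alpha> v) \<le> md \<alpha>"
      unfolding md_def \<pi>_def by (simp, intro sum_mono2) auto
    also have "\<dots> \<le> d * n" using dg_filt[OF \<alpha>(2)] \<alpha>(3) by (auto simp: dg_def lead_def)
    finally show "\<gamma> \<in> exps_le I (d * n)" by (simp add: \<alpha>(1) exps_le_def) (simp add: \<pi>_def)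
  qed
  have finE: "finite E" using finite_exps_le[of I "d * n"] img inj by (meson finite finite_imageD finite_subset)
  have "card E \<le> card (exps_le I (d * n))"
    using card_inj_on_le[OF inj img] finite_exps_le[of I] by simp
  \<comment> \<open>With lower index \<open>d * n\<close>, replacing \<open>card I\<close> by
    \<open>r\<close> changes the upper index alone, where monotonicity applies.\<close>
  also have "\<dots> = (d * n + card I) choose (d * n)"
    using card_exps_le[of I] binomial_symmetric[of "card I" "d * n + card I"] by simp
  also have "\<dots> \<le> (d * n + r) choose (d * n)"
    using I(1) rank unfolding D_def[symmetric] dim_span by (intro binomial_right_mono) simp
  also have "\<dots> = (d * n + r) choose r"
    using binomial_symmetric[of r "d * n + r"] by simp
  finally have "card E \<le> (d * n + r) choose r" .
  moreover obtain H where "finite H" "card H \<le> card E" "filt J f n \<subseteq> mpv.span H"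
    using span_by_leads[OF finE, of "(\<lambda>\<alpha>. mon J \<alpha> f) ` exps_le J n"]
    unfolding E_def filt_def by blast
  ultimately show ?thesis by (meson order_trans)
qed

end

text \<open>This guarantees that the choice in \<open>trdeg\<close> really yields a maximal
  independent set. The empty set is independent, so there are candidates among the finitely many
  subsets.\<close>

lemma finite_maximal_alg_independent:
  fixes F :: "('v, 'k::field) mpoly set"
  assumes "finite F"
  shows "\<exists>B. maximal_alg_independent F B"
proof -
  have "alg_independent ({} :: ('v, 'k) mpoly set)"
    unfolding alg_independent_def
  proof (intro allI impI)
    fix P :: "(('v, 'k) mpoly, 'k) mpoly"
    assume "\<forall>m\<in>Poly_Mapping.keys P. Poly_Mapping.keys m \<subseteq> {}" "mpoly_subst mpoly_const (\<lambda>b. b) P = 0"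
    then have keys: "Poly_Mapping.keys P \<subseteq> {0}"
      by (metis in_keys_iff lookup_zero poly_mapping_eqI singletonI subset_empty subsetI empty_iff)
    have "mpoly_subst mpoly_const (\<lambda>b. b) P = (\<Sum>m\<in>{0}. mpoly_const (Poly_Mapping.lookup P m) *
        (\<Prod>v\<in>Poly_Mapping.keys m. v ^ Poly_Mapping.lookup m v))"
      unfolding mpoly_subst_def using keys
      by (intro sum.mono_neutral_left) (auto simp: in_keys_iff const_0)
    then have "mpoly_const (Poly_Mapping.lookup P 0) = (0 :: ('v, 'k) mpoly)"
      using \<open>mpoly_subst _ _ P = 0\<close> by simp
    then have "Poly_Mapping.lookup (mpoly_const (Poly_Mapping.lookup P 0) :: ('v, 'k) mpoly) 0 = 0"
      by simp
    then have "Poly_Mapping.lookup P 0 = 0" by (simp add: mpoly_const_def)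
    then show "P = 0" using keys by (metis in_keys_iff lookup_zero poly_mapping_eqI singletonD subsetD)
  qed
  then have "{B. B \<subseteq> F \<and> alg_independent B} \<noteq> {}" by blast
  moreover have "finite {B. B \<subseteq> F \<and> alg_independent B}" using assms by simp
  ultimately obtain B where B: "B \<in> {B. B \<subseteq> F \<and> alg_independent B}"
    "\<forall>B'\<in>{B. B \<subseteq> F \<and> alg_independent B}. B \<subseteq> B' \<longrightarrow> B = B'"
    using finite_has_maximal by meson
  then show ?thesis unfolding maximal_alg_independent_def by (intro exI[of _ B]) blast
qed

text \<open>The bound is the dimension of the polynomials of degree at most \<open>d * n\<close> in \<open>r\<close> variables.\<close>

lemma filt_dimension_le:
  fixes f :: "'i \<Rightarrow> ('n::finite, 'k::field) mpoly"
  assumes "finite J" and deg: "\<And>j. j \<in> J \<Longrightarrow> total_degree (f j) \<le> d"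
    and "trdeg (f ` J) = r"
  shows "\<exists>H. finite H \<and> card H \<le> (d * n + r) choose r \<and> filt J f n \<subseteq> mpv.span H"
proof -
  define B where "B = (SOME B. maximal_alg_independent (f ` J) B)"
  have B: "maximal_alg_independent (f ` J) B"
    unfolding B_def using assms(1) by (intro someI_ex[OF finite_maximal_alg_independent]) simp
  have cardB: "card B = r" using assms(3) by (simp add: B_def trdeg_def)
  have "B \<subseteq> f ` J" "alg_independent B"
    using B by (simp_all add: maximal_alg_independent_def)
  then have finB: "finite B" using assms(1) finite_subset by blast
  obtain W :: "('n \<Rightarrow>\<^sub>0 nat) \<Rightarrow> nat" where "monomial_weight W" using monomial_weight_exists by blast
  then interpret monomial_weight W .
  have "\<exists>e a n. (\<forall>i\<le>e. a i \<in> filt B (\<lambda>b. b) n) \<and> a e \<noteq> 0 \<and> (\<Sum>i\<le>e. a i * f j ^ i) = 0"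
    if "j \<in> J" for j
  proof (cases "f j \<in> B")
    case True
    have "mon B ((\<lambda>_. 0)(f j := 1)) (\<lambda>b. b) = f j"
      using mon_Suc[OF finB True, of "\<lambda>_. 0" "\<lambda>b. b"] by (simp add: mon_zero)
    moreover have "(\<lambda>_. 0)(f j := 1) \<in> exps_le B 1"
      using exps_le_Suc[OF finB True, of "\<lambda>_. 0" 0] by (simp add: exps_le_def)
    ultimately have "f j \<in> filt B (\<lambda>b. b) 1" using mon_in_filt by metis
    \<comment> \<open>The trivial relation of a member of \<open>B\<close>: constant coefficient
      \<open>- f j\<close>, top coefficient 1.\<close>
    then show ?thesis
      by (intro exI[of _ 1] exI[of _ "\<lambda>i. if i = 0 then - f j else 1"])
         (auto simp: one_in_filt filt_uminus)
  next
    case False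
    then have "\<not> alg_independent (insert (f j) B)"
      using B that unfolding maximal_alg_independent_def by blast
    then show ?thesis by (rule algebraic_relation[OF \<open>alg_independent B\<close> finB False])
  qed
  then have "\<exists>Q e k. Q \<noteq> 0 \<and> Q \<in> filt B (\<lambda>b. b) k \<and> 0 < e \<and>
      (\<forall>j\<in>J. \<exists>a. (\<forall>i<e. a i \<in> filt B (\<lambda>b. b) k) \<and> Q * f j ^ e = (\<Sum>i<e. a i * f j ^ i))"
    by (intro common_relation[OF _ assms(1)] mpoly_domain) auto
  then obtain Q e k where Q: "Q \<noteq> 0" "Q \<in> filt B (\<lambda>b. b) k" "0 < e"
    "\<forall>j\<in>J. \<exists>a. (\<forall>i<e. a i \<in> filt B (\<lambda>b. b) k) \<and> Q * f j ^ e = (\<Sum>i<e. a i * f j ^ i)"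
    by (elim exE conjE)
  have "\<exists>C. \<forall>n. \<exists>T. finite T \<and> card T \<le> C * ((k * n + card B) choose card B) \<and>
      (\<forall>p\<in>filt J f n. Q ^ n * p \<in> mpv.span T)"
    using Q(4) by (intro growth[OF assms(1) finB Q(2,3)]) (rule bspec)
  then obtain C where "\<forall>n. \<exists>T. finite T \<and> card T \<le> C * ((k * n + card B) choose card B) \<and>
      (\<forall>p\<in>filt J f n. Q ^ n * p \<in> mpv.span T)" by (elim exE)
  then have "dim {exp_vec \<alpha> | \<alpha>. \<exists>n. \<exists>p\<in>filt J f n. lead p \<alpha>} \<le> card B"
    by (intro lead_rank[OF Q(1)]) (rule spec)
  then show ?thesis
    unfolding cardB by (intro filt_spanning_set[OF assms(1) deg])
qed

section \<open>Generic linear forms\<close>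

text \<open>A span of functions with indexed generators. The argument \<open>z\<close> will pair a
  coefficient matrix with a point, so that relations hold for indeterminate coefficients.\<close>

definition comb :: "'t set \<Rightarrow> ('t \<Rightarrow> 'z \<Rightarrow> 'k::field) \<Rightarrow> ('z \<Rightarrow> 'k) set" where
  "comb T \<tau> = {F. \<exists>q. \<forall>z. F z = (\<Sum>t\<in>T. q t * \<tau> t z)}"

lemma comb_base: "finite T \<Longrightarrow> t \<in> T \<Longrightarrow> \<tau> t \<in> comb T \<tau>"
  unfolding comb_def
  by (intro CollectI exI[of _ "\<lambda>u. if u = t then 1 else 0"]) (simp add: if_distrib[of "\<lambda>x. x * _"] cong: if_cong)

lemma comb_lincomb:
  assumes "\<And>i. i \<in> I \<Longrightarrow> F i \<in> comb T \<tau>"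
  shows "(\<lambda>z. \<Sum>i\<in>I. c i * F i z) \<in> comb T \<tau>"
proof -
  have "\<forall>i\<in>I. \<exists>q. \<forall>z. F i z = (\<Sum>t\<in>T. q t * \<tau> t z)" using assms by (simp add: comb_def)
  then obtain Q where Q: "\<And>i z. i \<in> I \<Longrightarrow> F i z = (\<Sum>t\<in>T. Q i t * \<tau> t z)" by metis
  have "(\<Sum>i\<in>I. c i * F i z) = (\<Sum>t\<in>T. (\<Sum>i\<in>I. c i * Q i t) * \<tau> t z)" for z
  proof -
    have "(\<Sum>i\<in>I. c i * F i z) = (\<Sum>i\<in>I. \<Sum>t\<in>T. c i * Q i t * \<tau> t z)"
      by (intro sum.cong refl) (simp add: Q sum_distrib_left mult.assoc)
    also have "\<dots> = (\<Sum>t\<in>T. (\<Sum>i\<in>I. c i * Q i t) * \<tau> t z)"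
      by (subst sum.swap) (simp add: sum_distrib_right)
    finally show ?thesis .
  qed
  then show ?thesis
    unfolding comb_def by (intro CollectI exI[of _ "\<lambda>t. \<Sum>i\<in>I. c i * Q i t"]) simp
qed

lemma comb_mult:
  assumes F: "F \<in> comb T \<tau>" and "\<And>t. t \<in> T \<Longrightarrow> (\<lambda>z. G z * \<tau> t z) \<in> comb T' \<tau>'"
  shows "(\<lambda>z. G z * F z) \<in> comb T' \<tau>'"
proof -
  obtain q where q: "\<And>z. F z = (\<Sum>t\<in>T. q t * \<tau> t z)" using F by (auto simp: comb_def)
  have "(\<lambda>z. \<Sum>t\<in>T. q t * (G z * \<tau> t z)) \<in> comb T' \<tau>'" by (rule comb_lincomb[OF assms(2)])
  moreover have "G z * F z = (\<Sum>t\<in>T. q t * (G z * \<tau> t z))" for z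
    by (simp add: q sum_distrib_left mult_ac)
  ultimately show ?thesis by simp
qed

lemma comb_relation:
  assumes "finite T" "finite I" "card T < card I" "\<And>i. i \<in> I \<Longrightarrow> g i \<in> comb T \<tau>"
  shows "\<exists>p. (\<exists>i\<in>I. p i \<noteq> 0) \<and> (\<forall>z. (\<Sum>i\<in>I. p i * g i z) = 0)"
proof -
  have "\<forall>i\<in>I. \<exists>q. \<forall>z. g i z = (\<Sum>t\<in>T. q t * \<tau> t z)" using assms(4) by (simp add: comb_def)
  then obtain M where M: "\<And>i z. i \<in> I \<Longrightarrow> g i z = (\<Sum>t\<in>T. M i t * \<tau> t z)" by metis
  from exists_kernel_vector[OF assms(1-3), of M] obtain p
    where p: "\<exists>i\<in>I. p i \<noteq> 0" "\<forall>t\<in>T. (\<Sum>i\<in>I. p i * M i t) = 0" by (elim exE conjE)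
  have "(\<Sum>i\<in>I. p i * g i z) = 0" for z
  proof -
    have "(\<Sum>i\<in>I. p i * g i z) = (\<Sum>i\<in>I. \<Sum>t\<in>T. p i * M i t * \<tau> t z)"
      by (intro sum.cong refl) (simp add: M sum_distrib_left mult.assoc)
    also have "\<dots> = (\<Sum>t\<in>T. (\<Sum>i\<in>I. p i * M i t) * \<tau> t z)"
      by (subst sum.swap) (simp add: sum_distrib_right)
    finally show ?thesis using p(2) by simp
  qed
  then show ?thesis using p(1) by blast
qed

text \<open>Products of powers of the linear forms \<open>\<Sum>j. Y (i, j) * \<phi> j x\<close>, expanded into monomials which
  are homogeneous of degree \<open>\<rho> i\<close> in row \<open>i\<close> of \<open>Y\<close>.\<close>

context
  fixes Rw :: "'r set" and Cl :: "'c set" and \<phi> :: "'c \<Rightarrow> 'x \<Rightarrow> 'k::field"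
  assumes fin: "finite Rw" "finite Cl"
begin

definition row_mon :: "('r \<Rightarrow> 'c \<Rightarrow> nat) \<Rightarrow> ('r \<times> 'c \<Rightarrow> 'k) \<Rightarrow> 'k" where
  "row_mon e Y = (\<Prod>i\<in>Rw. mon Cl (e i) (\<lambda>j. Y (i, j)))"

definition bimon :: "('r \<Rightarrow> 'c \<Rightarrow> nat) \<times> ('c \<Rightarrow> nat) \<Rightarrow> ('r \<times> 'c \<Rightarrow> 'k) \<times> 'x \<Rightarrow> 'k" where
  "bimon t z = row_mon (fst t) (fst z) * mon Cl (snd t) (\<lambda>j. \<phi> j (snd z))"

definition bidx :: "('r \<Rightarrow> nat) \<Rightarrow> nat \<Rightarrow> (('r \<Rightarrow> 'c \<Rightarrow> nat) \<times> ('c \<Rightarrow> nat)) set" where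
  "bidx \<rho> n = PiE Rw (\<lambda>i. exps Cl (\<rho> i)) \<times> exps Cl n"

lemma finite_bidx: "finite (bidx \<rho> n)"
  unfolding bidx_def using fin by (intro finite_cartesian_product finite_PiE finite_exps) auto

lemma exps_Suc: "j \<in> Cl \<Longrightarrow> \<alpha> \<in> exps Cl n \<Longrightarrow> \<alpha>(j := Suc (\<alpha> j)) \<in> exps Cl (Suc n)"
proof -
  assume *: "j \<in> Cl" "\<alpha> \<in> exps Cl n"
  have "(\<Sum>w\<in>Cl - {j}. (\<alpha>(j := Suc (\<alpha> j))) w) = (\<Sum>w\<in>Cl - {j}. \<alpha> w)"
    by (intro sum.cong) auto
  then show ?thesis using * fin by (auto simp: exps_def sum.remove[of Cl j])
qed

lemma comb_step:
  assumes F: "F \<in> comb (bidx \<rho> n) bimon" and i: "i \<in> Rw"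
  shows "(\<lambda>z. (\<Sum>j\<in>Cl. fst z (i, j) * \<phi> j (snd z)) * F z) \<in> comb (bidx (\<rho>(i := Suc (\<rho> i))) (Suc n)) bimon"
  using F
proof (rule comb_mult)
  fix t assume t: "t \<in> bidx \<rho> n"
  define u where "u j = ((fst t)(i := (fst t i)(j := Suc (fst t i j))), (snd t)(j := Suc (snd t j)))" for j
  have u: "u j \<in> bidx (\<rho>(i := Suc (\<rho> i))) (Suc n)" if "j \<in> Cl" for j
    using t i that by (auto simp: bidx_def u_def PiE_iff extensional_def intro!: exps_Suc)
  have bim: "bimon (u j) z = fst z (i, j) * \<phi> j (snd z) * bimon t z" if "j \<in> Cl" for j z
  proof -
    have "(\<Prod>l\<in>Rw - {i}. mon Cl (fst (u j) l) (\<lambda>j. fst z (l, j))) = (\<Prod>l\<in>Rw - {i}. mon Cl (fst t l) (\<lambda>j. fst z (l, j)))"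
      by (intro prod.cong) (auto simp: u_def)
    then have "row_mon (fst (u j)) (fst z) = fst z (i, j) * row_mon (fst t) (fst z)"
      using fin(1) i mon_Suc[OF fin(2) that, of "fst t i" "\<lambda>j. fst z (i, j)"]
      by (simp add: row_mon_def prod.remove[of Rw i] u_def mult.assoc del: fun_upd_apply) simp
    moreover have "mon Cl (snd (u j)) (\<lambda>j. \<phi> j (snd z)) = \<phi> j (snd z) * mon Cl (snd t) (\<lambda>j. \<phi> j (snd z))"
      unfolding u_def snd_conv by (rule mon_Suc[OF fin(2) that])
    ultimately show ?thesis by (simp only: bimon_def mult_ac)
  qed
  have "(\<lambda>z. \<Sum>j\<in>Cl. 1 * bimon (u j) z) \<in> comb (bidx (\<rho>(i := Suc (\<rho> i))) (Suc n)) bimon"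
    by (intro comb_lincomb comb_base finite_bidx u)
  moreover have "(\<Sum>j\<in>Cl. fst z (i, j) * \<phi> j (snd z)) * bimon t z = (\<Sum>j\<in>Cl. 1 * bimon (u j) z)" for z
    by (simp add: bim sum_distrib_right)
  ultimately show "(\<lambda>z. (\<Sum>j\<in>Cl. fst z (i, j) * \<phi> j (snd z)) * bimon t z)
      \<in> comb (bidx (\<rho>(i := Suc (\<rho> i))) (Suc n)) bimon" by simp
qed

lemma comb_power:
  assumes F: "F \<in> comb (bidx \<rho> n) bimon" and i: "i \<in> Rw"
  shows "(\<lambda>z. (\<Sum>j\<in>Cl. fst z (i, j) * \<phi> j (snd z)) ^ a * F z) \<in> comb (bidx (\<rho>(i := \<rho> i + a)) (n + a)) bimon"
proof (induction a)
  case 0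
  show ?case using F by simp
next
  case (Suc a)
  have "(\<rho>(i := \<rho> i + a))(i := Suc ((\<rho>(i := \<rho> i + a)) i)) = \<rho>(i := \<rho> i + Suc a)" by simp
  with comb_step[OF Suc.IH i] show ?case by (simp add: mult.assoc del: fun_upd_apply)
qed

lemma comb_product:
  assumes "\<beta> \<in> PiE Rw (\<lambda>i. exps Cl (\<rho> i))" and "U \<subseteq> Rw"
  shows "(\<lambda>z. (\<Prod>i\<in>U. (\<Sum>j\<in>Cl. fst z (i, j) * \<phi> j (snd z)) ^ a i) * row_mon \<beta> (fst z))
    \<in> comb (bidx (\<lambda>i. if i \<in> U then \<rho> i + a i else \<rho> i) (\<Sum>i\<in>U. a i)) bimon"
  using finite_subset[OF assms(2) fin(1)] assms(2)
proof (induction U rule: finite_induct)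
  case empty
  have "bimon (\<beta>, \<lambda>_. 0) \<in> comb (bidx \<rho> 0) bimon"
    using assms(1) by (intro comb_base finite_bidx) (auto simp: bidx_def exps_def)
  moreover have "bimon (\<beta>, \<lambda>_. 0) = (\<lambda>z. row_mon \<beta> (fst z))"
    by (simp add: fun_eq_iff bimon_def mon_zero)
  ultimately show ?case by simp
next
  case (insert i U)
  then have i: "i \<in> Rw" and IH: "(\<lambda>z. (\<Prod>i\<in>U. (\<Sum>j\<in>Cl. fst z (i, j) * \<phi> j (snd z)) ^ a i) * row_mon \<beta> (fst z))
    \<in> comb (bidx (\<lambda>i. if i \<in> U then \<rho> i + a i else \<rho> i) (\<Sum>i\<in>U. a i)) bimon" by auto
  have "(\<lambda>l. if l \<in> U then \<rho> l + a l else \<rho> l)(i := (if i \<in> U then \<rho> i + a i else \<rho> i) + a i)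
      = (\<lambda>l. if l \<in> insert i U then \<rho> l + a l else \<rho> l)" using insert.hyps by auto
  with comb_power[OF IH i, of "a i"] show ?case
    using insert.hyps by (simp add: mult.assoc add.commute)
qed

text \<open>A product of powers with exponents \<open>a\<close> is padded by monomials of degree
  \<open>\<delta> - a i\<close> in row \<open>i\<close>, so that it has degree \<delta> in each row.
  All padded products then lie in a space whose dimension is at most the left side of
  \<open>card\<close>, and there are more of them than that.\<close>

lemma generic_relation:
  fixes \<psi> :: "'h \<Rightarrow> 'x \<Rightarrow> 'k"
  assumes "N \<le> \<delta>" and H: "finite H" "\<And>\<gamma>. \<gamma> \<in> exps Cl N \<Longrightarrow> (\<lambda>x. mon Cl \<gamma> (\<lambda>j. \<phi> j x)) \<in> comb H \<psi>"
    and card: "card (exps Cl \<delta>) ^ card Rw * card H < card (SIGMA a:exps Rw N. PiE Rw (\<lambda>i. exps Cl (\<delta> - a i)))"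
      (is "_ < card ?I")
  shows "\<exists>p. (\<exists>t\<in>?I. p t \<noteq> 0) \<and> (\<forall>Y x. (\<Sum>t\<in>?I. p t *
    ((\<Prod>i\<in>Rw. (\<Sum>j\<in>Cl. Y (i, j) * \<phi> j x) ^ fst t i) * row_mon (snd t) Y)) = 0)"
proof -
  define T where "T = PiE Rw (\<lambda>_. exps Cl \<delta>) \<times> H"
  define \<tau> where "\<tau> t z = row_mon (fst t) (fst z) * \<psi> (snd t) (snd z)" for t and z :: "('r \<times> 'c \<Rightarrow> 'k) \<times> 'x"
  have finT: "finite T"
    unfolding T_def using fin H by (intro finite_cartesian_product finite_PiE finite_exps) auto
  have cardT: "card T = card (exps Cl \<delta>) ^ card Rw * card H"
    unfolding T_def using fin by (simp add: card_cartesian_product card_PiE)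
  have finI: "finite ?I"
    using fin by (intro finite_SigmaI finite_PiE finite_exps) auto
  define g where "g t z = (\<Prod>i\<in>Rw. (\<Sum>j\<in>Cl. fst z (i, j) * \<phi> j (snd z)) ^ fst t i) * row_mon (snd t) (fst z)"
    for t and z :: "('r \<times> 'c \<Rightarrow> 'k) \<times> 'x"
  have g: "g t \<in> comb T \<tau>" if t: "t \<in> ?I" for t
  proof -
    have a: "fst t \<in> exps Rw N" and \<beta>: "snd t \<in> PiE Rw (\<lambda>i. exps Cl (\<delta> - fst t i))" using t by auto
    \<comment> \<open>The subtraction is truncated; \<open>N \<le> \<delta>\<close> makes the
      padding exact.\<close>
    have "fst t i \<le> \<delta>" if "i \<in> Rw" for i
      using a that assms(1) member_le_sum[of i Rw "fst t"] fin by (auto simp: exps_def)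
    then have "bidx (\<lambda>i. if i \<in> Rw then \<delta> - fst t i + fst t i else \<delta> - fst t i) (\<Sum>i\<in>Rw. fst t i)
        = bidx (\<lambda>_. \<delta>) N"
      unfolding bidx_def using a by (auto simp: exps_def cong: PiE_cong)
    with comb_product[OF \<beta> order_refl, of "fst t"]
    have *: "(\<lambda>z. (\<Prod>i\<in>Rw. (\<Sum>j\<in>Cl. fst z (i, j) * \<phi> j (snd z)) ^ fst t i) * row_mon (snd t) (fst z))
        \<in> comb (bidx (\<lambda>_. \<delta>) N) bimon" by simp
    have "(\<lambda>z. 1 * bimon u z) \<in> comb T \<tau>" if u: "u \<in> bidx (\<lambda>_. \<delta>) N" for u
    proof -
      have "(\<lambda>z. mon Cl (snd u) (\<lambda>j. \<phi> j (snd z))) \<in> comb H (\<lambda>h z. \<psi> h (snd z :: 'x))"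
        using H(2)[of "snd u"] u by (auto simp: bidx_def comb_def)
      then have "(\<lambda>z. row_mon (fst u) (fst z) * mon Cl (snd u) (\<lambda>j. \<phi> j (snd z))) \<in> comb T \<tau>"
      proof (rule comb_mult)
        fix h assume "h \<in> H"
        then have "\<tau> (fst u, h) \<in> comb T \<tau>"
          using u by (intro comb_base finT) (auto simp: T_def bidx_def)
        moreover have "\<tau> (fst u, h) = (\<lambda>z. row_mon (fst u) (fst z) * \<psi> h (snd z))"
          by (simp add: fun_eq_iff \<tau>_def)
        ultimately show "(\<lambda>z. row_mon (fst u) (fst z) * \<psi> h (snd z)) \<in> comb T \<tau>" by simp
      qed
      then show ?thesis by (simp add: bimon_def)
    qed
    from comb_mult[OF * this] show ?thesis by (simp add: g_def[abs_def])
  qed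
  have "card T < card ?I" using card cardT by simp
  then have "\<exists>p. (\<exists>t\<in>?I. p t \<noteq> 0) \<and> (\<forall>z. (\<Sum>t\<in>?I. p t * g t z) = 0)"
    by (rule comb_relation[OF finT finI]) (rule g)
  then obtain p where p: "\<exists>t\<in>?I. p t \<noteq> 0"
    "\<forall>z. (\<Sum>t\<in>?I. p t * g t z) = 0" by (elim exE conjE)
  show ?thesis
  proof (intro exI[of _ p] conjI p(1) allI)
    fix Y x
    show "(\<Sum>t\<in>?I. p t * ((\<Prod>i\<in>Rw. (\<Sum>j\<in>Cl. Y (i, j) * \<phi> j x) ^ fst t i) * row_mon (snd t) Y)) = 0"
      using spec[OF p(2), of "(Y, x)"] by (simp add: g_def)
  qed
qed

end

text \<open>Replacing row \<open>i\<close> by \<open>C i + \<mu> i * V\<close>, with \<open>V\<close> the row \<open>t\<close>, makes the relation monic in the last linear form \<open>L\<close>: at a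
  point where the other forms vanish it reads \<open>R * L ^ N = 0\<close>.\<close>

lemma generic_forms:
  fixes \<phi> :: "nat \<Rightarrow> 'x \<Rightarrow> 'k::field" and \<psi> :: "'h \<Rightarrow> 'x \<Rightarrow> 'k" and Rw :: "'r set"
  assumes inf: "infinite (UNIV :: 'k set)" and "finite Rw" "t \<notin> Rw" "N \<le> \<delta>"
    and H: "finite H" "\<And>\<gamma>. \<gamma> \<in> exps {1..m} N \<Longrightarrow> (\<lambda>x. mon {1..m} \<gamma> (\<lambda>j. \<phi> j x)) \<in> comb H \<psi>"
    and card: "card (exps {1..m} \<delta>) ^ Suc (card Rw) * card H
      < card (SIGMA a:exps (insert t Rw) N. PiE (insert t Rw) (\<lambda>i. exps {1..m} (\<delta> - a i)))"
      (is "_ < card ?I")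
  shows "\<exists>R C. polyfun (card Rw * \<delta>) R \<and> R C \<noteq> 0 \<and>
    (\<forall>C x. R C \<noteq> 0 \<longrightarrow> (\<forall>i\<in>Rw. (\<Sum>j\<in>{1..m}. C (i, j) * \<phi> j x) = 0) \<longrightarrow> (\<forall>j\<in>{1..m}. \<phi> j x = 0))"
proof -
  define Rt where "Rt = insert t Rw"
  have Rt: "finite Rt" "t \<in> Rt" "card Rt = Suc (card Rw)"
    using assms(2,3) by (simp_all add: Rt_def)
  have finI: "finite ?I"
    using assms(2) by (intro finite_SigmaI finite_PiE finite_exps) auto
  have Isum: "(\<Sum>i\<in>Rt. fst u i) = N" if "u \<in> ?I" for u
    using that by (auto simp: exps_def Rt_def)
  obtain p where p: "\<exists>u\<in>?I. p u \<noteq> 0" and rel: "\<And>Y x. (\<Sum>u\<in>?I. p u *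
      ((\<Prod>i\<in>Rt. (\<Sum>j\<in>{1..m}. Y (i, j) * \<phi> j x) ^ fst u i) *
       (\<Prod>i\<in>Rt. mon {1..m} (snd u i) (\<lambda>j. Y (i, j))))) = 0"
    using generic_relation[OF Rt(1) finite_atLeastAtMost assms(4) H] card
    unfolding row_mon_def[OF Rt(1) finite_atLeastAtMost] Rt_def[symmetric] Rt(3) by auto
  \<comment> \<open>Column 0 of \<open>Y\<close> is new: \<open>Y (i, 0)\<close> is a variable
    standing for the value of form \<open>i\<close>. This turns the relation into a polynomial,
    nonzero because distinct index pairs give distinct monomials.\<close>
  define P where "P Y = (\<Sum>u\<in>?I. p u * (\<Prod>i\<in>Rt. Y (i, 0) ^ fst u i * mon {1..m} (snd u i) (\<lambda>j. Y (i, j))))"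
    for Y :: "'r \<times> nat \<Rightarrow> 'k"
  define e where "e u = (\<lambda>(i, j). if j = 0 then fst u i else snd u i j)"
    for u :: "('r \<Rightarrow> nat) \<times> ('r \<Rightarrow> nat \<Rightarrow> nat)"
  have mon_e: "mon (Rt \<times> {0..m}) (e u) Y = (\<Prod>i\<in>Rt. Y (i, 0) ^ fst u i * mon {1..m} (snd u i) (\<lambda>j. Y (i, j)))" for u Y
  proof -
    have "{0..m} = insert 0 {1..m}" by auto
    moreover have "(\<Prod>j\<in>{1..m}. Y (i, j) ^ (if j = 0 then fst u i else snd u i j)) = (\<Prod>j\<in>{1..m}. Y (i, j) ^ snd u i j)" for i
      by (intro prod.cong) auto
    moreover have "mon (Rt \<times> {0..m}) (e u) Y
        = (\<Prod>i\<in>Rt. \<Prod>j\<in>{0..m}. Y (i, j) ^ (if j = 0 then fst u i else snd u i j))"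
      unfolding mon_def prod.cartesian_product by (intro prod.cong) (auto simp: e_def)
    ultimately show ?thesis by (simp add: mon_def)
  qed
  have e_inj: "u = w" if uw: "u \<in> ?I" "w \<in> ?I" and eq: "\<And>v. v \<in> Rt \<times> {0..m} \<Longrightarrow> e u v = e w v" for u w
  proof (rule prod_eqI)
    show "fst u = fst w"
    proof
      fix i show "fst u i = fst w i"
        using uw eq[of "(i, 0)"] by (cases "i \<in> Rt") (auto simp: e_def exps_def Rt_def)
    qed
    show "snd u = snd w"
    proof (intro ext)
      fix i j
      show "snd u i j = snd w i j"
      proof (cases "i \<in> Rt")
        case True
        then have "snd u i \<in> exps {1..m} (\<delta> - fst u i)" "snd w i \<in> exps {1..m} (\<delta> - fst w i)"
          using uw by (auto simp: Rt_def PiE_iff)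
        then show ?thesis
          using True eq[of "(i, j)"] by (cases "j \<in> {1..m}") (auto simp: e_def exps_def)
      next
        case False
        then show ?thesis using uw by (auto simp: Rt_def PiE_iff extensional_def)
      qed
    qed
  qed
  have P_e: "P Y = (\<Sum>u\<in>?I. p u * mon (Rt \<times> {0..m}) (e u) Y)" for Y by (simp add: P_def mon_e)
  obtain u\<^sub>0 where "u\<^sub>0 \<in> ?I" "p u\<^sub>0 \<noteq> 0" using p by blast
  then obtain Y\<^sub>1 where Y1: "P Y\<^sub>1 \<noteq> 0"
    using monomials_nonzero[OF inf _ finI, of "Rt \<times> {0..m}" u\<^sub>0 p e] e_inj Rt(1) unfolding P_e by blast
  have mon_poly: "polyfun (\<Sum>v\<in>V. \<alpha> v) (\<lambda>Y. mon V \<alpha> (\<lambda>v. h Y v))"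
    if "\<And>v. v \<in> V \<Longrightarrow> polyfun (Suc 0) (\<lambda>Y. h Y v)" for V :: "'v set" and \<alpha> and h :: "('w \<Rightarrow> 'k) \<Rightarrow> 'v \<Rightarrow> 'k"
    unfolding mon_def using that polyfun_power[of "Suc 0"] by (intro polyfun_prod) fastforce
  have P_poly: "\<exists>D. polyfun D P"
  proof -
    define D where "D = (\<Sum>u\<in>?I. \<Sum>v\<in>Rt \<times> {0..m}. e u v)"
    have "polyfun D (\<lambda>Y. p u * mon (Rt \<times> {0..m}) (e u) Y)" if "u \<in> ?I" for u
    proof -
      have "polyfun (0 + (\<Sum>v\<in>Rt \<times> {0..m}. e u v)) (\<lambda>Y. p u * mon (Rt \<times> {0..m}) (e u) Y)"
        by (intro polyfun.mult polyfun.const mon_poly polyfun.var)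
      then show ?thesis
        using finI that unfolding D_def by (elim polyfun_mono) (auto intro: member_le_sum)
    qed
    then show ?thesis unfolding P_e[abs_def] by (intro exI[of _ D] polyfun_sum) auto
  qed
  then obtain D where D: "polyfun D P" ..
  have t0: "polyfun (Suc 0) (\<lambda>Y :: 'r \<times> nat \<Rightarrow> 'k. Y (t, 0))" by (rule polyfun.var)
  \<comment> \<open>Besides \<open>P\<close>, the entry \<open>Y (t, 0)\<close> has to be nonzero,
    since column 0 is going to be divided by it.\<close>
  obtain s where "P (\<lambda>v. Y\<^sub>1 v + s * (1 - Y\<^sub>1 v)) \<noteq> 0" "Y\<^sub>1 (t, 0) + s * (1 - Y\<^sub>1 (t, 0)) \<noteq> 0"
    using polyfun_common_nonzero[where F = P and G = "\<lambda>Y. Y (t, 0)" and a = Y\<^sub>1 and b = "\<lambda>_. 1", OF inf D t0 Y1]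
    by auto
  then obtain Y where Y: "P Y \<noteq> 0" "Y (t, 0) \<noteq> 0" by blast
  define \<mu> where "\<mu> i = Y (i, 0) / Y (t, 0)" for i
  have \<mu>t: "\<mu> t = 1" using Y(2) by (simp add: \<mu>_def)
  \<comment> \<open>The row operations with row \<open>t\<close> equal to \<open>V\<close>, and
    \<mu> in column 0. Where the forms of \<open>C\<close> vanish, form \<open>i\<close> becomes
    \<open>\<mu> i\<close> times the form of \<open>V\<close>, so \<open>P (Z C V)\<close> is the
    coefficient of the \<open>N\<close>-th power of the latter.\<close>
  define Z where "Z C V = (\<lambda>(i, j). if j = 0 then \<mu> i else if i = t then V j else C (i, j) + \<mu> i * V j)"
    for C :: "'r \<times> nat \<Rightarrow> 'k" and V :: "nat \<Rightarrow> 'k"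
  define C\<^sub>0 where "C\<^sub>0 = (\<lambda>(i, j). Y (i, j) - \<mu> i * Y (t, j))"
  define V\<^sub>0 where "V\<^sub>0 j = Y (t, j)" for j
  have PZ: "P (Z C V) = (\<Sum>u\<in>?I. p u * (\<Prod>i\<in>Rt. \<mu> i ^ fst u i * mon {1..m} (snd u i) (\<lambda>j. Z C V (i, j))))"
    for C V by (simp add: P_def Z_def)
  have scale: "p u * (\<Prod>i\<in>Rt. Y (i, 0) ^ fst u i * mon {1..m} (snd u i) (\<lambda>j. Y (i, j)))
      = Y (t, 0) ^ N * (p u * (\<Prod>i\<in>Rt. \<mu> i ^ fst u i * mon {1..m} (snd u i) (\<lambda>j. Z C\<^sub>0 V\<^sub>0 (i, j))))"
    if u: "u \<in> ?I" for u
  proof -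
    have "(\<Prod>i\<in>Rt. Y (i, 0) ^ fst u i * mon {1..m} (snd u i) (\<lambda>j. Y (i, j)))
      = (\<Prod>i\<in>Rt. Y (t, 0) ^ fst u i * (\<mu> i ^ fst u i * mon {1..m} (snd u i) (\<lambda>j. Z C\<^sub>0 V\<^sub>0 (i, j))))"
    proof (intro prod.cong refl)
      fix i
      have "mon {1..m} (snd u i) (\<lambda>j. Y (i, j)) = mon {1..m} (snd u i) (\<lambda>j. Z C\<^sub>0 V\<^sub>0 (i, j))"
        unfolding mon_def by (intro prod.cong) (auto simp: Z_def C\<^sub>0_def V\<^sub>0_def)
      moreover have "Y (i, 0) ^ fst u i = Y (t, 0) ^ fst u i * \<mu> i ^ fst u i"
        using Y(2) by (simp add: \<mu>_def power_mult_distrib[symmetric])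
      ultimately show "Y (i, 0) ^ fst u i * mon {1..m} (snd u i) (\<lambda>j. Y (i, j))
        = Y (t, 0) ^ fst u i * (\<mu> i ^ fst u i * mon {1..m} (snd u i) (\<lambda>j. Z C\<^sub>0 V\<^sub>0 (i, j)))"
        by (simp only: mult_ac)
    qed
    also have "\<dots> = Y (t, 0) ^ N * (\<Prod>i\<in>Rt. \<mu> i ^ fst u i * mon {1..m} (snd u i) (\<lambda>j. Z C\<^sub>0 V\<^sub>0 (i, j)))"
      using Isum[OF u] by (simp add: prod.distrib power_sum[symmetric])
    finally show ?thesis by (simp only: mult_ac)
  qed
  \<comment> \<open>\<open>P\<close> is homogeneous of degree \<open>N\<close> in column 0, so
    normalising that column only splits off a power.\<close>
  have "P Y = Y (t, 0) ^ N * P (Z C\<^sub>0 V\<^sub>0)"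
    unfolding PZ sum_distrib_left unfolding P_def using scale by (intro sum.cong refl)
  then have nz: "P (Z C\<^sub>0 V\<^sub>0) \<noteq> 0" using Y(1) by auto
  \<comment> \<open>With row \<open>t\<close> frozen at \<open>V\<^sub>0\<close>, the degree comes
    from the rows in \<open>Rw\<close>, at most \<delta> from each.\<close>
  have "polyfun (card Rw * \<delta>) (\<lambda>C. P (Z C V\<^sub>0))"
    unfolding PZ
  proof (intro polyfun_sum)
    fix u assume u: "u \<in> ?I"
    have "polyfun (if i = t then 0 else \<delta>) (\<lambda>C. \<mu> i ^ fst u i * mon {1..m} (snd u i) (\<lambda>j. Z C V\<^sub>0 (i, j)))"
      if i: "i \<in> Rt" for i
    proof (cases "i = t")
      case True
      have "Z C V\<^sub>0 (i, j) = (if j = 0 then 1 else V\<^sub>0 j)" for C j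
        unfolding True by (simp add: Z_def \<mu>t)
      then show ?thesis by (simp only: polyfun.const)
    next
      case False
      have "polyfun (Suc 0) (\<lambda>C. Z C V\<^sub>0 (i, j))" for j
        using False by (cases "j = 0") (simp_all add: Z_def polyfun.const polyfun.add polyfun.var)
      then have "polyfun (0 + (\<Sum>j\<in>{1..m}. snd u i j)) (\<lambda>C. \<mu> i ^ fst u i * mon {1..m} (snd u i) (\<lambda>j. Z C V\<^sub>0 (i, j)))"
        by (intro polyfun.mult polyfun.const mon_poly)
      moreover have "(\<Sum>j\<in>{1..m}. snd u i j) = \<delta> - fst u i"
        using u i by (auto simp: Rt_def PiE_iff exps_def)
      ultimately show ?thesis using False by (auto elim: polyfun_mono)
    qed
    then have "polyfun (0 + (\<Sum>i\<in>Rt. if i = t then 0 else \<delta>))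
      (\<lambda>C. p u * (\<Prod>i\<in>Rt. \<mu> i ^ fst u i * mon {1..m} (snd u i) (\<lambda>j. Z C V\<^sub>0 (i, j))))"
      by (intro polyfun.mult polyfun.const polyfun_prod)
    moreover have "(\<Sum>i\<in>Rt. if i = t then 0 else \<delta>) = card Rw * \<delta>"
    proof -
      have "(\<Sum>i\<in>Rw. if i = t then 0 else \<delta>) = (\<Sum>i\<in>Rw. \<delta>)"
        using assms(3) by (intro sum.cong) auto
      then show ?thesis using assms(2,3) by (simp add: Rt_def)
    qed
    ultimately show "polyfun (card Rw * \<delta>)
      (\<lambda>C. p u * (\<Prod>i\<in>Rt. \<mu> i ^ fst u i * mon {1..m} (snd u i) (\<lambda>j. Z C V\<^sub>0 (i, j))))" by simp
  qed
  moreover have "\<phi> k x = 0"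
    if R: "P (Z C V\<^sub>0) \<noteq> 0" and zero: "\<forall>i\<in>Rw. (\<Sum>j\<in>{1..m}. C (i, j) * \<phi> j x) = 0" and k: "k \<in> {1..m}" for C x k
  proof (rule ccontr)
    assume nzk: "\<phi> k x \<noteq> 0"
    define L where "L V = (\<Sum>j\<in>{1..m}. V j * \<phi> j x)" for V :: "nat \<Rightarrow> 'k"
    have PV: "polyfun D (\<lambda>V. P (Z C V))"
    proof (rule polyfun_compose[OF D])
      fix v :: "'r \<times> nat"
      obtain i j where v: "v = (i, j)" by fastforce
      have "polyfun (0 + Suc 0) (\<lambda>V. \<mu> i * V j)" by (intro polyfun.mult polyfun.const polyfun.var)
      then show "polyfun (Suc 0) (\<lambda>V. Z C V v)"
        unfolding v Z_def by (cases "j = 0"; cases "i = t") (simp_all add: polyfun.const polyfun.var polyfun.add)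
    qed
    have L_poly: "polyfun (Suc 0 + 0) L"
      unfolding L_def by (intro polyfun_sum polyfun.mult polyfun.var polyfun.const)
    have Lk: "L (\<lambda>j. if j = k then 1 else 0) \<noteq> 0"
      using nzk k by (simp add: L_def if_distrib[of "\<lambda>x. x * _"] cong: if_cong)
    \<comment> \<open>\<open>V\<^sub>0\<close> makes \<open>P\<close> nonzero, but its form may
      vanish at \<open>x\<close>; the unit vector at \<open>k\<close> has a nonvanishing form. A
      point on the line joining them has both properties, which is why \<open>V\<close> stays
      variable in \<open>Z\<close>.\<close>
    obtain V where V: "P (Z C V) \<noteq> 0" "L V \<noteq> 0"
      using polyfun_common_nonzero[where F = "\<lambda>V. P (Z C V)" and G = L, OF inf PV L_poly R Lk] by blast
    have form: "(\<Sum>j\<in>{1..m}. Z C V (i, j) * \<phi> j x) = \<mu> i * L V" if "i \<in> Rt" for i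
    proof (cases "i = t")
      case True
      then show ?thesis unfolding L_def by (simp add: \<mu>t, intro sum.cong) (auto simp: Z_def)
    next
      case False
      have "(\<Sum>j\<in>{1..m}. Z C V (i, j) * \<phi> j x) = (\<Sum>j\<in>{1..m}. C (i, j) * \<phi> j x + \<mu> i * (V j * \<phi> j x))"
        using False by (intro sum.cong) (auto simp: Z_def algebra_simps)
      also have "\<dots> = 0 + \<mu> i * L V"
        using zero that False by (simp add: sum.distrib L_def sum_distrib_left Rt_def)
      finally show ?thesis by simp
    qed
    have "0 = (\<Sum>u\<in>?I. p u * ((\<Prod>i\<in>Rt. (\<mu> i * L V) ^ fst u i) *
       (\<Prod>i\<in>Rt. mon {1..m} (snd u i) (\<lambda>j. Z C V (i, j)))))"
      using rel[of "Z C V" x] form by (simp cong: prod.cong)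
    also have "\<dots> = (\<Sum>u\<in>?I. L V ^ N * (p u * (\<Prod>i\<in>Rt. \<mu> i ^ fst u i * mon {1..m} (snd u i) (\<lambda>j. Z C V (i, j)))))"
      using Isum by (intro sum.cong refl)
        (simp add: power_mult_distrib prod.distrib power_sum[symmetric] mult_ac)
    also have "\<dots> = L V ^ N * P (Z C V)" by (simp add: PZ sum_distrib_left)
    finally show False using V by simp
  qed
  ultimately show ?thesis using nz by (intro exI[of _ "\<lambda>C. P (Z C V\<^sub>0)"] exI[of _ C\<^sub>0]) blast
qed

section \<open>Numerical estimates for the choice of \<open>N\<close> and \<delta>\<close>

lemma prod_one_minus_ge:
  fixes x :: "'a \<Rightarrow> real"
  assumes "finite I" "\<And>i. i \<in> I \<Longrightarrow> 0 \<le> x i \<and> x i \<le> 1"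
  shows "1 - (\<Sum>i\<in>I. x i) \<le> (\<Prod>i\<in>I. 1 - x i)"
  using assms
proof (induction I rule: finite_induct)
  case (insert i I)
  have "(\<Prod>i\<in>I. 1 - x i) \<le> 1" using insert.prems by (intro prod_le_1) auto
  then have "x i * (\<Prod>i\<in>I. 1 - x i) \<le> x i * 1" using insert.prems by (intro mult_left_mono) auto
  moreover have "1 - (\<Sum>i\<in>I. x i) \<le> (\<Prod>i\<in>I. 1 - x i)" using insert by auto
  ultimately show ?case using insert.hyps by (simp add: algebra_simps)
qed simp

text \<open>The quotient of the binomial coefficients is the product of
  \<open>1 - a / (\<delta> + i)\<close> for \<open>i\<close> from 1 to \<open>q\<close>. Each factor
  is at least \<open>1 - a / (\<delta> + 1)\<close>, and the rest is Bernoulli's inequality.\<close>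

lemma binomial_shift_ge:
  assumes "a \<le> \<delta>"
  shows "real ((\<delta> + q) choose q) * (1 - real q * real a / real (\<delta> + 1)) \<le> real ((\<delta> - a + q) choose q)"
proof (induction q)
  case (Suc q)
  let ?c = "\<lambda>n. real ((n + q) choose q)" and ?x = "real a / real (\<delta> + 1)"
  have step: "real ((n + Suc q) choose Suc q) = (n + Suc q) / Suc q * ?c n" for n
  proof -
    have "real (Suc q * ((n + Suc q) choose Suc q)) = real ((n + Suc q) * ((n + q) choose q))"
      by (simp only: Suc_times_binomial_shift)
    then show ?thesis by (simp add: field_simps)
  qed
  show ?case
  proof (cases "Suc q * ?x \<le> 1")
    \<comment> \<open>Here the left side is not positive. The other case may then use
      \<open>1 - q * ?x\<close> as a nonnegative factor.\<close>
    case False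
    then have "1 - real (Suc q) * real a / real (\<delta> + 1) \<le> 0"
      unfolding times_divide_eq_right diff_le_0_iff_le by (metis linorder_linear)
    then have "real ((\<delta> + Suc q) choose Suc q) * (1 - real (Suc q) * real a / real (\<delta> + 1)) \<le> 0"
      by (intro mult_nonneg_nonpos) auto
    then show ?thesis by (meson of_nat_0_le_iff order_trans)
  next
    case True
    have x: "0 \<le> ?x" "q * ?x \<le> 1" "?x \<le> 1"
    proof -
      show "0 \<le> ?x" by simp
      have "q * ?x \<le> Suc q * ?x" by (intro mult_right_mono) auto
      then show "q * ?x \<le> 1" using True by linarith
      show "?x \<le> 1" using assms by simp
    qed
    have quad: "1 - Suc q * ?x \<le> (1 - ?x) * (1 - q * ?x)"
    proof -
      have eq: "(1 - y) * (1 - q * y) = 1 - Suc q * y + q * y\<^sup>2" for y :: real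
        by (simp add: power2_eq_square algebra_simps)
      show ?thesis unfolding eq le_add_same_cancel1 by simp
    qed
    have lin: "(\<delta> + Suc q) * (1 - ?x) \<le> real (\<delta> - a + Suc q)"
    proof -
      have "real a = (\<delta> + 1) * ?x" by simp
      also have "\<dots> \<le> (\<delta> + Suc q) * ?x" using x(1) by (intro mult_right_mono) auto
      finally show ?thesis using assms by (simp add: of_nat_diff algebra_simps)
    qed
    have "(\<delta> + Suc q) * (1 - Suc q * ?x) \<le> (\<delta> + Suc q) * ((1 - ?x) * (1 - q * ?x))"
      by (rule mult_left_mono[OF quad]) simp
    also have "\<dots> = ((\<delta> + Suc q) * (1 - ?x)) * (1 - q * ?x)" by (simp only: mult.assoc)
    also have "\<dots> \<le> real (\<delta> - a + Suc q) * (1 - q * ?x)"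
      by (rule mult_right_mono[OF lin]) (use x(2) in simp)
    finally have "(\<delta> + Suc q) * (1 - Suc q * ?x) \<le> real (\<delta> - a + Suc q) * (1 - q * ?x)" .
    then have "?c \<delta> / Suc q * ((\<delta> + Suc q) * (1 - Suc q * ?x)) \<le> ?c \<delta> / Suc q * (real (\<delta> - a + Suc q) * (1 - q * ?x))"
      by (intro mult_left_mono) auto
    also have "\<dots> = real (\<delta> - a + Suc q) / Suc q * (?c \<delta> * (1 - q * ?x))" by simp
    also have "\<dots> \<le> real (\<delta> - a + Suc q) / Suc q * ?c (\<delta> - a)"
      using Suc.IH by (intro mult_left_mono) auto
    finally show ?thesis unfolding step by (simp add: mult_ac)
  qed
qed simp

text \<open>Since \<open>N / (r + 1) = 2 * d ^ r\<close>, the exponent vectors are more than twice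
  as many as \<open>(d * N + r) choose r\<close>. The value of \<delta> ensures that each of them
  admits at least half of \<open>card (exps {1..m} \<delta>) ^ (r + 2)\<close> paddings.\<close>

lemma monomial_count:
  fixes r m d :: nat
  assumes "finite Rw" "card Rw = r + 2" "2 \<le> m" "0 < d"
    and N: "N = 2 * (r + 1) * d ^ r" and \<delta>: "\<delta> + 1 = 2 * (m - 1) * N"
  shows "card (exps {1..m} \<delta>) ^ (r + 2) * ((d * N + r) choose r)
    < card (SIGMA a:exps Rw N. PiE Rw (\<lambda>i. exps {1..m} (\<delta> - a i)))"
proof -
  define c where "c t = real (card (exps {1..m} t))" for t
  have c: "c t = (t + (m - 1)) choose (m - 1)" for t
    using assms(3) unfolding c_def by (subst card_exps) auto
  have "N > 0" using N assms(4) by simp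
  have "2 * 1 * N \<le> 2 * (m - 1) * N" using assms(3) by (intro mult_le_mono) auto
  then have N\<delta>: "N \<le> \<delta>" using \<delta> \<open>N > 0\<close> by linarith
  have row: "c \<delta> ^ (r + 2) / 2 \<le> (\<Prod>i\<in>Rw. c (\<delta> - a i))" if a: "a \<in> exps Rw N" for a
  proof -
    define x where "x i = real (m - 1) * real (a i) / real (\<delta> + 1)" for i
    have ale: "a i \<le> N" if "i \<in> Rw" for i
      using a that member_le_sum[of i Rw a] assms(1) by (auto simp: exps_def)
    \<comment> \<open>The relative loss is linear in \<open>a\<close>, so its sum depends on
      \<open>N\<close> alone; \<delta> is chosen to make it exactly one half.\<close>
    have sumx: "(\<Sum>i\<in>Rw. x i) = 1 / 2"
    proof -
      have "(\<Sum>i\<in>Rw. x i) = real (m - 1) * real (\<Sum>i\<in>Rw. a i) / (\<delta> + 1)"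
        by (simp add: x_def sum_distrib_left sum_divide_distrib)
      also have "\<dots> = real ((m - 1) * N) / real (\<delta> + 1)" using a by (simp add: exps_def)
      also have "\<dots> = 1 / 2" unfolding \<delta> using \<open>N > 0\<close> assms(3) by simp
      finally show ?thesis .
    qed
    have x01: "0 \<le> x i \<and> x i \<le> 1" if "i \<in> Rw" for i
    proof -
      have "x i \<le> (\<Sum>i\<in>Rw. x i)" using that assms(1) by (intro member_le_sum) (auto simp: x_def)
      then have "x i \<le> 1" using sumx by linarith
      moreover have "0 \<le> x i" by (simp add: x_def)
      ultimately show ?thesis by blast
    qed
    have "c \<delta> ^ (r + 2) / 2 = c \<delta> ^ (r + 2) * (1 - (\<Sum>i\<in>Rw. x i))" using sumx by simp
    \<comment> \<open>The Weierstrass product inequality.\<close>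
    also have "\<dots> \<le> c \<delta> ^ (r + 2) * (\<Prod>i\<in>Rw. 1 - x i)"
      using x01 assms(1) by (intro mult_left_mono prod_one_minus_ge) (auto simp: c)
    also have "\<dots> = (\<Prod>i\<in>Rw. c \<delta> * (1 - x i))" using assms(2) by (simp add: prod.distrib)
    also have "\<dots> \<le> (\<Prod>i\<in>Rw. c (\<delta> - a i))"
    proof (intro prod_mono conjI)
      fix i assume i: "i \<in> Rw"
      show "0 \<le> c \<delta> * (1 - x i)" using x01[OF i] by (simp add: c)
      show "c \<delta> * (1 - x i) \<le> c (\<delta> - a i)"
        unfolding c x_def using ale[OF i] N\<delta> by (intro binomial_shift_ge) simp
    qed
    finally show ?thesis .
  qed
  have card_I: "real (card (SIGMA a:exps Rw N. PiE Rw (\<lambda>i. exps {1..m} (\<delta> - a i))))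
      = (\<Sum>a\<in>exps Rw N. \<Prod>i\<in>Rw. c (\<delta> - a i))"
    using assms(1) by (subst card_SigmaI) (auto simp: card_PiE c_def intro!: finite_exps finite_PiE)
  have "2 * ((d * N + r) choose r) < card (exps Rw N)"
  proof -
    have "Suc r * (2 * ((d * N + r) choose r)) \<le> Suc r * (2 * (d ^ r * ((N + r) choose r)))"
      using binomial_scale_le[OF assms(4)] by (intro mult_le_mono) auto
    also have "\<dots> = N * ((N + r) choose r)"
    proof -
      have "Suc r * (2 * (d ^ r * y)) = N * y" for y unfolding N by (simp add: algebra_simps)
      then show ?thesis by blast
    qed
    also have "\<dots> < (N + Suc r) * ((N + r) choose r)" by (intro mult_less_mono1) simp_all
    also have "\<dots> = Suc r * ((N + Suc r) choose Suc r)" by (rule Suc_times_binomial_shift[symmetric])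
    finally have "2 * ((d * N + r) choose r) < (N + Suc r) choose Suc r" using mult_less_cancel1 by blast
    also have "\<dots> = card (exps Rw N)" using assms(1,2) by (subst card_exps) auto
    finally show ?thesis .
  qed
  then have "c \<delta> ^ (r + 2) / 2 * (2 * real ((d * N + r) choose r)) < c \<delta> ^ (r + 2) / 2 * real (card (exps Rw N))"
    by (intro mult_strict_left_mono) (auto simp: c)
  also have "\<dots> = (\<Sum>a\<in>exps Rw N. c \<delta> ^ (r + 2) / 2)" by simp
  also have "\<dots> \<le> (\<Sum>a\<in>exps Rw N. \<Prod>i\<in>Rw. c (\<delta> - a i))" by (intro sum_mono row)
  finally have "c \<delta> ^ (r + 2) * real ((d * N + r) choose r)
    < real (card (SIGMA a:exps Rw N. PiE Rw (\<lambda>i. exps {1..m} (\<delta> - a i))))" using card_I by simp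
  then show ?thesis unfolding c_def by (simp only: of_nat_power[symmetric] of_nat_mult[symmetric] of_nat_less_iff)
qed

text \<open>As \<open>(r + 1) * (\<delta> + 1) = 4 * (r + 1) ^ 2 * (m - 1) * d ^ r\<close>, the
  factor \<open>d ^ r\<close> is set aside and the rest is compared with a power of 2, which
  \<open>2 \<le> d\<close> turns into a power of \<open>d\<close>.\<close>

lemma degree_bound:
  fixes r m d :: nat
  assumes "2 \<le> d" "r + 2 \<le> m" and "\<delta> + 1 = 2 * (m - 1) * (2 * (r + 1) * d ^ r)"
  shows "(r + 1) * \<delta> \<le> d ^ ((r + 1) * m)"
proof -
  \<comment> \<open>\<open>k\<close> is \<open>m - (r + 2)\<close>. Raising \<open>k\<close> by 1 at
    most doubles the left side. For \<open>k = 0\<close>, raising \<open>r\<close> by 1 costs at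
    most a factor 8 on the left, against \<open>2 * r + 3\<close> further factors 2 on the
    right.\<close>
  have base: "4 * (r + 1) ^ 2 * (r + 1 + k) \<le> 2 ^ ((r + 1) * (r + 2 + k) - r)" for k
  proof (induction k)
    case 0
    have "4 * (r + 1) ^ 3 \<le> 2 ^ (r ^ 2 + 2 * r + 2)"
    proof (induction r)
      case (Suc r)
      have "(Suc r + 1) ^ 3 \<le> (2 * (r + 1)) ^ 3" by (intro power_mono) auto
      then have "4 * (Suc r + 1) ^ 3 \<le> 2 ^ 3 * (4 * (r + 1) ^ 3)"
        unfolding power_mult_distrib[of 2 "r + 1" 3] by simp
      also have "\<dots> \<le> 2 ^ 3 * 2 ^ (r ^ 2 + 2 * r + 2)" using Suc.IH by (intro mult_le_mono) auto
      also have "\<dots> \<le> 2 ^ ((Suc r) ^ 2 + 2 * Suc r + 2)"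
        unfolding power_add[symmetric] by (intro power_increasing) (auto simp: power2_eq_square)
      finally show ?case .
    qed simp
    moreover have "(r + 1) * (r + 2 + 0) - r = r ^ 2 + 2 * r + 2" by (simp add: power2_eq_square)
    moreover have "4 * (r + 1) ^ 2 * (r + 1 + 0) = 4 * (r + 1) ^ 3"
      by (simp add: power2_eq_square power3_eq_cube algebra_simps)
    ultimately show ?case by (simp only:)
  next
    case (Suc k)
    have "4 * (r + 1) ^ 2 * (r + 1 + Suc k) \<le> 2 * (4 * (r + 1) ^ 2 * (r + 1 + k))"
      by (simp add: algebra_simps)
    also have "\<dots> \<le> 2 * 2 ^ ((r + 1) * (r + 2 + k) - r)" using Suc.IH by (intro mult_le_mono) auto
    also have "\<dots> \<le> 2 ^ ((r + 1) * (r + 2 + Suc k) - r)"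
      unfolding power_Suc[symmetric] by (intro power_increasing) (auto simp: algebra_simps)
    finally show ?case .
  qed
  obtain k where k: "m = r + 2 + k" using assms(2) le_iff_add by blast
  have "(r + 1) * \<delta> \<le> (r + 1) * (\<delta> + 1)" by simp
  also have "\<dots> = 4 * (r + 1) ^ 2 * (r + 1 + k) * d ^ r"
    unfolding assms(3) k by (simp add: power2_eq_square algebra_simps)
  also have "\<dots> \<le> 2 ^ ((r + 1) * m - r) * d ^ r" unfolding k by (intro mult_le_mono1 base)
  also have "\<dots> \<le> d ^ ((r + 1) * m - r) * d ^ r" using assms(1) by (intro mult_le_mono1 power_mono) auto
  also have "\<dots> = d ^ ((r + 1) * m)"
  proof -
    have "r \<le> (r + 1) * m" using assms(2) by (simp add: k)
    then show ?thesis by (simp add: power_add[symmetric])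
  qed
  finally show ?thesis .
qed

text \<open>Gaussian elimination on the random matrix, column by column: the rows below the pivot can be
  cleared at a nonzero of \<open>R\<close>, at the price of composing \<open>R\<close> with a row operation.\<close>

lemma triangular_forms:
  fixes \<phi> :: "nat \<Rightarrow> 'x \<Rightarrow> 'k::field"
  assumes inf: "infinite (UNIV :: 'k set)" and "s \<le> m"
    and "polyfun D R" "R C \<noteq> 0"
    and R: "\<And>C x. R C \<noteq> 0 \<Longrightarrow> \<forall>i\<in>{1..s}. (\<Sum>j\<in>{1..m}. C (i, j) * \<phi> j x) = 0 \<Longrightarrow>
        \<forall>j\<in>{1..m}. \<phi> j x = 0"
  shows "\<exists>R C. polyfun D R \<and> R C \<noteq> 0 \<and> (\<forall>v. v \<notin> (SIGMA i:{1..s}. {i..m}) \<longrightarrow> C v = 0) \<and>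
    (\<forall>C x. R C \<noteq> 0 \<longrightarrow> (\<forall>i\<in>{1..s}. (\<Sum>j\<in>{1..m}. C (i, j) * \<phi> j x) = 0) \<longrightarrow>
      (\<forall>j\<in>{1..m}. \<phi> j x = 0))"
proof -
  \<comment> \<open>The witness is left out: it changes with each row operation, whereas this
    property is preserved.\<close>
  define good where "good R \<longleftrightarrow> polyfun D R \<and>
    (\<forall>C x. R C \<noteq> 0 \<longrightarrow> (\<forall>i\<in>{1..s}. (\<Sum>j\<in>{1..m}. C (i, j) * \<phi> j x) = 0) \<longrightarrow>
      (\<forall>j\<in>{1..m}. \<phi> j x = 0))" for R :: "(nat \<times> nat \<Rightarrow> 'k) \<Rightarrow> 'k"
  have good_compose: "good (\<lambda>C. R (h C))"
    if "good R" "\<And>v. polyfun (Suc 0) (\<lambda>C. h C v)"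
      and rows: "\<And>C x. \<forall>i\<in>{1..s}. (\<Sum>j\<in>{1..m}. C (i, j) * \<phi> j x) = 0 \<Longrightarrow>
        \<forall>i\<in>{1..s}. (\<Sum>j\<in>{1..m}. h C (i, j) * \<phi> j x) = 0" for R h
    unfolding good_def
  proof (intro conjI allI impI)
    show "polyfun D (\<lambda>C. R (h C))" using that(1,2) polyfun_compose unfolding good_def by blast
    fix C x assume "R (h C) \<noteq> 0" "\<forall>i\<in>{1..s}. (\<Sum>j\<in>{1..m}. C (i, j) * \<phi> j x) = 0"
    then show "\<forall>j\<in>{1..m}. \<phi> j x = 0" using that(1) rows[of C x] unfolding good_def by blast
  qed
  have "\<exists>R C. good R \<and> R C \<noteq> 0 \<and> (\<forall>v. v \<notin> {1..s} \<times> {1..m} \<longrightarrow> C v = 0) \<and>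
    (\<forall>i j. j \<le> q \<longrightarrow> j < i \<longrightarrow> C (i, j) = 0)" if "q \<le> s" for q
    using that
  proof (induction q)
    case 0
    \<comment> \<open>Entries outside the matrix are frozen at their values in \<open>C\<close>, so
      that the new witness can be 0 there.\<close>
    define h where "h B v = (if v \<in> {1..s} \<times> {1..m} then B v else C v)" for B and v :: "nat \<times> nat"
    have "good R" using assms(3) R unfolding good_def by blast
    then have gh: "good (\<lambda>B. R (h B))"
    proof (rule good_compose)
      show "polyfun (Suc 0) (\<lambda>B. h B v)" for v
        by (cases "v \<in> {1..s} \<times> {1..m}") (simp_all add: h_def polyfun.const polyfun.var)
      show "\<forall>i\<in>{1..s}. (\<Sum>j\<in>{1..m}. h B (i, j) * \<phi> j x) = 0"
        if "\<forall>i\<in>{1..s}. (\<Sum>j\<in>{1..m}. B (i, j) * \<phi> j x) = 0" for B x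
      proof
        fix i assume i: "i \<in> {1..s}"
        then have "(\<Sum>j\<in>{1..m}. h B (i, j) * \<phi> j x) = (\<Sum>j\<in>{1..m}. B (i, j) * \<phi> j x)"
          by (intro sum.cong) (auto simp: h_def)
        then show "(\<Sum>j\<in>{1..m}. h B (i, j) * \<phi> j x) = 0" using that i by simp
      qed
    qed
    define B where "B v = (if v \<in> {1..s} \<times> {1..m} then C v else 0)" for v
    have "h B = C" by (auto simp: h_def B_def)
    then have "R (h B) \<noteq> 0" using assms(4) by simp
    moreover have "\<forall>v. v \<notin> {1..s} \<times> {1..m} \<longrightarrow> B v = 0" "\<forall>i j. j \<le> 0 \<longrightarrow> j < i \<longrightarrow> B (i, j) = 0"
      by (simp_all add: B_def)
    ultimately show ?case using gh by blast
  next
    case (Suc q)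
    then obtain R C where good: "good R" and C: "R C \<noteq> 0"
      "\<forall>v. v \<notin> {1..s} \<times> {1..m} \<longrightarrow> C v = 0" "\<forall>i j. j \<le> q \<longrightarrow> j < i \<longrightarrow> C (i, j) = 0" by auto
    let ?q = "Suc q"
    have q: "?q \<in> {1..s}" "?q \<in> {1..m}" using Suc.prems assms(2) by auto
    have RD: "polyfun D R" using good by (simp add: good_def)
    have piv: "polyfun (Suc 0) (\<lambda>C :: nat \<times> nat \<Rightarrow> 'k. C (?q, ?q))" by (rule polyfun.var)
    \<comment> \<open>The pivot may be 0 at \<open>C\<close>. Moving towards
      \<open>C((?q, ?q) := 1)\<close> affects this entry alone, so the zeros already produced
      survive.\<close>
    obtain t where t: "R (\<lambda>v. C v + t * ((C(( ?q, ?q) := 1)) v - C v)) \<noteq> 0"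
      "C (?q, ?q) + t * (1 - C (?q, ?q)) \<noteq> 0"
      using polyfun_common_nonzero[where F = R and G = "\<lambda>C. C (?q, ?q)" and a = C and b = "C((?q, ?q) := 1)",
          OF inf RD piv C(1)] by auto
    define C' where "C' = (\<lambda>v. C v + t * ((C((?q, ?q) := 1)) v - C v))"
    have C': "R C' \<noteq> 0" "C' (?q, ?q) \<noteq> 0" "\<forall>v. v \<notin> {1..s} \<times> {1..m} \<longrightarrow> C' v = 0"
      "\<forall>i j. j \<le> q \<longrightarrow> j < i \<longrightarrow> C' (i, j) = 0"
      using t C q by (auto simp: C'_def)
    define \<mu> where "\<mu> i = (if ?q < i then C' (i, ?q) / C' (?q, ?q) else 0)" for i
    \<comment> \<open>\<open>h\<close> undoes the elimination, taking the cleared matrix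
      \<open>C''\<close> back to \<open>C'\<close>. Its rows are combinations of the rows of
      \<open>B\<close>, so common zeros of the forms remain common zeros.\<close>
    define h where "h B = (\<lambda>(i, j). B (i, j) + \<mu> i * B (?q, j))" for B :: "nat \<times> nat \<Rightarrow> 'k"
    define C'' where "C'' = (\<lambda>(i, j). C' (i, j) - \<mu> i * C' (?q, j))"
    have "\<mu> ?q = 0" by (simp add: \<mu>_def)
    then have hC: "h C'' = C'" by (auto simp: h_def C''_def)
    have "good (\<lambda>B. R (h B))"
    proof (rule good_compose[OF good])
      show "polyfun (Suc 0) (\<lambda>B. h B v)" for v
      proof -
        obtain i j where v: "v = (i, j)" by fastforce
        have "polyfun (0 + Suc 0) (\<lambda>B. \<mu> i * B (?q, j))" by (intro polyfun.mult polyfun.const polyfun.var)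
        then show ?thesis by (simp add: v h_def polyfun.add polyfun.var)
      qed
      show "\<forall>i\<in>{1..s}. (\<Sum>j\<in>{1..m}. h B (i, j) * \<phi> j x) = 0"
        if "\<forall>i\<in>{1..s}. (\<Sum>j\<in>{1..m}. B (i, j) * \<phi> j x) = 0" for B x
      proof
        fix i assume "i \<in> {1..s}"
        have "(\<Sum>j\<in>{1..m}. h B (i, j) * \<phi> j x)
            = (\<Sum>j\<in>{1..m}. B (i, j) * \<phi> j x) + \<mu> i * (\<Sum>j\<in>{1..m}. B (?q, j) * \<phi> j x)"
          by (simp add: h_def distrib_right sum.distrib sum_distrib_left mult.assoc)
        then show "(\<Sum>j\<in>{1..m}. h B (i, j) * \<phi> j x) = 0" using that \<open>i \<in> {1..s}\<close> q(1) by simp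
      qed
    qed
    moreover have "R (h C'') \<noteq> 0" using hC C'(1) by simp
    moreover have "C'' v = 0" if "v \<notin> {1..s} \<times> {1..m}" for v
    proof -
      obtain i j where v: "v = (i, j)" by fastforce
      have "\<mu> i = 0 \<or> C' (?q, j) = 0"
      proof (cases "j \<in> {1..m}")
        case True
        then have "i \<notin> {1..s}" using that v by auto
        then show ?thesis using C'(3) by (auto simp: \<mu>_def)
      qed (use C'(3) in auto)
      then show ?thesis using C'(3) that v by (auto simp: C''_def)
    qed
    moreover have "C'' (i, j) = 0" if "j \<le> ?q" "j < i" for i j
    proof (cases "j = ?q")
      case True
      then show ?thesis using that C'(2) by (simp add: C''_def \<mu>_def)
    next
      case False
      then show ?thesis using that C'(4) by (simp add: C''_def)
    qed
    ultimately show ?case by blast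
  qed
  from this[of s] obtain R C where *: "good R" "R C \<noteq> 0" "\<forall>v. v \<notin> {1..s} \<times> {1..m} \<longrightarrow> C v = 0"
    "\<forall>i j. j \<le> s \<longrightarrow> j < i \<longrightarrow> C (i, j) = 0" by auto
  have "C v = 0" if "v \<notin> (SIGMA i:{1..s}. {i..m})" for v
  proof -
    obtain i j where v: "v = (i, j)" by fastforce
    show ?thesis
    proof (cases "v \<in> {1..s} \<times> {1..m}")
      case True
      then have "j < i" "j \<le> s" using that v by auto
      then show ?thesis using *(4) v by blast
    qed (use *(3) in blast)
  qed
  then show ?thesis using *(1,2) unfolding good_def by blast
qed

section \<open>Random linear combinations\<close>

lemma mpoly_eval_superset:
  assumes "finite K" "Poly_Mapping.keys p \<subseteq> K"
  shows "mpoly_eval x p = (\<Sum>m\<in>K. Poly_Mapping.lookup p m *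
    (\<Prod>v\<in>Poly_Mapping.keys m. x $ v ^ Poly_Mapping.lookup m v))"
  unfolding mpoly_eval_def mpoly_subst_def using assms
  by (intro sum.mono_neutral_left) (auto simp: in_keys_iff)

lemma mpoly_eval_zero: "mpoly_eval x 0 = 0"
  and mpoly_eval_one: "mpoly_eval x 1 = 1"
  by (simp_all add: mpoly_eval_def mpoly_subst_def)

lemma mpoly_eval_single:
  fixes x :: "'a::comm_ring_1 ^ 'n::finite"
  shows "mpoly_eval x (Poly_Mapping.single m a) = a * (\<Prod>v\<in>UNIV. x $ v ^ Poly_Mapping.lookup m v)"
proof -
  have "(\<Prod>v\<in>Poly_Mapping.keys m. x $ v ^ Poly_Mapping.lookup m v) = (\<Prod>v\<in>UNIV. x $ v ^ Poly_Mapping.lookup m v)"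
    by (intro prod.mono_neutral_left) (auto simp: in_keys_iff)
  then show ?thesis by (subst mpoly_eval_superset[of "{m}"]) auto
qed

lemma mpoly_eval_add: "mpoly_eval x (p + q) = mpoly_eval x p + mpoly_eval x q"
proof -
  let ?K = "Poly_Mapping.keys p \<union> Poly_Mapping.keys q"
  have "Poly_Mapping.keys (p + q) \<subseteq> ?K" by (rule keys_add)
  then show ?thesis
    by (subst (1 2 3) mpoly_eval_superset[of ?K]) (auto simp: lookup_add distrib_right sum.distrib)
qed

lemma mpoly_eval_sum: "mpoly_eval x (\<Sum>i\<in>I. p i) = (\<Sum>i\<in>I. mpoly_eval x (p i))"
  by (induction I rule: infinite_finite_induct) (simp_all add: mpoly_eval_zero mpoly_eval_add)

lemma sum_single_lookup: "(\<Sum>m\<in>Poly_Mapping.keys p. Poly_Mapping.single m (Poly_Mapping.lookup p m)) = p"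
proof (rule poly_mapping_eqI)
  fix k
  have "(\<Sum>m\<in>Poly_Mapping.keys p. Poly_Mapping.lookup (Poly_Mapping.single m (Poly_Mapping.lookup p m)) k)
      = (\<Sum>m\<in>Poly_Mapping.keys p. if m = k then Poly_Mapping.lookup p k else 0)"
    by (intro sum.cong) (auto simp: lookup_single when_def)
  then show "Poly_Mapping.lookup (\<Sum>m\<in>Poly_Mapping.keys p. Poly_Mapping.single m (Poly_Mapping.lookup p m)) k
      = Poly_Mapping.lookup p k"
    by (simp add: lookup_sum in_keys_iff)
qed

lemma mpoly_eval_mult:
  fixes x :: "'a::comm_ring_1 ^ 'n::finite"
  shows "mpoly_eval x (p * q) = mpoly_eval x p * mpoly_eval x q"
proof -
  let ?s = "\<lambda>p m. Poly_Mapping.single m (Poly_Mapping.lookup p m)"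
  have single: "mpoly_eval x (?s p m * ?s q n) = mpoly_eval x (?s p m) * mpoly_eval x (?s q n)" for m n
    unfolding mult_single mpoly_eval_single by (simp add: lookup_add power_add prod.distrib mult_ac)
  have "p * q = (\<Sum>m\<in>Poly_Mapping.keys p. ?s p m) * (\<Sum>n\<in>Poly_Mapping.keys q. ?s q n)"
    by (simp only: sum_single_lookup)
  then have "mpoly_eval x (p * q) = (\<Sum>m\<in>Poly_Mapping.keys p. mpoly_eval x (?s p m)) *
      (\<Sum>n\<in>Poly_Mapping.keys q. mpoly_eval x (?s q n))"
    by (simp only: sum_product mpoly_eval_sum single)
  also have "\<dots> = mpoly_eval x p * mpoly_eval x q"
    unfolding mpoly_eval_sum[symmetric] sum_single_lookup ..
  finally show ?thesis .
qed

lemma mpoly_eval_const: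
  fixes x :: "'a::comm_ring_1 ^ 'n::finite"
  shows "mpoly_eval x (mpoly_const c) = c"
  by (simp add: mpoly_const_def mpoly_eval_single)

lemma mpoly_eval_mon:
  fixes x :: "'a::comm_ring_1 ^ 'n::finite"
  shows "mpoly_eval x (mon V \<alpha> f) = mon V \<alpha> (\<lambda>j. mpoly_eval x (f j))"
proof -
  have pow: "mpoly_eval x (p ^ n) = mpoly_eval x p ^ n" for p n
    by (induction n) (simp_all add: mpoly_eval_one mpoly_eval_mult)
  show ?thesis unfolding mon_def
    by (induction V rule: infinite_finite_induct) (simp_all add: mpoly_eval_one mpoly_eval_mult pow)
qed

lemma zero_locus_ideal_gen:
  fixes F :: "('n::finite, 'a::comm_ring_1) mpoly set"
  shows "zero_locus (ideal_gen F) = {x. \<forall>p\<in>F. mpoly_eval x p = 0}"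
proof -
  interpret ring_module: module "(*) :: ('n, 'a) mpoly \<Rightarrow> _" by (rule module_ring_mult)
  have "mpoly_eval x p = 0" if "\<forall>q\<in>F. mpoly_eval x q = 0" "p \<in> ring_module.span F" for x p
    using that(2)
    by (induction rule: ring_module.span_induct_alt)
       (use that(1) in \<open>auto simp: mpoly_eval_zero mpoly_eval_add mpoly_eval_mult\<close>)
  then show ?thesis
    unfolding zero_locus_def ideal_gen_def using ring_module.span_base by blast
qed

text \<open>When \<open>m \<le> r + 1\<close> the random system is square triangular, up to zero rows, hence invertible unless a
  diagonal coefficient vanishes.\<close>

lemma good_coefficients:
  fixes f :: "nat \<Rightarrow> ('n::finite, 'k::alg_closed_field) mpoly"
  assumes "2 \<le> d" "\<And>j. j \<in> {1..m} \<Longrightarrow> total_degree (f j) \<le> d" "trdeg (f ` {1..m}) = r"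
  defines "T \<equiv> SIGMA i:{1..r+1}. {i..m}"
  shows "\<exists>R C. polyfun (d ^ ((r + 1) * m)) R \<and> R C \<noteq> 0 \<and> (\<forall>v. v \<notin> T \<longrightarrow> C v = 0) \<and>
    (\<forall>C x. (\<forall>v. v \<notin> T \<longrightarrow> C v = 0) \<longrightarrow> R C \<noteq> 0 \<longrightarrow>
      (\<forall>i\<in>{1..r+1}. (\<Sum>j\<in>{1..m}. C (i, j) * mpoly_eval x (f j)) = 0) \<longrightarrow>
      (\<forall>j\<in>{1..m}. mpoly_eval x (f j) = 0))"
proof (cases "r + 2 \<le> m")
  case True
  define N where "N = 2 * (r + 1) * d ^ r"
  define \<delta> where "\<delta> = 2 * (m - 1) * N - 1"
  have "0 < d" using assms(1) by simp
  have \<delta>: "\<delta> + 1 = 2 * (m - 1) * N"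
    using True \<open>0 < d\<close> by (simp add: \<delta>_def N_def)
  have "2 * 1 * N \<le> 2 * (m - 1) * N" using True by (intro mult_le_mono) auto
  moreover have "0 < N" using \<open>0 < d\<close> by (simp add: N_def)
  ultimately have N\<delta>: "N \<le> \<delta>" using \<delta> by linarith
  obtain H where H: "finite H" "card H \<le> (d * N + r) choose r" "filt {1..m} f N \<subseteq> mpv.span H"
    using filt_dimension_le[OF _ assms(2,3), of N] by blast
  have spanH: "(\<lambda>x. mon {1..m} \<gamma> (\<lambda>j. mpoly_eval x (f j))) \<in> comb H (\<lambda>h x. mpoly_eval x h)"
    if "\<gamma> \<in> exps {1..m} N" for \<gamma>
  proof -
    have "\<gamma> \<in> exps_le {1..m} N" using that by (simp add: exps_def exps_le_def)
    then have "mon {1..m} \<gamma> f \<in> mpv.span H" using mon_in_filt H(3) by blast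
    then obtain u where u: "mon {1..m} \<gamma> f = (\<Sum>h\<in>H. mpoly_const (u h) * h)"
      unfolding mpv.span_finite[OF H(1)] by blast
    have "mon {1..m} \<gamma> (\<lambda>j. mpoly_eval x (f j)) = (\<Sum>h\<in>H. u h * mpoly_eval x h)" for x
      unfolding mpoly_eval_mon[symmetric] u by (simp add: mpoly_eval_sum mpoly_eval_mult mpoly_eval_const)
    then show ?thesis unfolding comb_def by blast
  qed
  define Rw where "Rw = {1..r+1}"
  have Rw: "finite Rw" "r + 2 \<notin> Rw" "card Rw = r + 1" by (simp_all add: Rw_def)
  have "card (exps {1..m} \<delta>) ^ (r + 2) * card H \<le> card (exps {1..m} \<delta>) ^ (r + 2) * ((d * N + r) choose r)"
    using H(2) by (intro mult_le_mono) auto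
  also have "\<dots> < card (SIGMA a:exps (insert (r + 2) Rw) N. PiE (insert (r + 2) Rw) (\<lambda>i. exps {1..m} (\<delta> - a i)))"
    using Rw True \<open>0 < d\<close> by (intro monomial_count[OF _ _ _ _ N_def \<delta>]) auto
  finally have count: "card (exps {1..m} \<delta>) ^ Suc (card Rw) * card H
      < card (SIGMA a:exps (insert (r + 2) Rw) N. PiE (insert (r + 2) Rw) (\<lambda>i. exps {1..m} (\<delta> - a i)))"
    by (simp add: Rw(3))
  have "\<exists>R C. polyfun (card Rw * \<delta>) R \<and> R C \<noteq> 0 \<and>
    (\<forall>C x. R C \<noteq> 0 \<longrightarrow> (\<forall>i\<in>Rw. (\<Sum>j\<in>{1..m}. C (i, j) * mpoly_eval x (f j)) = 0) \<longrightarrow>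
      (\<forall>j\<in>{1..m}. mpoly_eval x (f j) = 0))"
    by (rule generic_forms[OF infinite_alg_closed Rw(1,2) N\<delta> H(1) _ count]) (rule spanH)
  then obtain R C where "polyfun (card Rw * \<delta>) R" "R C \<noteq> 0"
    and good: "\<forall>C x. R C \<noteq> 0 \<longrightarrow> (\<forall>i\<in>Rw. (\<Sum>j\<in>{1..m}. C (i, j) * mpoly_eval x (f j)) = 0) \<longrightarrow>
      (\<forall>j\<in>{1..m}. mpoly_eval x (f j) = 0)" by (elim exE conjE)
  moreover have "card Rw * \<delta> \<le> d ^ ((r + 1) * m)"
    using degree_bound[OF assms(1) True] \<delta> by (simp add: N_def Rw(3))
  ultimately have R: "polyfun (d ^ ((r + 1) * m)) R" "R C \<noteq> 0" using polyfun_mono by auto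
  have "\<exists>R C. polyfun (d ^ ((r + 1) * m)) R \<and> R C \<noteq> 0 \<and> (\<forall>v. v \<notin> T \<longrightarrow> C v = 0) \<and>
    (\<forall>C x. R C \<noteq> 0 \<longrightarrow> (\<forall>i\<in>{1..r+1}. (\<Sum>j\<in>{1..m}. C (i, j) * mpoly_eval x (f j)) = 0) \<longrightarrow>
      (\<forall>j\<in>{1..m}. mpoly_eval x (f j) = 0))"
    unfolding T_def
    by (rule triangular_forms[OF infinite_alg_closed _ R]) (use True good in \<open>auto simp: Rw_def\<close>)
  then show ?thesis by blast
next
  case False
  then have m: "m \<le> r + 1" by simp
  define R where "R C = (\<Prod>i\<in>{1..m}. C (i, i))" for C :: "nat \<times> nat \<Rightarrow> 'k"
  define C\<^sub>0 where "C\<^sub>0 v = (if v \<in> T then 1 else (0 :: 'k))" for v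
  have "polyfun (\<Sum>i\<in>{1..m}. Suc 0) R"
    unfolding R_def by (intro polyfun_prod polyfun.var)
  moreover have "m \<le> d ^ ((r + 1) * m)"
  proof -
    have "m \<le> 2 ^ m" using less_exp[of m] by simp
    also have "\<dots> \<le> d ^ m" using assms(1) by (intro power_mono) auto
    also have "\<dots> \<le> d ^ ((r + 1) * m)" using assms(1) by (intro power_increasing) auto
    finally show ?thesis .
  qed
  ultimately have "polyfun (d ^ ((r + 1) * m)) R" by (auto elim: polyfun_mono)
  moreover have "R C\<^sub>0 \<noteq> 0" using m by (auto simp: R_def C\<^sub>0_def T_def)
  moreover have "\<forall>v. v \<notin> T \<longrightarrow> C\<^sub>0 v = 0" by (simp add: C\<^sub>0_def)
  moreover have "\<forall>j\<in>{1..m}. mpoly_eval x (f j) = 0"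
    if C: "\<forall>v. v \<notin> T \<longrightarrow> C v = 0" "R C \<noteq> 0"
      and zero: "\<forall>i\<in>{1..r+1}. (\<Sum>j\<in>{1..m}. C (i, j) * mpoly_eval x (f j)) = 0" for C x
  proof -
    \<comment> \<open>Back substitution from the last row upwards; \<open>k\<close> is the distance
      from \<open>m\<close>.\<close>
    have *: "mpoly_eval x (f (m - k)) = 0" if "k < m" for k
      using that
    proof (induction k rule: less_induct)
      case (less k)
      define i where "i = m - k"
      have i: "i \<in> {1..m}" using less.prems by (auto simp: i_def)
      have "C (i, j) * mpoly_eval x (f j) = 0" if j: "j \<in> {1..m} - {i}" for j
      proof (cases "j < i")
        case True
        then show ?thesis using C(1) by (simp add: T_def)
      next
        case False
        then have "m - j < k" "m - (m - j) = j" "m - j < m" using j less.prems by (auto simp: i_def)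
        then show ?thesis using less.IH[of "m - j"] by simp
      qed
      then have "(\<Sum>j\<in>{1..m} - {i}. C (i, j) * mpoly_eval x (f j)) = 0" by (intro sum.neutral) blast
      then have "(\<Sum>j\<in>{1..m}. C (i, j) * mpoly_eval x (f j)) = C (i, i) * mpoly_eval x (f i)"
        using sum.remove[OF _ i, of "\<lambda>j. C (i, j) * mpoly_eval x (f j)"] by simp
      then have "C (i, i) * mpoly_eval x (f i) = 0" using zero i m by auto
      moreover have "C (i, i) \<noteq> 0" using C(2) i by (auto simp: R_def)
      ultimately show ?case by (simp add: i_def)
    qed
    show ?thesis
    proof
      fix j assume "j \<in> {1..m}"
      then have "m - j < m" "m - (m - j) = j" by auto
      then show "mpoly_eval x (f j) = 0" using *[of "m - j"] by simp
    qed
  qed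
  ultimately show ?thesis by blast
qed

theorem theorem3p2:
  fixes f :: "nat \<Rightarrow> ('n::finite, 'k::alg_closed_field) mpoly"
    and S :: "'k set"
    and m d r :: nat
  assumes "2 \<le> d"
    and "\<And>j. j \<in> {1..m} \<Longrightarrow> total_degree (f j) \<le> d"
    and "trdeg (f ` {1..m}) = r"
    and "finite S" and "S \<noteq> {}"
  shows "measure_pmf.prob (random_coeffs S (r + 1) m)
           {c. zero_locus (ideal_gen (f ` {1..m})) =
               zero_locus (ideal_gen (lin_comb f m c ` {1..r + 1}))}
         \<ge> 1 - real d ^ ((r + 1) * m) / real (card S)"
proof -
  define T where "T = (SIGMA i:{1..r+1}. {i..m})"
  define M where "M = random_coeffs S (r + 1) m"
  have finT: "finite T" unfolding T_def by (intro finite_SigmaI) auto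
  have M: "M = Pi_pmf T 0 (\<lambda>_. pmf_of_set S)" by (simp add: M_def random_coeffs_def T_def)
  let ?E = "{c. zero_locus (ideal_gen (f ` {1..m})) = zero_locus (ideal_gen (lin_comb f m c ` {1..r + 1}))}"
  have "\<exists>R C. polyfun (d ^ ((r + 1) * m)) R \<and> R C \<noteq> 0 \<and> (\<forall>v. v \<notin> T \<longrightarrow> C v = 0) \<and>
    (\<forall>C x. (\<forall>v. v \<notin> T \<longrightarrow> C v = 0) \<longrightarrow> R C \<noteq> 0 \<longrightarrow>
      (\<forall>i\<in>{1..r+1}. (\<Sum>j\<in>{1..m}. C (i, j) * mpoly_eval x (f j)) = 0) \<longrightarrow>
      (\<forall>j\<in>{1..m}. mpoly_eval x (f j) = 0))"
    unfolding T_def by (rule good_coefficients[OF assms(1) _ assms(3)]) (rule assms(2))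
  then obtain R C where R: "polyfun (d ^ ((r + 1) * m)) R" "R C \<noteq> 0" "\<forall>v. v \<notin> T \<longrightarrow> C v = 0"
    and good: "\<forall>C x. (\<forall>v. v \<notin> T \<longrightarrow> C v = 0) \<longrightarrow> R C \<noteq> 0 \<longrightarrow>
      (\<forall>i\<in>{1..r+1}. (\<Sum>j\<in>{1..m}. C (i, j) * mpoly_eval x (f j)) = 0) \<longrightarrow>
      (\<forall>j\<in>{1..m}. mpoly_eval x (f j) = 0)"
    by (elim exE conjE)
  have "measure_pmf.prob M {c. R c = 0} \<le> real (d ^ ((r + 1) * m)) / real (card S)"
    unfolding M using R(3) by (intro prob_polyfun_zero[OF finT assms(4,5) R(1,2)]) blast
  then have "1 - real d ^ ((r + 1) * m) / real (card S) \<le> 1 - measure_pmf.prob M {c. R c = 0}" by simp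
  also have "\<dots> = measure_pmf.prob M {c. R c \<noteq> 0}"
    using measure_pmf.prob_compl[of "{c. R c = 0}" M] by (simp add: Compl_eq_Diff_UNIV[symmetric] Collect_neg_eq)
  also have "\<dots> \<le> measure_pmf.prob M ?E"
  proof (rule measure_pmf.finite_measure_mono_AE)
    show "AE c in measure_pmf M. c \<in> {c. R c \<noteq> 0} \<longrightarrow> c \<in> ?E"
    proof (intro AE_pmfI impI CollectI)
      fix c assume c: "c \<in> set_pmf M" "c \<in> {c. R c \<noteq> 0}"
      have supp: "\<forall>v. v \<notin> T \<longrightarrow> c v = 0"
        using c(1) set_Pi_pmf_subset[OF finT] unfolding M by (fastforce simp: PiE_dflt_def)
      \<comment> \<open>Entries left of the diagonal are 0 on the support, so the triangular sums
        equal full row sums.\<close>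
      have form: "mpoly_eval x (lin_comb f m c i) = (\<Sum>j\<in>{1..m}. c (i, j) * mpoly_eval x (f j))"
        if "i \<in> {1..r+1}" for i x
      proof -
        have "mpoly_eval x (lin_comb f m c i) = (\<Sum>j\<in>{i..m}. c (i, j) * mpoly_eval x (f j))"
          by (simp add: lin_comb_def mpoly_eval_sum mpoly_eval_mult mpoly_eval_const)
        also have "\<dots> = (\<Sum>j\<in>{1..m}. c (i, j) * mpoly_eval x (f j))"
          using that supp by (intro sum.mono_neutral_left) (auto simp: T_def)
        finally show ?thesis .
      qed
      \<comment> \<open>From left to right this is linearity; the converse is where
        \<open>R c \<noteq> 0\<close> is used.\<close>
      have "(\<forall>j\<in>{1..m}. mpoly_eval x (f j) = 0) \<longleftrightarrow> (\<forall>i\<in>{1..r+1}. mpoly_eval x (lin_comb f m c i) = 0)" for x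
        using good supp c(2) form by auto
      then show "zero_locus (ideal_gen (f ` {1..m})) = zero_locus (ideal_gen (lin_comb f m c ` {1..r + 1}))"
        unfolding zero_locus_ideal_gen by auto
    qed
  qed simp
  finally show ?thesis unfolding M_def .
qed

end
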